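(* Let $d\ge 1$, $d<\beta<2d$, and let $f$ be a probability density on $\mathbb{R}_+$ such that $f(r)\sim C_\beta r^{-\beta-1}$ as $r\to+\infty$ for some constant $C_\beta>0$, and $r^{\beta+1}f(r)\le C_0$ for all $r$ for some constant $C_0$. For every $\rho>0$ let $\phi_\rho$ be a stationary determinantal point process on $\mathbb{R}^d$ with kernel $K_\rho(x,y)=K_\rho(x-y)$ with respect to Lebesgue measure, and assume: (a) the operator $\mathbf{K}_\rho g(x)=\int_{\mathbb{R}^d}K_\rho(x,y)g(y)\,dy$ is a bounded symmetric integral operator on $L^2(\mathbb{R}^d,dx)$ with spectrum included in $[0,1[$, and it is locally trace-class (for every compact $\Lambda\subset\mathbb{R}^d$ its restriction to $L^2(\Lambda,dx)$ is trace-class); (b) $K_\rho(0)=\lambda(\rho)K(0)$ with $\lim_{\rho\to0}\lambda(\rho)=+\infty$; (c) $\int_{\mathbb{R}^d}|K_\rho(x)|^2\,dx=\mathcal{O}(\lambda(\rho))$ as $\rho\to0$. Suppose $\lambda(\rho)\rho^\beta\to a^{d-\beta}\in\,]0,+\infty[$ as $\rho\to0$, where $a>0$. Then, as $\rho\to0$, the field $\widetilde M_\rho(\cdot)$ converges in the sense of finite-dimensional distributions on the space $\mathcal{M}_\beta^+$ to $\widetilde P\circ D_a(\cdot)$, where $$\widetilde P(\mu)=\int_{\mathbb{R}^d\times\mathbb{R}_+}\mu\big(B(x,r)\big)\,\widetilde\Pi(dx,dr),$$ $\widetilde\Pi$ is a compensated Poisson random measure on $\mathbb{R}^d\times\mathbb{R}_+$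 with intensity measure $K(0)C_\beta r^{-\beta-1}\,dx\,dr$, and $D_a$ is the dilatation defined by $(D_a\mu)(B)=\mu(a^{-1}B)$ for Borel sets $B\subset\mathbb{R}^d$.
   Context: $B(x,r)=\{y\in\mathbb{R}^d:\|y-x\|\le r\}$ is the Euclidean ball. Determinantal point process (Dpp): a simple point process $\xi$ on a Polish space $E$ is a Dpp with kernel $K$ with respect to a Radon measure $\lambda$ if for all $k\ge1$ and all mutually disjoint Borel sets $D_1,\dots,D_k\subset E$, $\mathbb{E}[\prod_{i=1}^k\xi(D_i)]=\int_{\prod_i D_i}\rho_k(x_1,\dots,x_k)\,\lambda(dx_1)\cdots\lambda(dx_k)$ with $\rho_k(x_1,\dots,x_k)=\det(K(x_i,x_j))_{1\le i,j\le k}$. $K(0)$ is the value at $0$ of the kernel $K(x,y)=K(x-y)$ of a fixed (unscaled) stationary Dpp $\phi$ on $\mathbb{R}^d$; the same letter denotes the two-variable kernel and the one-variable function. $\Phi_\rho$ is the marked point process on $\mathbb{R}^d\times\mathbb{R}_+$ obtained by attaching to the points of $\phi_\rho$ i.i.d. marks (radii), independent of $\phi_\rho$, with density $r\mapsto f(r/\rho)/\rho$. It is identified with the random measure $\sum_{(X,R)\in\Phi_\rho}\delta_{(X,R)}$. It is a Dpp with kernel $\widehat K_\rho((x,r),(y,s))=\sqrt{f(r/\rho)/\rho}\,K_\rho(x,y)\sqrt{f(s/\rho)/\rho}$ with respect to Lebesgue measure. Put $$M_\rho(\mu)=\int_{\mathbb{R}^d\times\mathbb{R}_+}\mu(B(x,r))\,\Phi_\rho(dx,dr),\qquad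 \widetilde M_\rho(\mu)=M_\rho(\mu)-\mathbb{E}[M_\rho(\mu)].$$ $\mathcal{M}_\beta^+$ is the set of finite positive compactly supported measures $\mu$ on $\mathbb{R}^d$ for which there exist real numbers $p,q$ with $0<p<\beta<q\le 2d$ and a constant $C_\mu>0$ such that $\int_{\mathbb{R}^d}\mu(B(x,r))^2\,dx\le C_\mu\,\min(r^p,r^q)$ for all $r$. *)

theory Defs
  imports
    "HOL-Probability.Probability"
    "HOL-Library.Landau_Symbols"
    "Jordan_Normal_Form.Determinant"
begin

section \<open>Point processes\<close>

text \<open>On a Polish space a Borel measure is Radon iff it is locally finite.\<close>

definition locally_finite :: "'e::polish_space measure \<Rightarrow> bool" where
  "locally_finite m \<longleftrightarrow>
     sets m = sets borel \<and> (\<forall>x. \<exists>U. open U \<and> x \<in> U \<and> emeasure m U < \<infinity>)"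

definition simple_point_process ::
    "'w measure \<Rightarrow> ('w \<Rightarrow> 'e::polish_space measure) \<Rightarrow> bool" where
  "simple_point_process M \<xi> \<longleftrightarrow>
     prob_space M \<and>
     (\<forall>\<omega>\<in>space M.
        locally_finite (\<xi> \<omega>) \<and>
        (\<forall>B\<in>sets borel. emeasure (\<xi> \<omega>) B \<in> range ennreal_of_enat) \<and>
        (\<forall>x. emeasure (\<xi> \<omega>) {x} \<le> 1)) \<and>
     (\<forall>B\<in>sets borel. (\<lambda>\<omega>. emeasure (\<xi> \<omega>) B) \<in> borel_measurable M)"

definition correlation_det :: "('e \<Rightarrow> 'e \<Rightarrow> complex) \<Rightarrow> nat \<Rightarrow> (nat \<Rightarrow> 'e) \<Rightarrow> complex" where
  "correlation_det k n x = Determinant.det (Matrix.mat n n (\<lambda>(i, j). k (x i) (x j)))"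

text \<open>Both sides of the defining identity may be infinite when the sets \<open>D i\<close> are unbounded, so it
  is stated in the extended nonnegative reals. The almost everywhere nonnegativity of the
  determinants is what makes the right-hand side the integral of the determinant itself, and
  not merely of the positive part of its real part.\<close>

definition determinantal ::
    "'w measure \<Rightarrow> ('w \<Rightarrow> 'e::polish_space measure) \<Rightarrow> ('e \<Rightarrow> 'e \<Rightarrow> complex) \<Rightarrow> 'e measure \<Rightarrow> bool" where
  "determinantal M \<xi> k m \<longleftrightarrow>
     simple_point_process M \<xi> \<and> locally_finite m \<and>
     case_prod k \<in> borel_measurable (borel \<Otimes>\<^sub>M borel) \<and>
     (\<forall>n\<ge>1.
        (AE x in (\<Pi>\<^sub>M i\<in>{..<n}. m). correlation_det k n x \<in> \<real>\<^sub>\<ge>\<^sub>0) \<and>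
        (\<forall>D. (\<forall>i<n. D i \<in> sets borel) \<and> disjoint_family_on D {..<n} \<longrightarrow>
           (\<integral>\<^sup>+\<omega>. (\<Prod>i<n. emeasure (\<xi> \<omega>) (D i)) \<partial>M) =
           (\<integral>\<^sup>+x. ennreal (Re (correlation_det k n x)) * indicator (Pi\<^sub>E {..<n} D) x
              \<partial>(\<Pi>\<^sub>M i\<in>{..<n}. m))))"

text \<open>The law of a random measure is its image in the product space of all evaluations
  on Borel sets.\<close>

definition stationary ::
    "'w measure \<Rightarrow> ('w \<Rightarrow> 'a::euclidean_space measure) \<Rightarrow> bool" where
  "stationary M \<xi> \<longleftrightarrow>
     (\<forall>v. distr M (\<Pi>\<^sub>M B\<in>sets borel. borel) (\<lambda>\<omega>. \<lambda>B\<in>sets borel. emeasure (\<xi> \<omega>) ((+) v ` B)) =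
          distr M (\<Pi>\<^sub>M B\<in>sets borel. borel) (\<lambda>\<omega>. \<lambda>B\<in>sets borel. emeasure (\<xi> \<omega>) B))"

text \<open>\<open>X 0, X 1, \<dots>\<close> (the first \<open>N\<close> of them, with \<open>N\<close> possibly infinite) enumerate the points
  of \<open>\<phi>\<close>, and \<open>R i\<close> is the mark of \<open>X i\<close>. The product form of the joint law says that
  the \<open>R i\<close> are i.i.d. with law \<open>\<nu>\<close> and independent of the enumerated process.\<close>

definition iid_marking ::
    "'w measure \<Rightarrow> ('w \<Rightarrow> 'a::euclidean_space measure) \<Rightarrow> real measure \<Rightarrow>
     ('w \<Rightarrow> ('a \<times> real) measure) \<Rightarrow> bool" where
  "iid_marking M \<phi> \<nu> \<Phi> \<longleftrightarrow>
     (\<exists>(N :: 'w \<Rightarrow> enat) (X :: nat \<Rightarrow> 'w \<Rightarrow> 'a) (R :: nat \<Rightarrow> 'w \<Rightarrow> real).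
        N \<in> measurable M (count_space UNIV) \<and>
        (\<forall>i. X i \<in> borel_measurable M) \<and> (\<forall>i. R i \<in> borel_measurable M) \<and>
        distr M ((count_space UNIV \<Otimes>\<^sub>M (\<Pi>\<^sub>M i\<in>UNIV. borel)) \<Otimes>\<^sub>M (\<Pi>\<^sub>M i\<in>UNIV. borel))
            (\<lambda>\<omega>. ((N \<omega>, \<lambda>i. X i \<omega>), \<lambda>i. R i \<omega>)) =
          distr M (count_space UNIV \<Otimes>\<^sub>M (\<Pi>\<^sub>M i\<in>UNIV. borel)) (\<lambda>\<omega>. (N \<omega>, \<lambda>i. X i \<omega>))
            \<Otimes>\<^sub>M (\<Pi>\<^sub>M i\<in>UNIV. \<nu>) \<and>
        (\<forall>\<omega>\<in>space M.
           sets (\<Phi> \<omega>) = sets borel \<and>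
           (\<forall>B\<in>sets borel.
              emeasure (\<phi> \<omega>) B = (\<Sum>i. if enat i < N \<omega> then indicator B (X i \<omega>) else 0)) \<and>
           (\<forall>B\<in>sets borel.
              emeasure (\<Phi> \<omega>) B =
                (\<Sum>i. if enat i < N \<omega> then indicator B (X i \<omega>, R i \<omega>) else 0))))"


section \<open>Operators on complex \<open>L\<^sup>2\<close> spaces\<close>

text \<open>Elements of \<open>L\<^sup>2\<close> are represented by functions; operators act on representatives, and
  equality is almost everywhere equality.\<close>

definition L2 :: "'a measure \<Rightarrow> ('a \<Rightarrow> complex) set" where
  "L2 m = {g \<in> borel_measurable m. integrable m (\<lambda>x. (cmod (g x))\<^sup>2)}"

definition L2_inner :: "'a measure \<Rightarrow> ('a \<Rightarrow> complex) \<Rightarrow> ('a \<Rightarrow> complex) \<Rightarrow> complex" where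
  "L2_inner m g h = (LINT x|m. g x * cnj (h x))"

definition L2_norm :: "'a measure \<Rightarrow> ('a \<Rightarrow> complex) \<Rightarrow> real" where
  "L2_norm m g = sqrt (LINT x|m. (cmod (g x))\<^sup>2)"

definition L2_bounded_operator ::
    "'a measure \<Rightarrow> (('a \<Rightarrow> complex) \<Rightarrow> 'a \<Rightarrow> complex) \<Rightarrow> bool" where
  "L2_bounded_operator m T \<longleftrightarrow>
     (\<forall>g\<in>L2 m. T g \<in> L2 m) \<and>
     (\<forall>g\<in>L2 m. \<forall>h\<in>L2 m. \<forall>b c.
        AE x in m. T (\<lambda>y. b * g y + c * h y) x = b * T g x + c * T h x) \<and>
     (\<exists>C. \<forall>g\<in>L2 m. L2_norm m (T g) \<le> C * L2_norm m g)"

definition L2_symmetric :: "'a measure \<Rightarrow> (('a \<Rightarrow> complex) \<Rightarrow> 'a \<Rightarrow> complex) \<Rightarrow> bool" where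
  "L2_symmetric m T \<longleftrightarrow> (\<forall>g\<in>L2 m. \<forall>h\<in>L2 m. L2_inner m (T g) h = L2_inner m g (T h))"

text \<open>\<open>z\<close> is in the resolvent set iff \<open>T - z\<close> is bounded below and onto, that is, bijective
  with bounded inverse.\<close>

definition L2_spectrum :: "'a measure \<Rightarrow> (('a \<Rightarrow> complex) \<Rightarrow> 'a \<Rightarrow> complex) \<Rightarrow> complex set" where
  "L2_spectrum m T = - {z.
     (\<exists>C. \<forall>g\<in>L2 m. L2_norm m g \<le> C * L2_norm m (\<lambda>x. T g x - z * g x)) \<and>
     (\<forall>h\<in>L2 m. \<exists>g\<in>L2 m. AE x in m. T g x - z * g x = h x)}"

definition L2_orthonormal_basis :: "'a measure \<Rightarrow> nat set \<Rightarrow> (nat \<Rightarrow> 'a \<Rightarrow> complex) \<Rightarrow> bool" where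
  "L2_orthonormal_basis m I e \<longleftrightarrow>
     (\<forall>i\<in>I. e i \<in> L2 m) \<and>
     (\<forall>i\<in>I. \<forall>j\<in>I. L2_inner m (e i) (e j) = (if i = j then 1 else 0)) \<and>
     (\<forall>g\<in>L2 m. (\<forall>i\<in>I. L2_inner m g (e i) = 0) \<longrightarrow> (AE x in m. g x = 0))"

text \<open>\<open>S\<close> is the absolute value of \<open>T\<close>: the positive operator with \<open>S\<^sup>2 = T\<^sup>* T\<close>, the latter
  written with inner products. The trace of the positive operator \<open>S\<close> does not depend on the
  orthonormal basis.\<close>

definition L2_absolute_value ::
    "'a measure \<Rightarrow> (('a \<Rightarrow> complex) \<Rightarrow> 'a \<Rightarrow> complex) \<Rightarrow> (('a \<Rightarrow> complex) \<Rightarrow> 'a \<Rightarrow> complex) \<Rightarrow> bool" where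
  "L2_absolute_value m T S \<longleftrightarrow>
     L2_bounded_operator m S \<and>
     (\<forall>g\<in>L2 m. L2_inner m (S g) g \<in> \<real>\<^sub>\<ge>\<^sub>0) \<and>
     (\<forall>g\<in>L2 m. \<forall>h\<in>L2 m. L2_inner m (S (S g)) h = L2_inner m (T g) (T h))"

definition L2_trace_class :: "'a measure \<Rightarrow> (('a \<Rightarrow> complex) \<Rightarrow> 'a \<Rightarrow> complex) \<Rightarrow> bool" where
  "L2_trace_class m T \<longleftrightarrow>
     L2_bounded_operator m T \<and>
     (\<exists>S I e. L2_absolute_value m T S \<and> L2_orthonormal_basis m I e \<and>
        (\<lambda>i. Re (L2_inner m (S (e i)) (e i))) summable_on I)"

definition integral_operator ::
    "'a measure \<Rightarrow> ('a \<Rightarrow> 'a \<Rightarrow> complex) \<Rightarrow> ('a \<Rightarrow> complex) \<Rightarrow> 'a \<Rightarrow> complex" where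
  "integral_operator m k g x = (LINT y|m. k x y * g y)"

text \<open>The Bochner integral of a non-integrable function is 0; hence the explicit condition that
  the defining integrals exist.\<close>

definition is_L2_integral_kernel :: "'a measure \<Rightarrow> ('a \<Rightarrow> 'a \<Rightarrow> complex) \<Rightarrow> bool" where
  "is_L2_integral_kernel m k \<longleftrightarrow>
     case_prod k \<in> borel_measurable (m \<Otimes>\<^sub>M m) \<and>
     (\<forall>g\<in>L2 m. AE x in m. integrable m (\<lambda>y. k x y * g y))"

text \<open>The restriction of an integral operator to \<open>L\<^sup>2(\<Lambda>)\<close> is the integral operator with the same
  kernel with respect to the restricted measure.\<close>

definition locally_trace_class :: "('a::euclidean_space \<Rightarrow> 'a \<Rightarrow> complex) \<Rightarrow> bool" where
  "locally_trace_class k \<longleftrightarrow>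
     (\<forall>\<Lambda>. compact \<Lambda> \<longrightarrow>
        L2_trace_class (restrict_space lborel \<Lambda>) (integral_operator (restrict_space lborel \<Lambda>) k))"


section \<open>Compensated Poisson integrals\<close>

definition poisson_random_measure ::
    "'v measure \<Rightarrow> 'e measure \<Rightarrow> ('v \<Rightarrow> 'e measure) \<Rightarrow> bool" where
  "poisson_random_measure N m Q \<longleftrightarrow>
     prob_space N \<and>
     (\<forall>\<omega>\<in>space N. sets (Q \<omega>) = sets m) \<and>
     (\<forall>B\<in>sets m. (\<lambda>\<omega>. emeasure (Q \<omega>) B) \<in> borel_measurable N) \<and>
     (\<forall>B\<in>sets m. emeasure m B < \<infinity> \<longrightarrow>
        (\<forall>n. measure N {\<omega> \<in> space N. emeasure (Q \<omega>) B = of_nat n} =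
             measure m B ^ n / fact n * exp (- measure m B))) \<and>
     (\<forall>B\<in>sets m. emeasure m B = \<infinity> \<longrightarrow> (AE \<omega> in N. emeasure (Q \<omega>) B = \<infinity>)) \<and>
     (\<forall>(I :: nat set) B. finite I \<and> (\<forall>i\<in>I. B i \<in> sets m) \<and> disjoint_family_on B I \<longrightarrow>
        prob_space.indep_vars N (\<lambda>_. borel) (\<lambda>i \<omega>. emeasure (Q \<omega>) (B i)) I)"

text \<open>\<open>g\<close> need only be square integrable, so \<open>\<integral> g dQ\<close> and \<open>\<integral> g dm\<close> may both diverge; the
  compensated integral is the \<open>L\<^sup>2\<close>-isometric extension from the functions that are also
  integrable. It is determined up to almost sure equality.\<close>

definition is_compensated_integral ::
    "'v measure \<Rightarrow> 'e measure \<Rightarrow> ('v \<Rightarrow> 'e measure) \<Rightarrow> ('e \<Rightarrow> real) \<Rightarrow> ('v \<Rightarrow> real) \<Rightarrow> bool" where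
  "is_compensated_integral N m Q g Y \<longleftrightarrow>
     g \<in> borel_measurable m \<and> Y \<in> borel_measurable N \<and>
     (\<exists>G :: nat \<Rightarrow> 'e \<Rightarrow> real.
        (\<forall>n. integrable m (G n) \<and> integrable m (\<lambda>z. (G n z)\<^sup>2)) \<and>
        (\<lambda>n. \<integral>\<^sup>+z. ennreal ((G n z - g z)\<^sup>2) \<partial>m) \<longlonglongrightarrow> 0 \<and>
        (\<lambda>n. \<integral>\<^sup>+\<omega>. ennreal (((LINT z|Q \<omega>. G n z) - (LINT z|m. G n z) - Y \<omega>)\<^sup>2) \<partial>N)
          \<longlonglongrightarrow> 0)"

definition compensated_integral ::
    "'v measure \<Rightarrow> 'e measure \<Rightarrow> ('v \<Rightarrow> 'e measure) \<Rightarrow> ('e \<Rightarrow> real) \<Rightarrow> 'v \<Rightarrow> real" where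
  "compensated_integral N m Q g = (SOME Y. is_compensated_integral N m Q g Y)"


section \<open>The random balls model\<close>

definition mark_law :: "(real \<Rightarrow> real) \<Rightarrow> real \<Rightarrow> real measure" where
  "mark_law f \<rho> = density lborel (\<lambda>r. ennreal (f (r / \<rho>) / \<rho>))"

definition ball_mass :: "'a::euclidean_space measure \<Rightarrow> 'a \<times> real \<Rightarrow> real" where
  "ball_mass \<mu> = (\<lambda>(x, r). measure \<mu> (cball x r))"

definition mass_field ::
    "('w \<Rightarrow> ('a::euclidean_space \<times> real) measure) \<Rightarrow> 'a measure \<Rightarrow> 'w \<Rightarrow> real" where
  "mass_field \<Phi> \<mu> \<omega> = (LINT z|\<Phi> \<omega>. ball_mass \<mu> z)"

definition centered_mass_field ::
    "'w measure \<Rightarrow> ('w \<Rightarrow> ('a::euclidean_space \<times> real) measure) \<Rightarrow> 'a measure \<Rightarrow> 'w \<Rightarrow> real" where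
  "centered_mass_field M \<Phi> \<mu> \<omega> = mass_field \<Phi> \<mu> \<omega> - (LINT \<omega>'|M. mass_field \<Phi> \<mu> \<omega>')"

definition admissible_measures :: "real \<Rightarrow> 'a::euclidean_space measure set" where
  "admissible_measures \<beta> = {\<mu>.
     sets \<mu> = sets borel \<and> finite_measure \<mu> \<and> (\<exists>S. compact S \<and> emeasure \<mu> (- S) = 0) \<and>
     (\<exists>p q C. 0 < p \<and> p < \<beta> \<and> \<beta> < q \<and> q \<le> 2 * real DIM('a) \<and> 0 < C \<and>
        (\<forall>r\<ge>0. (\<integral>\<^sup>+x. (emeasure \<mu> (cball x r))\<^sup>2 \<partial>lborel)
                   \<le> ennreal (C * min (r powr p) (r powr q))))}"

definition dilatation :: "real \<Rightarrow> 'a::euclidean_space measure \<Rightarrow> 'a measure" where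
  "dilatation a \<mu> = distr \<mu> borel (\<lambda>x. a *\<^sub>R x)"

definition limit_intensity :: "real \<Rightarrow> real \<Rightarrow> ('a::euclidean_space \<times> real) measure" where
  "limit_intensity c \<beta> =
     density lborel (\<lambda>(x, r). ennreal (c * r powr (- \<beta> - 1)) * indicator {0<..} r)"

definition poisson_field ::
    "'v measure \<Rightarrow> ('a::euclidean_space \<times> real) measure \<Rightarrow> ('v \<Rightarrow> ('a \<times> real) measure) \<Rightarrow>
     'a measure \<Rightarrow> 'v \<Rightarrow> real" where
  "poisson_field N m Q \<mu> = compensated_integral N m Q (ball_mass \<mu>)"

text \<open>The random elements \<open>X \<rho>\<close> may live on different probability spaces.\<close>

definition converges_in_distribution ::
    "('i \<Rightarrow> 'w measure) \<Rightarrow> ('i \<Rightarrow> 'w \<Rightarrow> 'b::topological_space) \<Rightarrow> 'i filter \<Rightarrow>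
     'v measure \<Rightarrow> ('v \<Rightarrow> 'b) \<Rightarrow> bool" where
  "converges_in_distribution M X F N Y \<longleftrightarrow>
     (\<forall>\<^sub>F \<rho> in F. X \<rho> \<in> borel_measurable (M \<rho>)) \<and> Y \<in> borel_measurable N \<and>
     (\<forall>h :: 'b \<Rightarrow> real. continuous_on UNIV h \<and> bounded (range h) \<longrightarrow>
        ((\<lambda>\<rho>. LINT \<omega>|M \<rho>. h (X \<rho> \<omega>)) \<longlongrightarrow> (LINT \<omega>|N. h (Y \<omega>))) F)"

end

theory Submission
  imports Defs
begin

text \<open>Write \<open>h(x,r)\<close> for the ball mass of a linear combination of the test measures, and
  \<open>u(x)\<close> for the mean of \<open>exp(i h(x,R)) - 1\<close> over the mark \<open>R\<close>. Given the points \<open>X\<close> of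
  \<open>\<phi>\<^sub>\<rho>\<close>, the characteristic function of the marked sum is the product of the factors
  \<open>1 + u(X)\<close>, each of modulus at most 1, which differs from \<open>exp(\<Sum> u(X))\<close> by at most a multiple
  of \<open>\<Sum> |u(X)|\<^sup>2\<close>. Only the first two correlation functions are needed to see that
  \<open>\<Sum> u(X)\<close> has mean \<open>K\<^sub>\<rho>(0) \<integral> u\<close> and variance of order
  \<open>(K\<^sub>\<rho>(0) + \<integral> |K\<^sub>\<rho>|\<^sup>2) \<integral> |u|\<^sup>2\<close>; by (b) and (c) this is \<open>O(\<lambda>(\<rho>) \<integral> |u|\<^sup>2)\<close>, and it
  tends to 0 by a weighted Cauchy-Schwarz inequality in the radius. So determinantal points have
  the same limit as Poisson points: the centred characteristic function is asymptotically
  \<open>exp(K\<^sub>\<rho>(0) \<integral> (exp(i h) - 1 - i h))\<close>, whose exponent converges by dominated convergence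
  because \<open>\<lambda>(\<rho>) f(r/\<rho>)/\<rho>\<close> tends to \<open>a\<^sup>d\<^sup>-\<^sup>\<beta> C\<^sub>\<beta> r\<^sup>-\<^sup>\<beta>\<^sup>-\<^sup>1\<close>. The dilatation absorbs
  the factor \<open>a\<^sup>d\<^sup>-\<^sup>\<beta>\<close>.\<close>

text \<open>The intensity r^(-\<beta>-1) dx dr integrates the square of a ball mass, but not the
  ball mass itself: its integral diverges at r = 0 because d < \<beta>. The mean of the field
  therefore blows up, centring has to be absorbed into the exponent before any limit is taken, and
  every error must be controlled by second-order quantities. Two facts make this possible. Since 1 +
  u lies in the unit disc, u lies in the left half-plane, where exp is 1-Lipschitz, and products of
  numbers in the disc are 1-Lipschitz in each factor; errors are thus not amplified, although the
  number of points is infinite or growing. Moreover |u(x)| is at most the mean of |h(x,R)|, and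
  Cauchy-Schwarz with weight r^d bounds the integral of |u|^2 by a constant times \<rho>^q, the
  constant containing the moments of f of orders d and q - d. Both moments are finite because d <
  \<beta> and q - d \<le> d < \<beta>; this is the purpose of q \<le> 2d. Finally \<lambda>(\<rho>)
  \<rho>^q = (\<lambda>(\<rho>) \<rho>^\<beta>) \<rho>^(q-\<beta>) tends to 0 because q >
  \<beta>.\<close>

no_notation Matrix.scalar_prod (infix "\<bullet>" 70)

section \<open>The continuity theorem in Euclidean spaces\<close>

text \<open>The complex linear span of the characters. The inductive form turns convergence of
  expectations into a rule induction, and since characters multiply to characters the span is an
  algebra: polynomials in its members remain in it.\<close>

inductive_set trigonometric :: "('b::real_inner \<Rightarrow> complex) set" where
  iexp: "(\<lambda>x. iexp (t \<bullet> x)) \<in> trigonometric"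
| scale: "F \<in> trigonometric \<Longrightarrow> (\<lambda>x. c * F x) \<in> trigonometric"
| add: "F \<in> trigonometric \<Longrightarrow> G \<in> trigonometric \<Longrightarrow> (\<lambda>x. F x + G x) \<in> trigonometric"

lemma trigonometric_mult:
  assumes "F \<in> trigonometric" "G \<in> trigonometric"
  shows "(\<lambda>x. F x * G x) \<in> trigonometric"
  using assms(1)
proof induction
  case (iexp t)
  show ?case using assms(2)
  proof induction
    case (iexp s)
    have "(\<lambda>x. iexp ((t + s) \<bullet> x)) \<in> trigonometric"
      by (rule trigonometric.iexp)
    then show ?case
      by (simp add: inner_add_left ring_distribs exp_add)
  next
    case (scale F c)
    from trigonometric.scale[OF scale.IH, of c] show ?case
      by (simp add: algebra_simps)
  next
    case (add F G)
    from trigonometric.add[OF add.IH] show ?case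
      by (simp add: algebra_simps)
  qed
next
  case (scale F c)
  from trigonometric.scale[OF scale.IH, of c] show ?case
    by (simp add: algebra_simps)
next
  case (add F G)
  from trigonometric.add[OF add.IH] show ?case
    by (simp add: algebra_simps)
qed

lemma trigonometric_const: "(\<lambda>x. c) \<in> trigonometric"
  using trigonometric.scale[OF trigonometric.iexp[of 0], of c] by simp

lemma trigonometric_sum:
  "finite I \<Longrightarrow> (\<And>i. i \<in> I \<Longrightarrow> F i \<in> trigonometric) \<Longrightarrow> (\<lambda>x. \<Sum>i\<in>I. F i x) \<in> trigonometric"
  by (induction rule: finite_induct) (auto intro: trigonometric.add trigonometric_const)

lemma trigonometric_sin: "(\<lambda>x. complex_of_real (sin (t \<bullet> x))) \<in> trigonometric"
proof -
  have "complex_of_real (sin y) = (- \<i> / 2) * iexp y + (\<i> / 2) * iexp (- y)" for y :: real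
    by (simp add: sin_exp_eq sin_of_real[symmetric] field_simps)
  then have "(\<lambda>x. complex_of_real (sin (t \<bullet> x))) =
      (\<lambda>x. (- \<i> / 2) * iexp (t \<bullet> x) + (\<i> / 2) * iexp ((- t) \<bullet> x))"
    by simp
  then show ?thesis
    by (simp only:) (intro trigonometric.intros)
qed

lemma trigonometric_measurable:
  "F \<in> trigonometric \<Longrightarrow> F \<in> borel_measurable (borel :: 'b::euclidean_space measure)"
  by (induction rule: trigonometric.induct) auto

lemma trigonometric_bounded:
  "F \<in> trigonometric \<Longrightarrow> \<exists>B. \<forall>x. cmod (F x) \<le> B"
proof (induction rule: trigonometric.induct)
  case (iexp t)
  show ?case by (intro exI[of _ 1]) simp
next
  case (scale F c)
  then obtain B where "\<And>x. cmod (F x) \<le> B" by blast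
  then show ?case
    by (intro exI[of _ "cmod c * B"]) (simp add: norm_mult mult_left_mono)
next
  case (add F G)
  then obtain B B' where "\<And>x. cmod (F x) \<le> B" "\<And>x. cmod (G x) \<le> B'" by blast
  then show ?case
    by (intro exI[of _ "B + B'"]) (meson add_mono norm_triangle_ineq order_trans)
qed

lemma trigonometric_integrable:
  fixes X :: "'w \<Rightarrow> 'b::euclidean_space"
  assumes "F \<in> trigonometric" "prob_space M" "X \<in> borel_measurable M"
  shows "integrable M (\<lambda>\<omega>. F (X \<omega>))"
proof -
  interpret prob_space M by fact
  from trigonometric_bounded[OF assms(1)] obtain B where "\<And>x. cmod (F x) \<le> B" by blast
  then show ?thesis
    using measurable_compose[OF assms(3) trigonometric_measurable[OF assms(1)]]
    by (intro integrable_const_bound[where B = B]) auto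
qed

lemma tendsto_expectation_trigonometric:
  fixes X :: "nat \<Rightarrow> 'w \<Rightarrow> 'b::euclidean_space"
  assumes F: "F \<in> trigonometric"
    and M: "\<And>n. prob_space (M n)" "\<And>n. X n \<in> borel_measurable (M n)"
    and N: "prob_space N" "Y \<in> borel_measurable N"
    and char: "\<And>t. (\<lambda>n. LINT \<omega>|M n. iexp (t \<bullet> X n \<omega>)) \<longlonglongrightarrow> (LINT \<omega>|N. iexp (t \<bullet> Y \<omega>))"
  shows "(\<lambda>n. LINT \<omega>|M n. F (X n \<omega>)) \<longlonglongrightarrow> (LINT \<omega>|N. F (Y \<omega>))"
  using F
proof induction
  case (iexp t)
  show ?case by (rule char)
next
  case (scale F c)
  from tendsto_mult_left[OF scale.IH] show ?case by simp
next
  case (add F G)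
  note int = trigonometric_integrable[OF _ M] trigonometric_integrable[OF _ N]
  from tendsto_add[OF add.IH] show ?case
    by (simp add: int add.hyps)
qed

text \<open>Polynomials in x itself are unbounded and not linear combinations of characters. A
  coordinatewise sine confines the argument of a polynomial to a compact cube on the whole space and
  keeps every coordinate in the trigonometric algebra.\<close>

definition sine_clip :: "real \<Rightarrow> 'b::euclidean_space \<Rightarrow> 'b" where
  "sine_clip c x = (\<Sum>b\<in>Basis. sin (c * (x \<bullet> b)) *\<^sub>R b)"

lemma sine_clip_inner: "b \<in> Basis \<Longrightarrow> sine_clip c x \<bullet> b = sin (c * (x \<bullet> b))"
  by (simp add: sine_clip_def inner_sum_left inner_Basis if_distrib sum.If_cases cong: if_cong)

lemma sine_clip_in_cbox: "sine_clip c x \<in> cbox (- One) One"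
  by (auto simp: mem_box sine_clip_inner)

lemma trigonometric_polynomial_sine_clip:
  fixes p :: "'b::euclidean_space \<Rightarrow> real"
  assumes "real_polynomial_function p"
  shows "(\<lambda>x. complex_of_real (p (sine_clip c x))) \<in> trigonometric"
  using assms
proof induction
  case (linear f)
  interpret bounded_linear f by fact
  have "(\<lambda>x. \<Sum>b\<in>Basis. complex_of_real (f b) * complex_of_real (sin ((c *\<^sub>R b) \<bullet> x))) \<in> trigonometric"
    by (intro trigonometric_sum trigonometric.scale trigonometric_sin) auto
  moreover have "complex_of_real (f (sine_clip c x)) =
      (\<Sum>b\<in>Basis. complex_of_real (f b) * complex_of_real (sin ((c *\<^sub>R b) \<bullet> x)))" for x
    unfolding sine_clip_def sum scaleR
    by (simp add: inner_commute mult.commute)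
  ultimately show ?case by simp
next
  case (const a)
  show ?case by (rule trigonometric_const)
next
  case (add f g)
  from trigonometric.add[OF add.IH] show ?case by simp
next
  case (mult f g)
  from trigonometric_mult[OF mult.IH] show ?case by simp
qed

text \<open>The one-dimensional Levy theorem gives weak convergence, and weak convergence to a
  probability law forces tightness. Applied to coordinates, this provides the cube outside which
  little mass lies, uniformly for large n.\<close>

lemma tight_of_char_convergence:
  fixes X :: "nat \<Rightarrow> 'w \<Rightarrow> real"
  assumes M: "\<And>n. prob_space (M n)" "\<And>n. X n \<in> borel_measurable (M n)"
    and N: "prob_space N" "Y \<in> borel_measurable N"
    and char: "\<And>t. (\<lambda>n. LINT \<omega>|M n. iexp (t * X n \<omega>)) \<longlonglongrightarrow> (LINT \<omega>|N. iexp (t * Y \<omega>))"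
    and "\<epsilon> > 0"
  shows "\<exists>L. (\<forall>\<^sub>F n in sequentially. measure (M n) {\<omega>\<in>space (M n). \<bar>X n \<omega>\<bar> > L} \<le> \<epsilon>) \<and>
    measure N {\<omega>\<in>space N. \<bar>Y \<omega>\<bar> > L} \<le> \<epsilon>"
proof -
  note [measurable] = M(2) N(2)
  interpret M: prob_space "M n" for n by fact
  interpret N: prob_space N by fact
  interpret DX: real_distribution "distr (M n) borel (X n)" for n
    by (rule M.real_distribution_distr) measurable
  interpret DY: real_distribution "distr N borel Y"
    by (rule N.real_distribution_distr) measurable
  have "weak_conv_m (\<lambda>n. distr (M n) borel (X n)) (distr N borel Y)"
    by (rule levy_continuity)
      (use char in \<open>auto simp: char_def integral_distr DX.real_distribution_axioms DY.real_distribution_axioms\<close>)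
  then have conv: "(\<lambda>n. LINT x|distr (M n) borel (X n). g x) \<longlonglongrightarrow> (LINT x|distr N borel Y. g x)"
    if "\<And>x. isCont g x" "\<And>x. \<bar>g x\<bar> \<le> 1" for g :: "real \<Rightarrow> real"
    using weak_conv_imp_integral_bdd_continuous_conv[of "\<lambda>n. distr (M n) borel (X n)" "distr N borel Y" g 1]
      DX.real_distribution_axioms DY.real_distribution_axioms that by auto
  have "(\<lambda>k. measure N {\<omega>\<in>space N. \<bar>Y \<omega>\<bar> > real k}) \<longlonglongrightarrow> measure N (\<Inter>k. {\<omega>\<in>space N. \<bar>Y \<omega>\<bar> > real k})"
    by (rule N.finite_Lim_measure_decseq) (auto simp: decseq_def)
  also have "(\<Inter>k. {\<omega>\<in>space N. \<bar>Y \<omega>\<bar> > real k}) = {}"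
    by auto (meson reals_Archimedean2 not_less_iff_gr_or_eq)
  finally have "\<forall>\<^sub>F k in sequentially. measure N {\<omega>\<in>space N. \<bar>Y \<omega>\<bar> > real k} < \<epsilon>"
    using \<open>\<epsilon> > 0\<close> by (auto dest: order_tendstoD)
  then obtain k where k: "measure N {\<omega>\<in>space N. \<bar>Y \<omega>\<bar> > real k} < \<epsilon>"
    by (auto simp: eventually_sequentially)
  \<comment> \<open>A continuous ramp squeezed between the indicators of |x| > k + 1 and |x| > k:
    the lower one measures the tail of \<open>X n\<close>, the upper one is already small for
    \<open>Y\<close>.\<close>
  define g where "g = (\<lambda>x. min 1 (max 0 (\<bar>x\<bar> - real k)))"
  have g: "isCont g x" "\<bar>g x\<bar> \<le> 1" for x
    unfolding g_def by (auto intro!: continuous_intros)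
  have [measurable]: "g \<in> borel_measurable borel"
    unfolding g_def by measurable
  have "(LINT \<omega>|N. g (Y \<omega>)) \<le> (LINT \<omega>|N. indicator {\<omega>\<in>space N. \<bar>Y \<omega>\<bar> > real k} \<omega>)"
    by (intro integral_mono N.integrable_const_bound[where B = 1])
      (auto simp: g_def split: split_indicator)
  also have "\<dots> < \<epsilon>" using k by simp
  finally have "(LINT \<omega>|N. g (Y \<omega>)) < \<epsilon>" .
  moreover have "(\<lambda>n. LINT \<omega>|M n. g (X n \<omega>)) \<longlonglongrightarrow> (LINT \<omega>|N. g (Y \<omega>))"
    using conv[OF g] by (simp add: integral_distr)
  ultimately have "\<forall>\<^sub>F n in sequentially. (LINT \<omega>|M n. g (X n \<omega>)) < \<epsilon>"
    by (auto dest: order_tendstoD)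
  moreover have "measure (M n) {\<omega>\<in>space (M n). \<bar>X n \<omega>\<bar> > real k + 1} \<le> (LINT \<omega>|M n. g (X n \<omega>))" for n
  proof -
    have "(LINT \<omega>|M n. indicator {\<omega>\<in>space (M n). \<bar>X n \<omega>\<bar> > real k + 1} \<omega>) \<le> (LINT \<omega>|M n. g (X n \<omega>))"
      by (intro integral_mono M.integrable_const_bound[where B = 1])
        (auto simp: g_def split: split_indicator)
    then show ?thesis by simp
  qed
  moreover have "measure N {\<omega>\<in>space N. \<bar>Y \<omega>\<bar> > real k + 1} \<le> \<epsilon>"
    by (rule order_trans[OF N.finite_measure_mono less_imp_le[OF k]]) auto
  ultimately show ?thesis
    by (intro exI[of _ "real k + 1"]) (auto elim!: eventually_mono intro: order_trans less_imp_le)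
qed

text \<open>On \<open>S\<close> the two functions differ by at most \<epsilon>. Elsewhere they
  differ by at most 2 B + \<epsilon>, and the excess 2 B is paid only with probability
  \<delta>.\<close>

lemma expectation_approximation_outside_small_set:
  fixes g h :: "'b::euclidean_space \<Rightarrow> real"
  assumes M: "prob_space M" "X \<in> borel_measurable M"
    and [measurable]: "g \<in> borel_measurable borel" "h \<in> borel_measurable borel" "S \<in> sets borel"
    and B: "\<And>x. \<bar>h x\<bar> \<le> B" "\<And>x. \<bar>g x\<bar> \<le> B + \<epsilon>" and in_S: "\<And>x. x \<in> S \<Longrightarrow> \<bar>h x - g x\<bar> \<le> \<epsilon>"
    and out_S: "measure M {\<omega>\<in>space M. X \<omega> \<notin> S} \<le> \<delta>" and "\<epsilon> > 0"
  shows "\<bar>(LINT \<omega>|M. h (X \<omega>)) - (LINT \<omega>|M. g (X \<omega>))\<bar> \<le> \<epsilon> + 2 * B * \<delta>"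
proof -
  interpret prob_space M by fact
  note [measurable] = M(2)
  have B0: "0 \<le> B" using B(1)[of 0] by linarith
  have int: "integrable M (\<lambda>\<omega>. h (X \<omega>))" "integrable M (\<lambda>\<omega>. g (X \<omega>))"
    using B by (auto intro: integrable_const_bound[where B = B] integrable_const_bound[where B = "B + \<epsilon>"])
  have "\<bar>(LINT \<omega>|M. h (X \<omega>)) - (LINT \<omega>|M. g (X \<omega>))\<bar> = \<bar>LINT \<omega>|M. h (X \<omega>) - g (X \<omega>)\<bar>"
    using int by simp
  also have "\<dots> \<le> (LINT \<omega>|M. \<bar>h (X \<omega>) - g (X \<omega>)\<bar>)"
    by (rule integral_abs_bound)
  also have "\<dots> \<le> (LINT \<omega>|M. \<epsilon> + 2 * B * indicator {\<omega>\<in>space M. X \<omega> \<notin> S} \<omega>)"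
  proof (intro integral_mono)
    fix \<omega> assume "\<omega> \<in> space M"
    show "\<bar>h (X \<omega>) - g (X \<omega>)\<bar> \<le> \<epsilon> + 2 * B * indicator {\<omega>\<in>space M. X \<omega> \<notin> S} \<omega>"
      using in_S[of "X \<omega>"] B(1)[of "X \<omega>"] B(2)[of "X \<omega>"] \<open>\<omega> \<in> space M\<close>
      by (auto split: split_indicator)
  qed (use int B0 \<open>\<epsilon> > 0\<close> in \<open>auto intro!: integrable_const_bound[where B = "\<epsilon> + 2 * B"] split: split_indicator\<close>)
  also have "\<dots> = \<epsilon> + 2 * B * measure M {\<omega>\<in>space M. X \<omega> \<notin> S}"
    using integrable_real_indicator[of "{\<omega>\<in>space M. X \<omega> \<notin> S}" M]
    by (subst Bochner_Integration.integral_add) (auto simp: prob_space less_top[symmetric])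
  also have "\<dots> \<le> \<epsilon> + 2 * B * \<delta>"
    using out_S B0 by (intro add_left_mono mult_left_mono) auto
  finally show ?thesis .
qed

text \<open>Outside a large cube the trigonometric polynomials approximating \<open>h\<close> must stay bounded. For
  this, \<open>h\<close> is written on the cube \<open>[-L, L]\<^sup>d\<close> as a function of \<open>sin (c x\<^sub>b)\<close> with \<open>c = pi / (2 L)\<close>,
  and this function is approximated by a polynomial on \<open>[-1, 1]\<^sup>d\<close>.\<close>

theorem levy_continuity_euclidean:
  fixes X :: "nat \<Rightarrow> 'w \<Rightarrow> 'b::euclidean_space" and h :: "'b \<Rightarrow> real"
  assumes M: "\<And>n. prob_space (M n)" "\<And>n. X n \<in> borel_measurable (M n)"
    and N: "prob_space N" "Y \<in> borel_measurable N"
    and char: "\<And>t. (\<lambda>n. LINT \<omega>|M n. iexp (t \<bullet> X n \<omega>)) \<longlonglongrightarrow> (LINT \<omega>|N. iexp (t \<bullet> Y \<omega>))"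
    and h: "continuous_on UNIV h" "bounded (range h)"
  shows "(\<lambda>n. LINT \<omega>|M n. h (X n \<omega>)) \<longlonglongrightarrow> (LINT \<omega>|N. h (Y \<omega>))"
proof (rule tendstoI)
  fix e :: real assume "e > 0"
  note [measurable] = M(2) N(2)
  interpret M: prob_space "M n" for n by fact
  interpret N: prob_space N by fact
  have [measurable]: "h \<in> borel_measurable borel"
    by (rule borel_measurable_continuous_onI) (rule h)
  from h(2) obtain B where B: "\<And>x. \<bar>h x\<bar> \<le> B" "B > 0"
    by (auto simp: bounded_pos)
  \<comment> \<open>Replacing \<open>h\<close> by \<open>q\<close> costs \<epsilon> + 2 B \<delta> =
    e/4 for each of the two laws, and the expectations of \<open>q\<close> differ by less than
    \<epsilon> = e/8; the total 5e/8 is below e.\<close>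
  define \<delta> where "\<delta> = e / (16 * B)"
  define \<epsilon> where "\<epsilon> = e / 8"
  have "\<delta> > 0" "\<epsilon> > 0" using \<open>e > 0\<close> B by (auto simp: \<delta>_def \<epsilon>_def)
  define \<delta>' where "\<delta>' = \<delta> / DIM('b)"
  have "\<delta>' > 0" using \<open>\<delta> > 0\<close> by (simp add: \<delta>'_def)
  have "\<forall>b\<in>Basis. \<exists>L. (\<forall>\<^sub>F n in sequentially. measure (M n) {\<omega>\<in>space (M n). \<bar>X n \<omega> \<bullet> b\<bar> > L} \<le> \<delta>') \<and>
    measure N {\<omega>\<in>space N. \<bar>Y \<omega> \<bullet> b\<bar> > L} \<le> \<delta>'"
  proof
    fix b :: 'b assume "b \<in> Basis"
    show "\<exists>L. (\<forall>\<^sub>F n in sequentially. measure (M n) {\<omega>\<in>space (M n). \<bar>X n \<omega> \<bullet> b\<bar> > L} \<le> \<delta>') \<and>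
      measure N {\<omega>\<in>space N. \<bar>Y \<omega> \<bullet> b\<bar> > L} \<le> \<delta>'"
    proof (rule tight_of_char_convergence)
      show "(\<lambda>n. LINT \<omega>|M n. iexp (t * (X n \<omega> \<bullet> b))) \<longlonglongrightarrow> (LINT \<omega>|N. iexp (t * (Y \<omega> \<bullet> b)))" for t
        using char[of "t *\<^sub>R b"] by (simp add: inner_commute)
    qed (use M N \<open>\<delta>' > 0\<close> in auto)
  qed
  from bchoice[OF this] obtain L where L: "\<And>b. b \<in> Basis \<Longrightarrow>
      \<forall>\<^sub>F n in sequentially. measure (M n) {\<omega>\<in>space (M n). \<bar>X n \<omega> \<bullet> b\<bar> > L b} \<le> \<delta>'"
    "\<And>b. b \<in> Basis \<Longrightarrow> measure N {\<omega>\<in>space N. \<bar>Y \<omega> \<bullet> b\<bar> > L b} \<le> \<delta>'"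
    by blast
  \<comment> \<open>One half-side that exceeds the thresholds of all coordinates; the summand 1
    keeps it positive.\<close>
  define r where "r = 1 + (\<Sum>b\<in>Basis. \<bar>L b\<bar>)"
  have r: "L b \<le> r" if "b \<in> Basis" for b
  proof -
    have "\<bar>L b\<bar> \<le> (\<Sum>b\<in>Basis. \<bar>L b\<bar>)" using that by (intro member_le_sum) auto
    then show ?thesis by (simp add: r_def)
  qed
  have "r > 0" by (auto simp: r_def intro!: add_pos_nonneg sum_nonneg)
  define S where "S = {x::'b. \<forall>b\<in>Basis. \<bar>x \<bullet> b\<bar> \<le> r}"
  have [measurable]: "S \<in> sets borel"
    unfolding S_def Ball_def
    by (intro borel_closed closed_Collect_all closed_Collect_imp closed_Collect_le continuous_intros) auto
  have outside: "measure P {\<omega>\<in>space P. Z \<omega> \<notin> S} \<le> \<delta>"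
    if P: "prob_space P" and [measurable]: "Z \<in> borel_measurable P"
      and *: "\<And>b. b \<in> Basis \<Longrightarrow> measure P {\<omega>\<in>space P. \<bar>Z \<omega> \<bullet> b\<bar> > L b} \<le> \<delta>'" for P :: "'z measure" and Z
  proof -
    interpret P: prob_space P by fact
    have "measure P {\<omega>\<in>space P. Z \<omega> \<notin> S} \<le> measure P (\<Union>b\<in>Basis. {\<omega>\<in>space P. \<bar>Z \<omega> \<bullet> b\<bar> > L b})"
    proof (intro P.finite_measure_mono subsetI)
      fix \<omega> assume "\<omega> \<in> {\<omega>\<in>space P. Z \<omega> \<notin> S}"
      then obtain b where b: "b \<in> Basis" "\<bar>Z \<omega> \<bullet> b\<bar> > r" and "\<omega> \<in> space P"
        by (auto simp: S_def not_le)
      then show "\<omega> \<in> (\<Union>b\<in>Basis. {\<omega>\<in>space P. \<bar>Z \<omega> \<bullet> b\<bar> > L b})"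
        using r[of b] by (intro UN_I[of b]) simp_all
    next
      show "(\<Union>b\<in>Basis. {\<omega>\<in>space P. \<bar>Z \<omega> \<bullet> b\<bar> > L b}) \<in> sets P"
        by (intro sets.finite_UN) simp_all
    qed
    also have "\<dots> \<le> (\<Sum>b\<in>Basis. measure P {\<omega>\<in>space P. \<bar>Z \<omega> \<bullet> b\<bar> > L b})"
      by (intro P.finite_measure_subadditive_finite image_subsetI) simp_all
    also have "\<dots> \<le> (\<Sum>b\<in>(Basis::'b set). \<delta>')"
      by (intro sum_mono *)
    also have "\<dots> = \<delta>" by (simp add: \<delta>'_def)
    finally show ?thesis .
  qed
  define c where "c = pi / (2 * r)"
  have "c > 0" using \<open>r > 0\<close> by (simp add: c_def)
  \<comment> \<open>This is \<open>h\<close> read in sine coordinates. It is continuous up to the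
    boundary of the cube because arcsin is, so Stone-Weierstrass applies to it there.\<close>
  define g where "g = (\<lambda>y. h (\<Sum>b\<in>Basis. (arcsin (y \<bullet> b) / c) *\<^sub>R b))"
  have "continuous_on (cbox (- One) One) g"
    unfolding g_def
    by (intro continuous_on_compose2[OF h(1)] continuous_intros)
      (use \<open>c > 0\<close> in \<open>auto simp: mem_box\<close>)
  then obtain p where p: "real_polynomial_function p" "\<And>y. y \<in> cbox (- One) One \<Longrightarrow> \<bar>g y - p y\<bar> < \<epsilon>"
    using Stone_Weierstrass_real_polynomial_function[of "cbox (- One) One" g \<epsilon>] \<open>\<epsilon> > 0\<close> by auto
  define q where "q = (\<lambda>x. p (sine_clip c x))"
  have q_trig: "(\<lambda>x. complex_of_real (q x)) \<in> trigonometric"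
    unfolding q_def by (rule trigonometric_polynomial_sine_clip) (rule p)
  from trigonometric_measurable[OF q_trig] have [measurable]: "q \<in> borel_measurable borel"
    unfolding borel_measurable_complex_iff by simp
  \<comment> \<open>Since \<open>sine_clip\<close> never leaves the cube, closeness of
    \<open>p\<close> to \<open>g\<close> bounds \<open>q\<close> also where \<open>q\<close> is
    unrelated to \<open>h\<close>.\<close>
  have q_bound: "\<bar>q x\<bar> \<le> B + \<epsilon>" for x
  proof -
    have "\<bar>g (sine_clip c x)\<bar> \<le> B" unfolding g_def by (rule B)
    with p(2)[OF sine_clip_in_cbox, of c x] show ?thesis unfolding q_def by linarith
  qed
  have q_S: "\<bar>h x - q x\<bar> \<le> \<epsilon>" if "x \<in> S" for x
  proof -
    have "arcsin (sine_clip c x \<bullet> b) / c = x \<bullet> b" if "b \<in> Basis" for b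
    proof -
      have "\<bar>x \<bullet> b\<bar> \<le> r" using \<open>x \<in> S\<close> that by (auto simp: S_def)
      then have "\<bar>c * (x \<bullet> b)\<bar> \<le> c * r" using \<open>c > 0\<close> by (simp add: abs_mult)
      also have "c * r = pi / 2" using \<open>r > 0\<close> by (simp add: c_def)
      finally have "arcsin (sin (c * (x \<bullet> b))) = c * (x \<bullet> b)"
        by (intro arcsin_sin) auto
      then show ?thesis using \<open>c > 0\<close> that by (simp add: sine_clip_inner)
    qed
    then have "g (sine_clip c x) = h x"
      unfolding g_def by (simp add: euclidean_representation cong: sum.cong)
    with p(2)[OF sine_clip_in_cbox, of c x] show ?thesis by (simp add: q_def)
  qed
  have "(\<lambda>n. LINT \<omega>|M n. complex_of_real (q (X n \<omega>))) \<longlonglongrightarrow> (LINT \<omega>|N. complex_of_real (q (Y \<omega>)))"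
    by (rule tendsto_expectation_trigonometric[OF q_trig]) (use M N char in auto)
  then have "(\<lambda>n. LINT \<omega>|M n. q (X n \<omega>)) \<longlonglongrightarrow> (LINT \<omega>|N. q (Y \<omega>))"
    by (simp add: tendsto_of_real_iff)
  then have "\<forall>\<^sub>F n in sequentially. dist (LINT \<omega>|M n. q (X n \<omega>)) (LINT \<omega>|N. q (Y \<omega>)) < \<epsilon>"
    using \<open>\<epsilon> > 0\<close> by (rule tendstoD)
  moreover have "\<forall>\<^sub>F n in sequentially. \<forall>b\<in>Basis. measure (M n) {\<omega>\<in>space (M n). \<bar>X n \<omega> \<bullet> b\<bar> > L b} \<le> \<delta>'"
    using L(1) by (intro eventually_ball_finite) auto
  ultimately show "\<forall>\<^sub>F n in sequentially. dist (LINT \<omega>|M n. h (X n \<omega>)) (LINT \<omega>|N. h (Y \<omega>)) < e"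
  proof eventually_elim
    case (elim n)
    have "\<bar>(LINT \<omega>|M n. h (X n \<omega>)) - (LINT \<omega>|M n. q (X n \<omega>))\<bar> \<le> \<epsilon> + 2 * B * \<delta>"
      by (rule expectation_approximation_outside_small_set[where S = S])
        (use elim M B q_bound q_S \<open>\<epsilon> > 0\<close> in \<open>auto intro!: outside\<close>)
    moreover have "\<bar>(LINT \<omega>|N. h (Y \<omega>)) - (LINT \<omega>|N. q (Y \<omega>))\<bar> \<le> \<epsilon> + 2 * B * \<delta>"
      by (rule expectation_approximation_outside_small_set[where S = S])
        (use L(2) N B q_bound q_S \<open>\<epsilon> > 0\<close> in \<open>auto intro!: outside\<close>)
    moreover have "2 * B * \<delta> = e / 8" using B by (simp add: \<delta>_def)
    ultimately show ?case
      using elim(1) \<open>e > 0\<close> unfolding dist_real_def \<epsilon>_def by linarith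
  qed
qed

section \<open>Compensated Poisson integrals\<close>

lemma poisson_moments:
  fixes l :: real
  shows "(\<lambda>n. l ^ n / fact n) sums exp l"
    and "(\<lambda>n. real n * (l ^ n / fact n)) sums (l * exp l)"
    and "(\<lambda>n. (real n)\<^sup>2 * (l ^ n / fact n)) sums ((l\<^sup>2 + l) * exp l)"
proof -
  show 0: "(\<lambda>n. l ^ n / fact n) sums exp l"
    using exp_converges[of l] by (simp add: scaleR_conv_of_real divide_inverse mult.commute)
  \<comment> \<open>Cancelling one factor of the factorial gives the mean; doing it twice gives the
    second moment. The missing term n = 0 vanishes in both series, so \<open>sums_Suc\<close>
    restores it for free.\<close>
  have Suc: "real (Suc n) * (l ^ Suc n / fact (Suc n)) = l * (l ^ n / fact n)" for n
    by (simp add: field_simps del: of_nat_Suc)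
  have "(\<lambda>n. real (Suc n) * (l ^ Suc n / fact (Suc n))) sums (l * exp l)"
    unfolding Suc by (intro sums_mult 0)
  from sums_Suc[OF this] show 1: "(\<lambda>n. real n * (l ^ n / fact n)) sums (l * exp l)"
    by simp
  have Suc2: "(real (Suc n))\<^sup>2 * (l ^ Suc n / fact (Suc n)) =
      l * (real n * (l ^ n / fact n)) + l * (l ^ n / fact n)" for n
  proof -
    have "(real (Suc n))\<^sup>2 * (l ^ Suc n / fact (Suc n)) = real (Suc n) * (real (Suc n) * (l ^ Suc n / fact (Suc n)))"
      by (simp only: power2_eq_square mult.assoc)
    also have "\<dots> = real (Suc n) * (l * (l ^ n / fact n))"
      by (simp only: Suc)
    also have "real (Suc n) * (l * q) = l * (real n * q) + l * q" for q
      by (simp add: algebra_simps)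
    finally show ?thesis .
  qed
  have "(\<lambda>n. (real (Suc n))\<^sup>2 * (l ^ Suc n / fact (Suc n))) sums (l * (l * exp l) + l * exp l)"
    unfolding Suc2 by (intro sums_add sums_mult 0 1)
  from sums_Suc[OF this] show "(\<lambda>n. (real n)\<^sup>2 * (l ^ n / fact n)) sums ((l\<^sup>2 + l) * exp l)"
    by (simp add: power2_eq_square algebra_simps)
qed

lemma (in prob_space) expectation_discrete:
  fixes F :: "nat \<Rightarrow> 'b::{banach, second_countable_topology}"
  assumes [measurable]: "T \<in> measurable M (count_space UNIV)"
    and p: "\<And>n. prob {\<omega>\<in>space M. T \<omega> = n} = p n"
    and sum: "summable (\<lambda>n. norm (F n) * p n)"
  shows "integrable M (\<lambda>\<omega>. F (T \<omega>))" "expectation (\<lambda>\<omega>. F (T \<omega>)) = (\<Sum>n. p n *\<^sub>R F n)"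
proof -
  have p0: "p n \<ge> 0" for n by (simp flip: p)
  have D: "distr M (count_space UNIV) T = density (count_space UNIV) (\<lambda>n. ennreal (p n))"
  proof (rule measure_eqI_countable[where A = UNIV])
    fix n :: nat
    have "emeasure (distr M (count_space UNIV) T) {n} = emeasure M {\<omega>\<in>space M. T \<omega> = n}"
      by (subst emeasure_distr) (auto simp: vimage_def Int_def conj_commute)
    then show "emeasure (distr M (count_space UNIV) T) {n} =
        emeasure (density (count_space UNIV) (\<lambda>n. ennreal (p n))) {n}"
      by (simp add: emeasure_eq_measure p emeasure_density nn_integral_count_space_indicator
        nn_integral_indicator_singleton)
  qed auto
  have int: "integrable (count_space UNIV) (\<lambda>n. p n *\<^sub>R F n)"
    using sum by (simp add: integrable_count_space_nat_iff p0 mult.commute)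
  then have "integrable (distr M (count_space UNIV) T) F"
    unfolding D by (subst integrable_density) (auto simp: p0)
  then show "integrable M (\<lambda>\<omega>. F (T \<omega>))"
    by (simp add: integrable_distr_eq)
  have "expectation (\<lambda>\<omega>. F (T \<omega>)) = integral\<^sup>L (distr M (count_space UNIV) T) F"
    by (simp add: integral_distr)
  also have "\<dots> = (\<Sum>n. p n *\<^sub>R F n)"
    unfolding D using int by (subst integral_density) (auto simp: p0 integral_count_space_nat)
  finally show "expectation (\<lambda>\<omega>. F (T \<omega>)) = (\<Sum>n. p n *\<^sub>R F n)" .
qed

locale poisson_random_measure_space =
  fixes N :: "'v measure" and m :: "'e measure" and Q :: "'v \<Rightarrow> 'e measure"
  assumes poisson: "poisson_random_measure N m Q"
begin

sublocale prob_space N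
  using poisson by (simp add: poisson_random_measure_def)

lemma sets_Q: "\<omega> \<in> space N \<Longrightarrow> sets (Q \<omega>) = sets m"
  using poisson by (simp add: poisson_random_measure_def)

lemma space_Q: "\<omega> \<in> space N \<Longrightarrow> space (Q \<omega>) = space m"
  using sets_Q by (rule sets_eq_imp_space_eq)

lemma measurable_Q: "\<omega> \<in> space N \<Longrightarrow> borel_measurable (Q \<omega>) = borel_measurable m"
  by (intro measurable_cong_sets sets_Q refl)

lemma measurable_emeasure_Q[measurable]:
  "B \<in> sets m \<Longrightarrow> (\<lambda>\<omega>. emeasure (Q \<omega>) B) \<in> borel_measurable N"
  using poisson by (simp add: poisson_random_measure_def)

lemma measurable_measure_Q[measurable]:
  "B \<in> sets m \<Longrightarrow> (\<lambda>\<omega>. measure (Q \<omega>) B) \<in> borel_measurable N"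
  unfolding measure_def by measurable

text \<open>The definition prescribes only the probabilities of natural values. As these add up to
  1, the count is almost surely natural and may be replaced by an integer-valued variable, whose
  expectations are series.\<close>

lemma poisson_count:
  assumes B: "B \<in> sets m" "emeasure m B < \<infinity>"
  obtains T :: "'v \<Rightarrow> nat" where "T \<in> measurable N (count_space UNIV)"
    "AE \<omega> in N. emeasure (Q \<omega>) B = of_nat (T \<omega>)"
    "\<And>n. prob {\<omega>\<in>space N. T \<omega> = n} = measure m B ^ n / fact n * exp (- measure m B)"
proof
  define T where "T = (\<lambda>\<omega>. nat \<lfloor>enn2real (emeasure (Q \<omega>) B)\<rfloor>)"
  note [measurable] = B(1)
  define A where "A n = {\<omega>\<in>space N. emeasure (Q \<omega>) B = of_nat n}" for n :: nat
  have prob_A: "prob (A n) = measure m B ^ n / fact n * exp (- measure m B)" for n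
    using poisson B by (simp add: poisson_random_measure_def A_def)
  have [measurable]: "A n \<in> sets N" for n
    unfolding A_def by measurable
  have "(\<lambda>n. prob (A n)) sums prob (\<Union>n. A n)"
    by (rule finite_measure_UNION) (auto simp: disjoint_family_on_def A_def)
  moreover have "(\<lambda>n. prob (A n)) sums 1"
    using sums_mult2[OF poisson_moments(1), of "measure m B" "exp (- measure m B)"]
    by (simp add: prob_A exp_minus)
  ultimately have "prob (\<Union>n. A n) = 1"
    by (rule sums_unique2)
  then have "AE \<omega> in N. \<omega> \<in> (\<Union>n. A n)"
    by (intro AE_prob_1)
  then show *: "AE \<omega> in N. emeasure (Q \<omega>) B = of_nat (T \<omega>)"
    by (rule AE_mp) (auto intro!: AE_I2 simp: A_def T_def ennreal_of_nat_eq_real_of_nat)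
  show [measurable]: "T \<in> measurable N (count_space UNIV)"
    unfolding T_def by measurable
  show "prob {\<omega>\<in>space N. T \<omega> = n} = measure m B ^ n / fact n * exp (- measure m B)" for n
    unfolding prob_A[symmetric]
    by (rule finite_measure_eq_AE) (use * in \<open>auto simp: A_def elim!: eventually_mono\<close>)
qed

lemma count_moments:
  assumes B: "B \<in> sets m" "emeasure m B < \<infinity>"
  shows "integrable N (\<lambda>\<omega>. measure (Q \<omega>) B)" "expectation (\<lambda>\<omega>. measure (Q \<omega>) B) = measure m B"
    "integrable N (\<lambda>\<omega>. (measure (Q \<omega>) B)\<^sup>2)"
    "expectation (\<lambda>\<omega>. (measure (Q \<omega>) B)\<^sup>2) = (measure m B)\<^sup>2 + measure m B"
    "expectation (\<lambda>\<omega>. iexp (c * measure (Q \<omega>) B)) = exp (measure m B * (iexp c - 1))"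
    "AE \<omega> in N. emeasure (Q \<omega>) B < \<infinity>"
proof -
  let ?l = "measure m B"
  from poisson_count[OF B] obtain T :: "'v \<Rightarrow> nat" where T[measurable]: "T \<in> measurable N (count_space UNIV)"
    and eq: "AE \<omega> in N. emeasure (Q \<omega>) B = of_nat (T \<omega>)"
    and p: "\<And>n. prob {\<omega>\<in>space N. T \<omega> = n} = ?l ^ n / fact n * exp (- ?l)" by blast
  have Z: "AE \<omega> in N. measure (Q \<omega>) B = real (T \<omega>)"
    using eq by eventually_elim (simp add: measure_def ennreal_of_nat_eq_real_of_nat)
  note [measurable] = B(1)
  show "AE \<omega> in N. emeasure (Q \<omega>) B < \<infinity>"
    using eq by eventually_elim (simp add: of_nat_less_top)
  note E = expectation_discrete[OF T p]
  have s1: "(\<lambda>n. real n * (?l ^ n / fact n * exp (- ?l))) sums ?l"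
    using sums_mult2[OF poisson_moments(2), of "?l" "exp (- ?l)"] by (simp add: exp_minus mult.assoc)
  have s2: "(\<lambda>n. (real n)\<^sup>2 * (?l ^ n / fact n * exp (- ?l))) sums (?l\<^sup>2 + ?l)"
    using sums_mult2[OF poisson_moments(3), of "?l" "exp (- ?l)"] by (simp add: exp_minus mult.assoc)
  have "integrable N (\<lambda>\<omega>. real (T \<omega>))" "expectation (\<lambda>\<omega>. real (T \<omega>)) = ?l"
    using E[of real] s1 by (auto simp: sums_iff mult.commute)
  moreover have *: "integrable N (\<lambda>\<omega>. real (T \<omega>)) = integrable N (\<lambda>\<omega>. measure (Q \<omega>) B)"
    by (intro integrable_cong_AE) (use Z in auto)
  moreover have "expectation (\<lambda>\<omega>. real (T \<omega>)) = expectation (\<lambda>\<omega>. measure (Q \<omega>) B)"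
    by (intro integral_cong_AE) (use Z in auto)
  ultimately show "integrable N (\<lambda>\<omega>. measure (Q \<omega>) B)" "expectation (\<lambda>\<omega>. measure (Q \<omega>) B) = ?l"
    by auto
  have "integrable N (\<lambda>\<omega>. (real (T \<omega>))\<^sup>2)" "expectation (\<lambda>\<omega>. (real (T \<omega>))\<^sup>2) = ?l\<^sup>2 + ?l"
    using E[of "\<lambda>n. (real n)\<^sup>2"] s2 by (auto simp: sums_iff mult.commute)
  moreover have *: "integrable N (\<lambda>\<omega>. (real (T \<omega>))\<^sup>2) = integrable N (\<lambda>\<omega>. (measure (Q \<omega>) B)\<^sup>2)"
    by (intro integrable_cong_AE) (use Z in auto)
  moreover have "expectation (\<lambda>\<omega>. (real (T \<omega>))\<^sup>2) = expectation (\<lambda>\<omega>. (measure (Q \<omega>) B)\<^sup>2)"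
    by (intro integral_cong_AE) (use Z in auto)
  ultimately show "integrable N (\<lambda>\<omega>. (measure (Q \<omega>) B)\<^sup>2)"
    "expectation (\<lambda>\<omega>. (measure (Q \<omega>) B)\<^sup>2) = ?l\<^sup>2 + ?l"
    by auto
  have "expectation (\<lambda>\<omega>. iexp (c * measure (Q \<omega>) B)) = expectation (\<lambda>\<omega>. iexp (c * real (T \<omega>)))"
    by (intro integral_cong_AE) (use Z in auto)
  also have "\<dots> = (\<Sum>n. (?l ^ n / fact n * exp (- ?l)) *\<^sub>R iexp (c * real n))"
    using E(2)[of "\<lambda>n. iexp (c * real n)"] sums_mult2[OF poisson_moments(1), of "?l" "exp (- ?l)"]
    by (simp add: sums_iff)
  also have "\<dots> = exp (?l * (iexp c - 1))"
  proof -
    have "(\<lambda>n. exp (- complex_of_real ?l) * ((?l * iexp c) ^ n /\<^sub>R fact n)) sums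
        (exp (- complex_of_real ?l) * exp (?l * iexp c))"
      by (intro sums_mult exp_converges)
    also have "exp (- complex_of_real ?l) * exp (?l * iexp c) = exp (?l * (iexp c - 1))"
      by (simp add: exp_add[symmetric] algebra_simps)
    also have "(\<lambda>n. exp (- complex_of_real ?l) * ((?l * iexp c) ^ n /\<^sub>R fact n)) =
        (\<lambda>n. (?l ^ n / fact n * exp (- ?l)) *\<^sub>R iexp (c * real n))"
      by (simp add: fun_eq_iff scaleR_conv_of_real power_mult_distrib exp_of_nat_mult[symmetric]
        exp_of_real[symmetric] field_simps)
    finally show ?thesis by (simp add: sums_iff)
  qed
  finally show "expectation (\<lambda>\<omega>. iexp (c * measure (Q \<omega>) B)) = exp (?l * (iexp c - 1))" .
qed

lemma emeasure_Q_mean: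
  assumes B: "B \<in> sets m"
  shows "(\<integral>\<^sup>+\<omega>. emeasure (Q \<omega>) B \<partial>N) = emeasure m B"
proof (cases "emeasure m B = \<infinity>")
  case True
  then have "AE \<omega> in N. emeasure (Q \<omega>) B = \<infinity>"
    using poisson B by (simp add: poisson_random_measure_def)
  then have "(\<integral>\<^sup>+\<omega>. emeasure (Q \<omega>) B \<partial>N) = (\<integral>\<^sup>+\<omega>. \<infinity> \<partial>N)"
    by (intro nn_integral_cong_AE)
  then show ?thesis by (simp add: True emeasure_space_1)
next
  case False
  then have fin: "emeasure m B < \<infinity>" by (simp add: less_top)
  note mom = count_moments[OF B fin]
  have "(\<integral>\<^sup>+\<omega>. emeasure (Q \<omega>) B \<partial>N) = (\<integral>\<^sup>+\<omega>. ennreal (measure (Q \<omega>) B) \<partial>N)"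
    using mom(6) by (intro nn_integral_cong_AE) (auto simp: emeasure_eq_ennreal_measure)
  also have "\<dots> = ennreal (measure m B)"
    using mom(1,2) by (subst nn_integral_eq_integral) auto
  finally show ?thesis using fin by (simp add: emeasure_eq_ennreal_measure)
qed

text \<open>Measurability in \<omega> is proved in the same induction as the formula, because the
  definition of a Poisson random measure provides it for single sets only.\<close>

lemma campbell:
  assumes "g \<in> borel_measurable m"
  shows "(\<lambda>\<omega>. \<integral>\<^sup>+z. g z \<partial>Q \<omega>) \<in> borel_measurable N \<and> (\<integral>\<^sup>+\<omega>. (\<integral>\<^sup>+z. g z \<partial>Q \<omega>) \<partial>N) = (\<integral>\<^sup>+z. g z \<partial>m)"
  using assms
proof (induction rule: borel_measurable_induct)
  case (cong f g)
  have "(\<integral>\<^sup>+z. f z \<partial>Q \<omega>) = (\<integral>\<^sup>+z. g z \<partial>Q \<omega>)" if "\<omega> \<in> space N" for \<omega>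
    using that cong by (intro nn_integral_cong) (simp add: space_Q)
  then show ?case
    using cong by (simp cong: nn_integral_cong measurable_cong)
next
  case (set A)
  have *: "(\<integral>\<^sup>+z. indicator A z \<partial>Q \<omega>) = emeasure (Q \<omega>) A" if "\<omega> \<in> space N" for \<omega>
    using that set by (simp add: sets_Q)
  show ?case
    using set emeasure_Q_mean[OF set] by (simp add: * cong: nn_integral_cong measurable_cong)
next
  case (mult u c)
  have *: "(\<integral>\<^sup>+z. c * u z \<partial>Q \<omega>) = c * (\<integral>\<^sup>+z. u z \<partial>Q \<omega>)" if "\<omega> \<in> space N" for \<omega>
    using that mult by (intro nn_integral_cmult) (simp add: measurable_Q)
  have [measurable]: "(\<lambda>\<omega>. \<integral>\<^sup>+z. u z \<partial>Q \<omega>) \<in> borel_measurable N"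
    using mult by blast
  show ?case
    using mult by (simp add: * nn_integral_cmult cong: nn_integral_cong measurable_cong)
next
  case (add u v)
  have *: "(\<integral>\<^sup>+z. v z + u z \<partial>Q \<omega>) = (\<integral>\<^sup>+z. v z \<partial>Q \<omega>) + (\<integral>\<^sup>+z. u z \<partial>Q \<omega>)" if "\<omega> \<in> space N" for \<omega>
    using that add by (intro nn_integral_add) (simp_all add: measurable_Q)
  have [measurable]: "(\<lambda>\<omega>. \<integral>\<^sup>+z. u z \<partial>Q \<omega>) \<in> borel_measurable N"
    "(\<lambda>\<omega>. \<integral>\<^sup>+z. v z \<partial>Q \<omega>) \<in> borel_measurable N"
    using add by blast+
  show ?case
    using add by (simp add: * nn_integral_add cong: nn_integral_cong measurable_cong)
next
  case (seq U)
  have *: "(\<integral>\<^sup>+z. (SUP i. U i z) \<partial>Q \<omega>) = (SUP i. \<integral>\<^sup>+z. U i z \<partial>Q \<omega>)" if "\<omega> \<in> space N" for \<omega>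
    using that seq by (intro nn_integral_monotone_convergence_SUP) (simp_all add: measurable_Q)
  have inc: "incseq (\<lambda>i \<omega>. \<integral>\<^sup>+z. U i z \<partial>Q \<omega>)"
    using \<open>incseq U\<close> by (auto simp: incseq_def le_fun_def intro!: nn_integral_mono)
  have [measurable]: "(\<lambda>\<omega>. \<integral>\<^sup>+z. U i z \<partial>Q \<omega>) \<in> borel_measurable N" for i
    using seq by blast
  have "(\<integral>\<^sup>+\<omega>. (\<integral>\<^sup>+z. (SUP i. U i z) \<partial>Q \<omega>) \<partial>N) = (\<integral>\<^sup>+\<omega>. (SUP i. \<integral>\<^sup>+z. U i z \<partial>Q \<omega>) \<partial>N)"
    by (intro nn_integral_cong *)
  also have "\<dots> = (SUP i. \<integral>\<^sup>+\<omega>. (\<integral>\<^sup>+z. U i z \<partial>Q \<omega>) \<partial>N)"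
    using inc by (intro nn_integral_monotone_convergence_SUP) simp_all
  also have "\<dots> = (SUP i. \<integral>\<^sup>+z. U i z \<partial>m)"
    using seq by simp
  also have "\<dots> = (\<integral>\<^sup>+z. (SUP i. U i z) \<partial>m)"
    using seq by (intro nn_integral_monotone_convergence_SUP[symmetric]) simp_all
  finally have "(\<integral>\<^sup>+\<omega>. (\<integral>\<^sup>+z. (SUP i. U i z) \<partial>Q \<omega>) \<partial>N) = (\<integral>\<^sup>+z. (SUP i. U i z) \<partial>m)" .
  moreover have "(\<lambda>\<omega>. SUP i. \<integral>\<^sup>+z. U i z \<partial>Q \<omega>) \<in> borel_measurable N"
    by measurable
  moreover have "(SUP i. U i) = (\<lambda>z. SUP i. U i z)"
    by (auto simp: fun_eq_iff image_comp)
  ultimately show ?case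
    by (simp add: * cong: measurable_cong)
qed

lemma integral_Q_measurable:
  fixes G :: "'e \<Rightarrow> real"
  assumes [measurable]: "G \<in> borel_measurable m"
  shows "(\<lambda>\<omega>. LINT z|Q \<omega>. G z) \<in> borel_measurable N"
proof -
  have [measurable]: "(\<lambda>\<omega>. \<integral>\<^sup>+z. ennreal (G z) \<partial>Q \<omega>) \<in> borel_measurable N"
    "(\<lambda>\<omega>. \<integral>\<^sup>+z. ennreal (- G z) \<partial>Q \<omega>) \<in> borel_measurable N"
    "(\<lambda>\<omega>. \<integral>\<^sup>+z. ennreal \<bar>G z\<bar> \<partial>Q \<omega>) \<in> borel_measurable N"
    by (auto intro!: campbell[THEN conjunct1])
  \<comment> \<open>A Bochner integral of a function that is not integrable is 0, so measurability
    in \<omega> is read off from a case distinction on the integral of |G|.\<close>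
  have "(LINT z|Q \<omega>. G z) = (if (\<integral>\<^sup>+z. ennreal \<bar>G z\<bar> \<partial>Q \<omega>) < \<infinity>
      then enn2real (\<integral>\<^sup>+z. ennreal (G z) \<partial>Q \<omega>) - enn2real (\<integral>\<^sup>+z. ennreal (- G z) \<partial>Q \<omega>) else 0)"
    if "\<omega> \<in> space N" for \<omega>
    using that assms by (auto simp: integrable_iff_bounded measurable_Q real_lebesgue_integral_def
      intro!: not_integrable_integral_eq)
  then show ?thesis by (subst measurable_cong) (assumption, measurable)
qed

text \<open>By Campbell's formula the integral of |G| against \<open>Q\<close> has the finite mean
  given by the intensity measure, so it is almost surely finite.\<close>

lemma integrable_Q:
  fixes G :: "'e \<Rightarrow> real"
  assumes G: "integrable m G"
  shows "AE \<omega> in N. integrable (Q \<omega>) G"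
    and "(\<integral>\<^sup>+\<omega>. ennreal \<bar>LINT z|Q \<omega>. G z\<bar> \<partial>N) \<le> (\<integral>\<^sup>+z. ennreal \<bar>G z\<bar> \<partial>m)"
proof -
  have [measurable]: "G \<in> borel_measurable m" using G by simp
  have c: "(\<lambda>\<omega>. \<integral>\<^sup>+z. ennreal \<bar>G z\<bar> \<partial>Q \<omega>) \<in> borel_measurable N"
    "(\<integral>\<^sup>+\<omega>. (\<integral>\<^sup>+z. ennreal \<bar>G z\<bar> \<partial>Q \<omega>) \<partial>N) = (\<integral>\<^sup>+z. ennreal \<bar>G z\<bar> \<partial>m)"
    using campbell[of "\<lambda>z. ennreal \<bar>G z\<bar>"] by auto
  have "(\<integral>\<^sup>+z. ennreal \<bar>G z\<bar> \<partial>m) < \<infinity>"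
    using G by (simp add: integrable_iff_bounded)
  then have "AE \<omega> in N. (\<integral>\<^sup>+z. ennreal \<bar>G z\<bar> \<partial>Q \<omega>) \<noteq> \<infinity>"
    using c by (intro nn_integral_PInf_AE) auto
  moreover have "G \<in> borel_measurable (Q \<omega>)" if "\<omega> \<in> space N" for \<omega>
    using that by (simp add: measurable_Q)
  ultimately show ae: "AE \<omega> in N. integrable (Q \<omega>) G"
    by (auto simp: integrable_iff_bounded less_top[symmetric])
  have "(\<integral>\<^sup>+\<omega>. ennreal \<bar>LINT z|Q \<omega>. G z\<bar> \<partial>N) \<le> (\<integral>\<^sup>+\<omega>. (\<integral>\<^sup>+z. ennreal \<bar>G z\<bar> \<partial>Q \<omega>) \<partial>N)"
  proof (rule nn_integral_mono_AE, use ae in eventually_elim)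
    fix \<omega> assume "integrable (Q \<omega>) G"
    from integral_norm_bound_ennreal[OF this]
    show "ennreal \<bar>LINT z|Q \<omega>. G z\<bar> \<le> (\<integral>\<^sup>+z. ennreal \<bar>G z\<bar> \<partial>Q \<omega>)" by simp
  qed
  then show "(\<integral>\<^sup>+\<omega>. ennreal \<bar>LINT z|Q \<omega>. G z\<bar> \<partial>N) \<le> (\<integral>\<^sup>+z. ennreal \<bar>G z\<bar> \<partial>m)"
    by (simp add: c)
qed

end

section \<open>Quadratic estimates, step functions and limits in mean square\<close>

lemma integral_abs_mult_le_sqrt:
  fixes f g :: "'a \<Rightarrow> real"
  assumes [measurable]: "f \<in> borel_measurable M" "g \<in> borel_measurable M"
    and f2: "integrable M (\<lambda>x. (f x)\<^sup>2)" and g2: "integrable M (\<lambda>x. (g x)\<^sup>2)"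
  shows "integrable M (\<lambda>x. f x * g x)"
    and "(LINT x|M. \<bar>f x * g x\<bar>) \<le> sqrt ((LINT x|M. (f x)\<^sup>2) * (LINT x|M. (g x)\<^sup>2))"
proof -
  have bound: "\<bar>f x * g x\<bar> \<le> (f x)\<^sup>2 + (g x)\<^sup>2" for x
  proof -
    have "0 \<le> (\<bar>f x\<bar> - \<bar>g x\<bar>)\<^sup>2" by simp
    then have "2 * \<bar>f x * g x\<bar> \<le> (f x)\<^sup>2 + (g x)\<^sup>2"
      by (simp add: power2_diff abs_mult)
    then show ?thesis using abs_ge_zero[of "f x * g x"] by linarith
  qed
  show int: "integrable M (\<lambda>x. f x * g x)"
    by (rule Bochner_Integration.integrable_bound[OF Bochner_Integration.integrable_add[OF f2 g2]])
      (use bound in auto)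
  have "(ennreal (LINT x|M. \<bar>f x * g x\<bar>))\<^sup>2 = (\<integral>\<^sup>+x. ennreal \<bar>f x\<bar> * ennreal \<bar>g x\<bar> \<partial>M)\<^sup>2"
    using integrable_abs[OF int] by (subst nn_integral_eq_integral[symmetric]) (auto simp: abs_mult ennreal_mult)
  also have "\<dots> \<le> (\<integral>\<^sup>+x. (ennreal \<bar>f x\<bar>)\<^sup>2 \<partial>M) * (\<integral>\<^sup>+x. (ennreal \<bar>g x\<bar>)\<^sup>2 \<partial>M)"
    by (rule Cauchy_Schwarz_nn_integral) auto
  also have "\<dots> = ennreal (LINT x|M. (f x)\<^sup>2) * ennreal (LINT x|M. (g x)\<^sup>2)"
    using f2 g2 by (simp add: ennreal_power nn_integral_eq_integral)
  finally have "(LINT x|M. \<bar>f x * g x\<bar>)\<^sup>2 \<le> (LINT x|M. (f x)\<^sup>2) * (LINT x|M. (g x)\<^sup>2)"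
    by (simp add: ennreal_power flip: ennreal_mult)
  then show "(LINT x|M. \<bar>f x * g x\<bar>) \<le> sqrt ((LINT x|M. (f x)\<^sup>2) * (LINT x|M. (g x)\<^sup>2))"
    by (rule real_le_rsqrt)
qed

lemma (in prob_space) expectation_abs_le_sqrt:
  fixes X :: "'a \<Rightarrow> real"
  assumes [measurable]: "X \<in> borel_measurable M" and X: "integrable M (\<lambda>\<omega>. (X \<omega>)\<^sup>2)"
  shows "integrable M X" "expectation (\<lambda>\<omega>. \<bar>X \<omega>\<bar>) \<le> sqrt (expectation (\<lambda>\<omega>. (X \<omega>)\<^sup>2))"
  using integral_abs_mult_le_sqrt[of X M "\<lambda>_. 1"] X by (simp_all add: prob_space)

lemma cmod_iexp_diff_le: "cmod (iexp x - iexp y) \<le> \<bar>x - y\<bar>"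
proof -
  have "iexp x - iexp y = iexp y * (iexp (x - y) - 1)"
    by (simp add: algebra_simps flip: exp_add)
  then have "cmod (iexp x - iexp y) = cmod (iexp (x - y) - 1)"
    by (simp add: norm_mult)
  also have "\<dots> \<le> \<bar>x - y\<bar>"
    using iexp_approx1[of "x - y" 0] by simp
  finally show ?thesis .
qed

lemma cmod_iexp_minus_one_le: "cmod (iexp x - 1) \<le> \<bar>x\<bar>"
  using cmod_iexp_diff_le[of x 0] by simp

text \<open>Integrated against the intensity measure, this is the logarithm of the characteristic
  function of a compensated Poisson integral. Removing the linear term leaves a function of order
  x^2, so square integrability of the integrand suffices.\<close>

definition compensated_iexp :: "real \<Rightarrow> complex" where
  "compensated_iexp x = iexp x - 1 - \<i> * complex_of_real x"

lemma compensated_iexp_measurable[measurable]: "compensated_iexp \<in> borel_measurable borel"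
  unfolding compensated_iexp_def[abs_def] by measurable

lemma cmod_compensated_iexp_le: "cmod (compensated_iexp x) \<le> x\<^sup>2 / 2"
  using iexp_approx1[of x 1] by (simp add: compensated_iexp_def numeral_2_eq_2 algebra_simps)

text \<open>Factoring out \<open>iexp y\<close> leaves a purely quadratic term in x - y and a mixed
  term of order (x - y) y. Both are controlled by L2 distances through Cauchy-Schwarz, which makes
  the exponent continuous in mean square.\<close>

lemma cmod_compensated_iexp_diff_le:
  "cmod (compensated_iexp x - compensated_iexp y) \<le> 2 * ((x - y)\<^sup>2 + \<bar>(x - y) * y\<bar>)"
proof -
  have "compensated_iexp x - compensated_iexp y =
      iexp y * compensated_iexp (x - y) + \<i> * complex_of_real (x - y) * (iexp y - 1)"
    unfolding compensated_iexp_def by (simp add: algebra_simps flip: exp_add)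
  then have "cmod (compensated_iexp x - compensated_iexp y) \<le>
      cmod (compensated_iexp (x - y)) + \<bar>x - y\<bar> * cmod (iexp y - 1)"
    using norm_triangle_ineq[of "iexp y * compensated_iexp (x - y)" "\<i> * complex_of_real (x - y) * (iexp y - 1)"]
    by (simp add: norm_mult del: of_real_diff)
  also have "\<dots> \<le> (x - y)\<^sup>2 / 2 + \<bar>x - y\<bar> * \<bar>y\<bar>"
    by (intro add_mono mult_left_mono cmod_compensated_iexp_le cmod_iexp_minus_one_le) auto
  also have "\<dots> \<le> 2 * ((x - y)\<^sup>2 + \<bar>(x - y) * y\<bar>)"
  proof -
    have "a / 2 + b \<le> 2 * (a + b)" if "0 \<le> a" "0 \<le> b" for a b :: real
      using that by simp
    then show ?thesis unfolding abs_mult by simp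
  qed
  finally show ?thesis .
qed

text \<open>A simple function has finitely many nonzero values, so its modulus is bounded away from
  0 where it does not vanish and is dominated there by a multiple of its square.\<close>

lemma simple_function_square_integrable:
  fixes F :: "'a \<Rightarrow> real"
  assumes F: "simple_function M F" and int: "integrable M (\<lambda>x. (F x)\<^sup>2)"
  shows "integrable M F"
proof -
  \<comment> \<open>A possible value 0 of \<open>F\<close> adds nothing to this sum, because 1 / 0 =
    0.\<close>
  define k where "k = (\<Sum>c\<in>F ` space M. 1 / \<bar>c\<bar>)"
  have fin: "finite (F ` space M)" using F by (simp add: simple_function_def)
  have "\<bar>F x\<bar> \<le> k * (F x)\<^sup>2" if "x \<in> space M" for x
  proof (cases "F x = 0")
    case False
    have "1 / \<bar>F x\<bar> \<le> k"
      unfolding k_def by (rule member_le_sum) (use fin that in auto)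
    then have "(1 / \<bar>F x\<bar>) * (F x)\<^sup>2 \<le> k * (F x)\<^sup>2" by (rule mult_right_mono) simp
    moreover have "(1 / \<bar>F x\<bar>) * (F x)\<^sup>2 = \<bar>F x\<bar>"
      using False by (simp add: power2_eq_square abs_mult_self_eq field_simps)
    ultimately show ?thesis by simp
  qed simp
  then show ?thesis
    using F by (intro Bochner_Integration.integrable_bound[OF integrable_mult_right[OF int, of k]])
      (auto intro!: AE_I2 order_trans[OF _ abs_ge_self] borel_measurable_simple_function)
qed

text \<open>The value 0 is left out: its level set may have infinite measure, while integrability
  makes every other level set finite, as the formulas for Poisson counts require.\<close>

lemma simple_function_step_representation:
  fixes G :: "'a \<Rightarrow> real"
  assumes G: "simple_function M G" and int: "integrable M G"
  obtains n :: nat and c :: "nat \<Rightarrow> real" and B :: "nat \<Rightarrow> 'a set"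
  where "\<And>i. i < n \<Longrightarrow> B i \<in> sets M" "\<And>i. i < n \<Longrightarrow> emeasure M (B i) < \<infinity>"
    "disjoint_family_on B {..<n}" "\<And>z. z \<in> space M \<Longrightarrow> G z = (\<Sum>i<n. c i * indicator (B i) z)"
proof -
  define R where "R = G ` space M - {0}"
  have "finite R" using G by (simp add: R_def simple_function_def)
  then obtain c where c: "bij_betw c {..<card R} R"
    by (metis ex_bij_betw_nat_finite atLeast0LessThan)
  define B where "B i = G -` {c i} \<inter> space M" for i
  have cR: "c i \<in> R" if "i < card R" for i
    using c that by (auto simp: bij_betw_def)
  have B: "B i \<in> sets M" if "i < card R" for i
    using G cR[OF that] by (auto simp: B_def R_def simple_function_def)
  show ?thesis
  proof (rule that[of "card R" B c])
    show "B i \<in> sets M" if "i < card R" for i by (rule B[OF that])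
    show "emeasure M (B i) < \<infinity>" if "i < card R" for i
    proof -
      have [measurable]: "B i \<in> sets M" by (rule B[OF that])
      have "c i \<noteq> 0" using cR[OF that] by (simp add: R_def)
      have "integrable M (\<lambda>z. (1 / \<bar>c i\<bar>) * \<bar>G z\<bar>)" using int by simp
      then have "integrable M (indicator (B i) :: _ \<Rightarrow> real)"
      proof (rule Bochner_Integration.integrable_bound)
        show "(indicator (B i) :: _ \<Rightarrow> real) \<in> borel_measurable M" by measurable
        show "AE z in M. norm (indicator (B i) z :: real) \<le> norm ((1 / \<bar>c i\<bar>) * \<bar>G z\<bar>)"
          using \<open>c i \<noteq> 0\<close> by (auto simp: B_def split: split_indicator)
      qed
      then show ?thesis using sets.sets_into_space[OF B[OF that]] by (simp add: integrable_indicator_iff Int_absorb2)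
    qed
    show "disjoint_family_on B {..<card R}"
      using c by (auto simp: disjoint_family_on_def B_def bij_betw_def inj_on_def)
    show "G z = (\<Sum>i<card R. c i * indicator (B i) z)" if z: "z \<in> space M" for z
    proof (cases "G z = 0")
      case True
      then have "c i * indicator (B i) z = 0" if "i < card R" for i
        using cR[OF that] by (auto simp: B_def R_def split: split_indicator)
      then show ?thesis using True by (intro trans[OF _ sum.neutral[symmetric]]) auto
    next
      case False
      then have "G z \<in> R" using z by (simp add: R_def)
      then have "G z \<in> c ` {..<card R}" using c by (simp add: bij_betw_def)
      then obtain j where j: "j < card R" "c j = G z" by (metis imageE lessThan_iff)
      have "(\<Sum>i<card R. c i * indicator (B i) z) = (\<Sum>i<card R. if i = j then c j else 0)"
        using c j z by (intro sum.cong refl) (auto simp: B_def bij_betw_def inj_on_def split: split_indicator)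
      then show ?thesis using j by simp
    qed
  qed
qed

lemma ennreal_le_of_power2_le:
  assumes "x\<^sup>2 \<le> ennreal (b\<^sup>2)" "0 \<le> b"
  shows "x \<le> ennreal b"
proof (cases x)
  case (real r)
  then have "ennreal (r\<^sup>2) \<le> ennreal (b\<^sup>2)"
    using assms(1) by (simp add: ennreal_power)
  then have "r\<^sup>2 \<le> b\<^sup>2"
    by (subst (asm) ennreal_le_iff) simp_all
  then have "r \<le> b" using assms(2) by (rule power2_le_imp_le)
  then show ?thesis unfolding real by (rule ennreal_leI)
next
  case top
  then have "(\<infinity>::ennreal) \<le> ennreal (b\<^sup>2)"
    using assms(1) by (simp add: power2_eq_square ennreal_top_mult)
  then show ?thesis by (simp add: top_unique)
qed

text \<open>The rate is fast enough for the L1 norms of the increments to be summable, so the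
  sequence converges almost surely by absolute convergence of the telescoping series.\<close>

lemma (in prob_space) L2_limit:
  fixes I :: "nat \<Rightarrow> 'a \<Rightarrow> real"
  assumes [measurable]: "\<And>k. I k \<in> borel_measurable M"
    and Cauchy: "\<And>k l. k \<le> l \<Longrightarrow> (\<integral>\<^sup>+\<omega>. ennreal ((I k \<omega> - I l \<omega>)\<^sup>2) \<partial>M) \<le> ennreal ((1/4) ^ k)"
  obtains Y where "Y \<in> borel_measurable M" "(\<lambda>k. \<integral>\<^sup>+\<omega>. ennreal ((I k \<omega> - Y \<omega>)\<^sup>2) \<partial>M) \<longlonglongrightarrow> 0"
proof
  define Y where "Y = (\<lambda>\<omega>. lim (\<lambda>k. I k \<omega>))"
  show [measurable]: "Y \<in> borel_measurable M"
    unfolding Y_def by measurable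
  have "(\<integral>\<^sup>+\<omega>. ennreal \<bar>I (Suc k) \<omega> - I k \<omega>\<bar> \<partial>M) \<le> ennreal ((1/2) ^ k)" for k
  proof -
    have "(\<integral>\<^sup>+\<omega>. ennreal \<bar>I (Suc k) \<omega> - I k \<omega>\<bar> * 1 \<partial>M)\<^sup>2 \<le>
        (\<integral>\<^sup>+\<omega>. (ennreal \<bar>I (Suc k) \<omega> - I k \<omega>\<bar>)\<^sup>2 \<partial>M) * (\<integral>\<^sup>+\<omega>. 1\<^sup>2 \<partial>M)"
      by (rule Cauchy_Schwarz_nn_integral) auto
    also have "\<dots> = (\<integral>\<^sup>+\<omega>. ennreal ((I k \<omega> - I (Suc k) \<omega>)\<^sup>2) \<partial>M)"
      by (simp add: ennreal_power emeasure_space_1 power2_commute)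
    also have "\<dots> \<le> ennreal ((1/4) ^ k)" by (rule Cauchy) simp
    also have "(1/4::real) ^ k = ((1/2) ^ k)\<^sup>2"
      by (simp add: power2_eq_square flip: power_mult_distrib)
    finally have "(\<integral>\<^sup>+\<omega>. ennreal \<bar>I (Suc k) \<omega> - I k \<omega>\<bar> \<partial>M)\<^sup>2 \<le> ennreal (((1/2) ^ k)\<^sup>2)"
      by simp
    then show ?thesis by (rule ennreal_le_of_power2_le) simp
  qed
  then have "(\<Sum>k. \<integral>\<^sup>+\<omega>. ennreal \<bar>I (Suc k) \<omega> - I k \<omega>\<bar> \<partial>M) \<le> (\<Sum>k. ennreal ((1/2) ^ k))"
    by (intro suminf_le) auto
  also have "\<dots> < \<infinity>"
    by (subst suminf_ennreal2) (auto simp: summable_geometric_iff)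
  finally have "(\<integral>\<^sup>+\<omega>. (\<Sum>k. ennreal \<bar>I (Suc k) \<omega> - I k \<omega>\<bar>) \<partial>M) \<noteq> \<infinity>"
    by (subst nn_integral_suminf) auto
  then have "AE \<omega> in M. (\<Sum>k. ennreal \<bar>I (Suc k) \<omega> - I k \<omega>\<bar>) \<noteq> \<infinity>"
    by (intro nn_integral_PInf_AE) auto
  then have lim: "AE \<omega> in M. (\<lambda>k. I k \<omega>) \<longlonglongrightarrow> Y \<omega>"
  proof eventually_elim
    case (elim \<omega>)
    then have "summable (\<lambda>k. \<bar>I (Suc k) \<omega> - I k \<omega>\<bar>)"
      by (intro summable_suminf_not_top) (auto simp: top_ennreal_def)
    then have "summable (\<lambda>k. I (Suc k) \<omega> - I k \<omega>)"
      by (rule summable_rabs_cancel)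
    then have "convergent (\<lambda>n. \<Sum>k<n. I (Suc k) \<omega> - I k \<omega>)"
      by (simp add: summable_iff_convergent)
    then have "convergent (\<lambda>n. I n \<omega> - I 0 \<omega>)"
      by (simp only: sum_lessThan_telescope[of "\<lambda>k. I k \<omega>"])
    then have "convergent (\<lambda>n. I n \<omega>)"
      by (simp add: convergent_diff_const_right_iff)
    then show ?case by (simp add: Y_def convergent_LIMSEQ_iff)
  qed
  \<comment> \<open>Fatou's lemma in the second index carries the Cauchy bound over to the almost
    sure limit.\<close>
  have bound: "(\<integral>\<^sup>+\<omega>. ennreal ((I k \<omega> - Y \<omega>)\<^sup>2) \<partial>M) \<le> ennreal ((1/4) ^ k)" for k
  proof -
    have "(\<integral>\<^sup>+\<omega>. ennreal ((I k \<omega> - Y \<omega>)\<^sup>2) \<partial>M) =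
        (\<integral>\<^sup>+\<omega>. liminf (\<lambda>l. ennreal ((I k \<omega> - I l \<omega>)\<^sup>2)) \<partial>M)"
    proof (intro nn_integral_cong_AE, use lim in eventually_elim)
      case (elim \<omega>)
      then have "(\<lambda>l. ennreal ((I k \<omega> - I l \<omega>)\<^sup>2)) \<longlonglongrightarrow> ennreal ((I k \<omega> - Y \<omega>)\<^sup>2)"
        by (intro tendsto_intros)
      then show ?case by (intro lim_imp_Liminf[symmetric]) auto
    qed
    also have "\<dots> \<le> liminf (\<lambda>l. \<integral>\<^sup>+\<omega>. ennreal ((I k \<omega> - I l \<omega>)\<^sup>2) \<partial>M)"
      by (rule nn_integral_liminf) auto
    also have "\<dots> \<le> ennreal ((1/4) ^ k)"
      by (intro Liminf_le) (auto simp: eventually_sequentially intro!: exI[of _ k] Cauchy)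
    finally show ?thesis .
  qed
  have conv: "(\<lambda>k. ennreal ((1/4) ^ k)) \<longlonglongrightarrow> ennreal 0"
    by (intro tendsto_ennrealI LIMSEQ_realpow_zero) auto
  show "(\<lambda>k. \<integral>\<^sup>+\<omega>. ennreal ((I k \<omega> - Y \<omega>)\<^sup>2) \<partial>M) \<longlonglongrightarrow> 0"
  proof (rule tendsto_sandwich[where f = "\<lambda>_. 0"])
    show "\<forall>\<^sub>F k in sequentially. (\<integral>\<^sup>+\<omega>. ennreal ((I k \<omega> - Y \<omega>)\<^sup>2) \<partial>M) \<le> ennreal ((1/4) ^ k)"
      by (intro always_eventually allI bound)
    show "(\<lambda>k. ennreal ((1/4) ^ k)) \<longlonglongrightarrow> 0"
      using conv by (simp only: ennreal_0)
  qed (simp, rule tendsto_const)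
qed

section \<open>Isometry and characteristic functions for integrable integrands\<close>

context poisson_random_measure_space
begin

lemma integral_Q_step:
  fixes c :: "nat \<Rightarrow> real"
  assumes B: "\<And>i. i < n \<Longrightarrow> B i \<in> sets m" "\<And>i. i < n \<Longrightarrow> emeasure m (B i) < \<infinity>"
  shows "AE \<omega> in N. (LINT z|Q \<omega>. (\<Sum>i<n. c i * indicator (B i) z)) = (\<Sum>i<n. c i * measure (Q \<omega>) (B i))"
    and "(LINT z|m. (\<Sum>i<n. c i * indicator (B i) z)) = (\<Sum>i<n. c i * measure m (B i))"
proof -
  have *: "(LINT z|P. (\<Sum>i<n. c i * indicator (B i) z)) = (\<Sum>i<n. c i * measure P (B i))"
    if "\<And>i. i < n \<Longrightarrow> B i \<in> sets P" "\<And>i. i < n \<Longrightarrow> emeasure P (B i) < \<infinity>" for P :: "'e measure"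
  proof -
    have "integrable P (\<lambda>z. c i * indicator (B i) z)" if "i < n" for i
      using that \<open>\<And>i. i < n \<Longrightarrow> B i \<in> sets P\<close> \<open>\<And>i. i < n \<Longrightarrow> emeasure P (B i) < \<infinity>\<close>
      by (intro integrable_mult_right integrable_real_indicator) auto
    moreover have "(LINT z|P. indicator (B i) z :: real) = measure P (B i)" if "i < n" for i
      using sets.sets_into_space[OF \<open>\<And>i. i < n \<Longrightarrow> B i \<in> sets P\<close>[OF that]] by (simp add: Int_absorb2)
    ultimately show ?thesis
      by (subst Bochner_Integration.integral_sum) auto
  qed
  show "(LINT z|m. (\<Sum>i<n. c i * indicator (B i) z)) = (\<Sum>i<n. c i * measure m (B i))"
    by (rule *) (use B in auto)
  have "AE \<omega> in N. \<forall>i\<in>{..<n}. emeasure (Q \<omega>) (B i) < \<infinity>"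
    using B by (intro AE_finite_allI count_moments(6)) auto
  then have ae: "AE \<omega> in N. \<omega> \<in> space N \<and> (\<forall>i\<in>{..<n}. emeasure (Q \<omega>) (B i) < \<infinity>)"
    by auto
  then show "AE \<omega> in N. (LINT z|Q \<omega>. (\<Sum>i<n. c i * indicator (B i) z)) = (\<Sum>i<n. c i * measure (Q \<omega>) (B i))"
  proof eventually_elim
    case (elim \<omega>)
    then show ?case using B by (intro *) (auto simp: sets_Q)
  qed
qed

text \<open>Orthogonality for disjoint sets comes from polarisation: centred counts add up on a
  disjoint union and so do the Poisson variances, hence the mixed term has mean 0.\<close>

lemma count_covariance:
  assumes A: "A \<in> sets m" "emeasure m A < \<infinity>" and B: "B \<in> sets m" "emeasure m B < \<infinity>"
  defines "W \<equiv> \<lambda>S \<omega>. measure (Q \<omega>) S - measure m S"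
  shows "integrable N (\<lambda>\<omega>. W A \<omega> * W B \<omega>)"
    and "expectation (\<lambda>\<omega>. W A \<omega> * W A \<omega>) = measure m A"
    and "A \<inter> B = {} \<Longrightarrow> expectation (\<lambda>\<omega>. W A \<omega> * W B \<omega>) = 0"
proof -
  have W: "W S \<in> borel_measurable N" "integrable N (\<lambda>\<omega>. (W S \<omega>)\<^sup>2)" "expectation (\<lambda>\<omega>. (W S \<omega>)\<^sup>2) = measure m S"
    if S: "S \<in> sets m" "emeasure m S < \<infinity>" for S
  proof -
    note mom = count_moments[OF S]
    show "W S \<in> borel_measurable N" unfolding W_def using S(1) by measurable
    have eq: "(W S \<omega>)\<^sup>2 = (measure (Q \<omega>) S)\<^sup>2 - 2 * measure m S * measure (Q \<omega>) S + (measure m S)\<^sup>2" for \<omega>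
      by (simp add: W_def power2_diff)
    show "integrable N (\<lambda>\<omega>. (W S \<omega>)\<^sup>2)"
      unfolding eq using mom by auto
    show "expectation (\<lambda>\<omega>. (W S \<omega>)\<^sup>2) = measure m S"
      unfolding eq using mom by (simp add: prob_space power2_eq_square)
  qed
  show int: "integrable N (\<lambda>\<omega>. W A \<omega> * W B \<omega>)"
    by (rule integral_abs_mult_le_sqrt) (use W A B in auto)
  show "expectation (\<lambda>\<omega>. W A \<omega> * W A \<omega>) = measure m A"
    using W(3)[OF A] by (simp add: power2_eq_square)
  assume disj: "A \<inter> B = {}"
  have AB: "A \<union> B \<in> sets m" "emeasure m (A \<union> B) < \<infinity>"
    using A B disj by (auto simp: plus_emeasure[symmetric])
  have mAB: "measure m (A \<union> B) = measure m A + measure m B"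
    using A B disj by (intro measure_Union) auto
  have "AE \<omega> in N. W (A \<union> B) \<omega> = W A \<omega> + W B \<omega>"
    using count_moments(6)[OF A] count_moments(6)[OF B] AE_space
  proof eventually_elim
    case (elim \<omega>)
    then have "measure (Q \<omega>) (A \<union> B) = measure (Q \<omega>) A + measure (Q \<omega>) B"
      using A B disj by (intro measure_Union) (auto simp: sets_Q)
    then show ?case by (simp add: W_def mAB)
  qed
  then have "AE \<omega> in N. (W (A \<union> B) \<omega>)\<^sup>2 = (W A \<omega>)\<^sup>2 + (W B \<omega>)\<^sup>2 + 2 * (W A \<omega> * W B \<omega>)"
    by eventually_elim (simp add: power2_sum)
  then have "expectation (\<lambda>\<omega>. (W (A \<union> B) \<omega>)\<^sup>2) = expectation (\<lambda>\<omega>. (W A \<omega>)\<^sup>2 + (W B \<omega>)\<^sup>2 + 2 * (W A \<omega> * W B \<omega>))"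
    using W[OF A] W[OF B] W[OF AB] int by (intro integral_cong_AE) auto
  also have "\<dots> = measure m A + measure m B + 2 * expectation (\<lambda>\<omega>. W A \<omega> * W B \<omega>)"
    using W[OF A] W[OF B] int by simp
  finally show "expectation (\<lambda>\<omega>. W A \<omega> * W B \<omega>) = 0"
    using W(3)[OF AB] mAB by simp
qed

text \<open>Centred counts of the disjoint level sets are orthogonal with variances
  \<open>measure m (B i)\<close>, so expanding the square leaves only the diagonal. This isometry
  carries Cauchy sequences from the intensity measure to the probability space.\<close>

lemma simple_isometry:
  assumes G: "simple_function m G" "integrable m G"
  shows "(\<integral>\<^sup>+\<omega>. ennreal (((LINT z|Q \<omega>. G z) - (LINT z|m. G z))\<^sup>2) \<partial>N) = (\<integral>\<^sup>+z. ennreal ((G z)\<^sup>2) \<partial>m)"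
proof -
  obtain n :: nat and c :: "nat \<Rightarrow> real" and B :: "nat \<Rightarrow> 'e set" where
    B: "\<And>i. i < n \<Longrightarrow> B i \<in> sets m" "\<And>i. i < n \<Longrightarrow> emeasure m (B i) < \<infinity>"
    and disj: "disjoint_family_on B {..<n}"
    and rep: "\<And>z. z \<in> space m \<Longrightarrow> G z = (\<Sum>i<n. c i * indicator (B i) z)"
    by (rule simple_function_step_representation[OF G], rule that) assumption+
  have step_Q: "AE \<omega> in N. (LINT z|Q \<omega>. (\<Sum>i<n. c i * indicator (B i) z)) = (\<Sum>i<n. c i * measure (Q \<omega>) (B i))"
    by (rule integral_Q_step(1)) (fact B)+
  have step_m: "(LINT z|m. (\<Sum>i<n. d i * indicator (B i) z)) = (\<Sum>i<n. d i * measure m (B i))" for d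
    by (rule integral_Q_step(2)) (fact B)+
  define W where "W = (\<lambda>i \<omega>. measure (Q \<omega>) (B i) - measure m (B i))"
  have cov: "integrable N (\<lambda>\<omega>. W i \<omega> * W j \<omega>)"
    "expectation (\<lambda>\<omega>. W i \<omega> * W i \<omega>) = measure m (B i)"
    "B i \<inter> B j = {} \<Longrightarrow> expectation (\<lambda>\<omega>. W i \<omega> * W j \<omega>) = 0" if "i < n" "j < n" for i j
    unfolding W_def using count_covariance[OF B B, of i j] that by auto
  have GW: "AE \<omega> in N. (LINT z|Q \<omega>. G z) - (LINT z|m. G z) = (\<Sum>i<n. c i * W i \<omega>)"
    using step_Q AE_space
  proof eventually_elim
    case (elim \<omega>)
    have "(LINT z|Q \<omega>. G z) = (LINT z|Q \<omega>. (\<Sum>i<n. c i * indicator (B i) z))"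
      using elim by (intro Bochner_Integration.integral_cong) (auto simp: space_Q rep)
    moreover have "(LINT z|m. G z) = (LINT z|m. (\<Sum>i<n. c i * indicator (B i) z))"
      by (intro Bochner_Integration.integral_cong) (auto simp: rep)
    ultimately show ?case
      using elim step_m by (simp add: W_def right_diff_distrib sum_subtractf)
  qed
  have sq: "(\<Sum>i<n. c i * W i \<omega>)\<^sup>2 = (\<Sum>i<n. \<Sum>j<n. c i * c j * (W i \<omega> * W j \<omega>))" for \<omega>
    by (simp add: power2_eq_square sum_product algebra_simps)
  have int: "integrable N (\<lambda>\<omega>. (\<Sum>i<n. c i * W i \<omega>)\<^sup>2)"
    unfolding sq using cov(1) by (intro Bochner_Integration.integrable_sum integrable_mult_right) auto
  have "(\<integral>\<^sup>+\<omega>. ennreal (((LINT z|Q \<omega>. G z) - (LINT z|m. G z))\<^sup>2) \<partial>N) =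
      (\<integral>\<^sup>+\<omega>. ennreal ((\<Sum>i<n. c i * W i \<omega>)\<^sup>2) \<partial>N)"
    using GW by (intro nn_integral_cong_AE) auto
  also have "\<dots> = ennreal (expectation (\<lambda>\<omega>. (\<Sum>i<n. c i * W i \<omega>)\<^sup>2))"
    using int by (intro nn_integral_eq_integral) auto
  also have "expectation (\<lambda>\<omega>. (\<Sum>i<n. c i * W i \<omega>)\<^sup>2) =
      (\<Sum>i<n. expectation (\<lambda>\<omega>. \<Sum>j<n. c i * c j * (W i \<omega> * W j \<omega>)))"
    unfolding sq
    by (intro Bochner_Integration.integral_sum Bochner_Integration.integrable_sum integrable_mult_right cov(1)) auto
  also have "\<dots> = (\<Sum>i<n. \<Sum>j<n. expectation (\<lambda>\<omega>. c i * c j * (W i \<omega> * W j \<omega>)))"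
    by (intro sum.cong refl Bochner_Integration.integral_sum integrable_mult_right cov(1)) auto
  also have "\<dots> = (\<Sum>i<n. \<Sum>j<n. c i * c j * expectation (\<lambda>\<omega>. W i \<omega> * W j \<omega>))"
    by simp
  also have "\<dots> = (\<Sum>i<n. \<Sum>j<n. if i = j then (c i)\<^sup>2 * measure m (B i) else 0)"
  proof (intro sum.cong refl)
    fix i j assume ij: "i \<in> {..<n}" "j \<in> {..<n}"
    show "c i * c j * expectation (\<lambda>\<omega>. W i \<omega> * W j \<omega>) = (if i = j then (c i)\<^sup>2 * measure m (B i) else 0)"
      using ij cov(2)[of i j] cov(3)[of i j] disj
      by (auto simp: power2_eq_square disjoint_family_on_def)
  qed
  also have "\<dots> = (\<Sum>i<n. (c i)\<^sup>2 * measure m (B i))"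
    by simp
  also have "\<dots> = (LINT z|m. (\<Sum>i<n. (c i)\<^sup>2 * indicator (B i) z))"
    by (rule step_m[symmetric])
  also have "ennreal \<dots> = (\<integral>\<^sup>+z. ennreal (\<Sum>i<n. (c i)\<^sup>2 * indicator (B i) z) \<partial>m)"
    using B by (intro nn_integral_eq_integral[symmetric] Bochner_Integration.integrable_sum integrable_mult_right
      integrable_real_indicator) (auto intro!: sum_nonneg)
  also have "\<dots> = (\<integral>\<^sup>+z. ennreal ((G z)\<^sup>2) \<partial>m)"
  proof (intro nn_integral_cong arg_cong[where f = ennreal])
    fix z assume z: "z \<in> space m"
    have "(G z)\<^sup>2 = (\<Sum>i<n. \<Sum>j<n. (c i * indicator (B i) z) * (c j * indicator (B j) z))"
      unfolding rep[OF z] power2_eq_square sum_product ..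
    also have "\<dots> = (\<Sum>i<n. \<Sum>j<n. if i = j then (c i)\<^sup>2 * indicator (B i) z else 0)"
      using disj by (intro sum.cong refl)
        (auto simp: power2_eq_square disjoint_family_on_def split: split_indicator)
    finally show "(\<Sum>i<n. (c i)\<^sup>2 * indicator (B i) z) = (G z)\<^sup>2" by simp
  qed
  finally show ?thesis .
qed

text \<open>Counts of disjoint level sets are independent, so the characteristic function is a
  product of Poisson ones. At each point at most one level set is active, which turns the sum of
  exponents into the integral of \<open>iexp (G z) - 1\<close>.\<close>

lemma simple_characteristic:
  assumes G: "simple_function m G" "integrable m G"
  shows "expectation (\<lambda>\<omega>. iexp (LINT z|Q \<omega>. G z)) = exp (LINT z|m. iexp (G z) - 1)"
proof -
  obtain n :: nat and c :: "nat \<Rightarrow> real" and B :: "nat \<Rightarrow> 'e set" where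
    B: "\<And>i. i < n \<Longrightarrow> B i \<in> sets m" "\<And>i. i < n \<Longrightarrow> emeasure m (B i) < \<infinity>"
    and disj: "disjoint_family_on B {..<n}"
    and rep: "\<And>z. z \<in> space m \<Longrightarrow> G z = (\<Sum>i<n. c i * indicator (B i) z)"
    by (rule simple_function_step_representation[OF G], rule that) assumption+
  have step_Q: "AE \<omega> in N. (LINT z|Q \<omega>. (\<Sum>i<n. c i * indicator (B i) z)) = (\<Sum>i<n. c i * measure (Q \<omega>) (B i))"
    by (rule integral_Q_step(1)) (fact B)+
  have [measurable]: "G \<in> borel_measurable m" by (rule borel_measurable_simple_function[OF G(1)])
  have "indep_vars (\<lambda>_. borel) (\<lambda>i \<omega>. emeasure (Q \<omega>) (B i)) {..<n}"
    using poisson B disj unfolding poisson_random_measure_def by auto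
  then have indep: "indep_vars (\<lambda>_. borel) (\<lambda>i \<omega>. iexp (c i * measure (Q \<omega>) (B i))) {..<n}"
    unfolding measure_def by (rule indep_vars_compose2) measurable
  have "expectation (\<lambda>\<omega>. iexp (LINT z|Q \<omega>. G z)) = expectation (\<lambda>\<omega>. \<Prod>i<n. iexp (c i * measure (Q \<omega>) (B i)))"
  proof (intro integral_cong_AE)
    show "(\<lambda>\<omega>. iexp (LINT z|Q \<omega>. G z)) \<in> borel_measurable N"
      using integral_Q_measurable[of G] by measurable
    show "(\<lambda>\<omega>. \<Prod>i<n. iexp (c i * measure (Q \<omega>) (B i))) \<in> borel_measurable N"
      using B(1) by (intro borel_measurable_prod) auto
    show "AE \<omega> in N. iexp (LINT z|Q \<omega>. G z) = (\<Prod>i<n. iexp (c i * measure (Q \<omega>) (B i)))"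
      using step_Q AE_space
    proof eventually_elim
      case (elim \<omega>)
      have "(LINT z|Q \<omega>. G z) = (LINT z|Q \<omega>. (\<Sum>i<n. c i * indicator (B i) z))"
        using elim by (intro Bochner_Integration.integral_cong) (auto simp: space_Q rep)
      then show ?case
        using elim by (simp add: exp_sum[symmetric] sum_distrib_left)
    qed
  qed
  also have "\<dots> = (\<Prod>i<n. expectation (\<lambda>\<omega>. iexp (c i * measure (Q \<omega>) (B i))))"
    using indep B(1) by (intro indep_vars_lebesgue_integral) (auto intro!: integrable_const_bound[where B = 1])
  also have "\<dots> = (\<Prod>i<n. exp (measure m (B i) * (iexp (c i) - 1)))"
    using count_moments(5)[OF B] by (intro prod.cong) auto
  also have "\<dots> = exp (\<Sum>i<n. measure m (B i) * (iexp (c i) - 1))"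
    by (simp add: exp_sum)
  also have "(\<Sum>i<n. measure m (B i) * (iexp (c i) - 1)) = (LINT z|m. (\<Sum>i<n. indicator (B i) z *\<^sub>R (iexp (c i) - 1)))"
  proof -
    have "(LINT z|m. indicator (B i) z *\<^sub>R (iexp (c i) - 1)) = measure m (B i) * (iexp (c i) - 1)"
      "integrable m (\<lambda>z. indicator (B i) z *\<^sub>R (iexp (c i) - 1))" if "i < n" for i
      using sets.sets_into_space[OF B(1)[OF that]] B[OF that]
      by (auto simp: Int_absorb2 scaleR_conv_of_real)
    then show ?thesis by (subst Bochner_Integration.integral_sum) auto
  qed
  also have "\<dots> = (LINT z|m. iexp (G z) - 1)"
  proof (intro Bochner_Integration.integral_cong refl)
    fix z assume z: "z \<in> space m"
    show "(\<Sum>i<n. indicator (B i) z *\<^sub>R (iexp (c i) - 1)) = iexp (G z) - 1"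
    proof (cases "\<exists>j<n. z \<in> B j")
      case True
      then obtain j where j: "j < n" "z \<in> B j" by blast
      then have ind: "indicator (B i) z = (if i = j then 1 else 0 :: real)" if "i < n" for i
        using disj that by (auto simp: disjoint_family_on_def split: split_indicator)
      have "(\<Sum>i<n. c i * indicator (B i) z) = (\<Sum>i<n. if i = j then c j else 0)"
        by (intro sum.cong) (auto simp: ind)
      moreover have "(\<Sum>i<n. indicator (B i) z *\<^sub>R (iexp (c i) - 1)) = (\<Sum>i<n. if i = j then iexp (c j) - 1 else 0)"
        by (intro sum.cong) (auto simp: ind)
      ultimately show ?thesis unfolding rep[OF z] using j by simp
    next
      case False
      then have ind: "indicator (B i) z = (0 :: real)" if "i < n" for i
        using that by (auto split: split_indicator)
      show ?thesis unfolding rep[OF z] by (simp add: ind)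
    qed
  qed
  finally show ?thesis .
qed

text \<open>The simple approximations are dominated by 2 |G|, which is integrable against the
  intensity and almost surely against \<open>Q\<close>; dominated convergence therefore works on
  both sides.\<close>

lemma integral_characteristic:
  assumes G: "integrable m G"
  shows "expectation (\<lambda>\<omega>. iexp (LINT z|Q \<omega>. G z)) = exp (LINT z|m. iexp (G z) - 1)"
proof -
  have [measurable]: "G \<in> borel_measurable m" using G by simp
  obtain F where F: "\<And>i. simple_function m (F i)" "\<And>z. z \<in> space m \<Longrightarrow> (\<lambda>i. F i z) \<longlonglongrightarrow> G z"
    "\<And>i z. z \<in> space m \<Longrightarrow> \<bar>F i z\<bar> \<le> 2 * \<bar>G z\<bar>"
    using borel_measurable_implies_sequence_metric[of G m 0] by (simp add: dist_real_def) blast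
  have [measurable]: "F i \<in> borel_measurable m" for i
    using F(1) by (rule borel_measurable_simple_function)
  have G2: "integrable m (\<lambda>z. 2 * \<bar>G z\<bar>)" using G by simp
  have F_int: "integrable m (F i)" for i
    by (rule Bochner_Integration.integrable_bound[OF G2]) (use F(3) in auto)
  have "(\<lambda>i. expectation (\<lambda>\<omega>. iexp (LINT z|Q \<omega>. F i z))) \<longlonglongrightarrow> expectation (\<lambda>\<omega>. iexp (LINT z|Q \<omega>. G z))"
  proof (rule integral_dominated_convergence[where w = "\<lambda>_. 1"])
    show "(\<lambda>\<omega>. iexp (LINT z|Q \<omega>. G z)) \<in> borel_measurable N"
      "\<And>i. (\<lambda>\<omega>. iexp (LINT z|Q \<omega>. F i z)) \<in> borel_measurable N"
      using integral_Q_measurable[of G] integral_Q_measurable[of "F _"] by measurable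
    show "AE \<omega> in N. (\<lambda>i. iexp (LINT z|Q \<omega>. F i z)) \<longlonglongrightarrow> iexp (LINT z|Q \<omega>. G z)"
      using integrable_Q(1)[OF G2] AE_space
    proof eventually_elim
      case (elim \<omega>)
      have "(\<lambda>i. LINT z|Q \<omega>. F i z) \<longlonglongrightarrow> (LINT z|Q \<omega>. G z)"
        by (rule integral_dominated_convergence[where w = "\<lambda>z. 2 * \<bar>G z\<bar>"])
          (use elim F in \<open>auto simp: measurable_Q space_Q intro!: AE_I2\<close>)
      then show ?case by (intro tendsto_intros)
    qed
  qed auto
  moreover have "(\<lambda>i. exp (LINT z|m. iexp (F i z) - 1)) \<longlonglongrightarrow> exp (LINT z|m. iexp (G z) - 1)"
  proof (intro tendsto_exp integral_dominated_convergence[where w = "\<lambda>z. 2 * \<bar>G z\<bar>"])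
    show "AE z in m. (\<lambda>i. iexp (F i z) - 1) \<longlonglongrightarrow> iexp (G z) - 1"
      using F(2) by (auto intro!: AE_I2 tendsto_intros)
    show "AE z in m. norm (iexp (F i z) - 1) \<le> 2 * \<bar>G z\<bar>" for i
      using F(3) by (auto intro!: AE_I2 order_trans[OF cmod_iexp_minus_one_le])
  qed (use G2 in auto)
  ultimately show ?thesis
    by (simp add: simple_characteristic[OF F(1) F_int] LIMSEQ_unique)
qed

end

lemma nn_integral_square_add_le:
  fixes f g :: "'a \<Rightarrow> real"
  assumes [measurable]: "f \<in> borel_measurable M" "g \<in> borel_measurable M"
  shows "(\<integral>\<^sup>+x. ennreal ((f x + g x)\<^sup>2) \<partial>M) \<le>
    2 * (\<integral>\<^sup>+x. ennreal ((f x)\<^sup>2) \<partial>M) + 2 * (\<integral>\<^sup>+x. ennreal ((g x)\<^sup>2) \<partial>M)"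
proof -
  have sq: "(f x + g x)\<^sup>2 \<le> 2 * (f x)\<^sup>2 + 2 * (g x)\<^sup>2" for x
    using zero_le_power2[of "f x - g x"] by (simp add: power2_sum power2_diff)
  have "(\<integral>\<^sup>+x. ennreal ((f x + g x)\<^sup>2) \<partial>M) \<le> (\<integral>\<^sup>+x. 2 * ennreal ((f x)\<^sup>2) + 2 * ennreal ((g x)\<^sup>2) \<partial>M)"
  proof (rule nn_integral_mono)
    fix x
    have "ennreal ((f x + g x)\<^sup>2) \<le> ennreal (2 * (f x)\<^sup>2 + 2 * (g x)\<^sup>2)"
      by (rule ennreal_leI) (rule sq)
    also have "\<dots> = 2 * ennreal ((f x)\<^sup>2) + 2 * ennreal ((g x)\<^sup>2)"
      by (simp add: ennreal_mult)
    finally show "ennreal ((f x + g x)\<^sup>2) \<le> 2 * ennreal ((f x)\<^sup>2) + 2 * ennreal ((g x)\<^sup>2)" .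
  qed
  also have "\<dots> = 2 * (\<integral>\<^sup>+x. ennreal ((f x)\<^sup>2) \<partial>M) + 2 * (\<integral>\<^sup>+x. ennreal ((g x)\<^sup>2) \<partial>M)"
    by (simp add: nn_integral_add nn_integral_cmult)
  finally show ?thesis .
qed

lemma tendsto_zero_double_sum:
  fixes a b c :: "nat \<Rightarrow> ennreal"
  assumes a: "a \<longlonglongrightarrow> 0" and b: "b \<longlonglongrightarrow> 0" and le: "\<And>n. c n \<le> 2 * a n + 2 * b n"
  shows "c \<longlonglongrightarrow> 0"
proof (rule tendsto_sandwich[where f = "\<lambda>_. 0"])
  have "(\<lambda>n. 2 * a n + 2 * b n) \<longlonglongrightarrow> 2 * 0 + 2 * 0"
    using a b by (intro tendsto_add ennreal_tendsto_cmult) auto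
  then show "(\<lambda>n. 2 * a n + 2 * b n) \<longlonglongrightarrow> 0" by simp
  show "\<forall>\<^sub>F n in sequentially. c n \<le> 2 * a n + 2 * b n"
    by (intro always_eventually allI le)
qed (simp, rule tendsto_const)

text \<open>The map \<open>iexp\<close> is 1-Lipschitz and on a probability space the L1 norm is at
  most the L2 norm.\<close>

lemma (in prob_space) tendsto_expectation_iexp:
  fixes X :: "nat \<Rightarrow> 'a \<Rightarrow> real"
  assumes [measurable]: "\<And>n. X n \<in> borel_measurable M" "Y \<in> borel_measurable M"
    and conv: "(\<lambda>n. \<integral>\<^sup>+\<omega>. ennreal ((X n \<omega> - Y \<omega>)\<^sup>2) \<partial>M) \<longlonglongrightarrow> 0"
  shows "(\<lambda>n. expectation (\<lambda>\<omega>. iexp (X n \<omega>))) \<longlonglongrightarrow> expectation (\<lambda>\<omega>. iexp (Y \<omega>))"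
proof -
  define d where "d n = expectation (\<lambda>\<omega>. (X n \<omega> - Y \<omega>)\<^sup>2)" for n
  \<comment> \<open>Early terms may be infinite, in which case their Bochner integrals would be 0
    and the estimate meaningless.\<close>
  have fin: "\<forall>\<^sub>F n in sequentially. (\<integral>\<^sup>+\<omega>. ennreal ((X n \<omega> - Y \<omega>)\<^sup>2) \<partial>M) < \<infinity>"
    using order_tendstoD(2)[OF conv, of \<infinity>] by simp
  have "(\<lambda>n. enn2real (\<integral>\<^sup>+\<omega>. ennreal ((X n \<omega> - Y \<omega>)\<^sup>2) \<partial>M)) \<longlonglongrightarrow> enn2real 0"
    using tendsto_enn2real[OF conv[folded ennreal_0]] by simp
  then have "d \<longlonglongrightarrow> 0"
    unfolding d_def by (simp add: integral_eq_nn_integral)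
  then have "(\<lambda>n. sqrt (d n)) \<longlonglongrightarrow> 0"
    using tendsto_real_sqrt by fastforce
  moreover have "\<forall>\<^sub>F n in sequentially. norm (expectation (\<lambda>\<omega>. iexp (X n \<omega>)) - expectation (\<lambda>\<omega>. iexp (Y \<omega>))) \<le> sqrt (d n)"
    using fin
  proof eventually_elim
    case (elim n)
    then have int: "integrable M (\<lambda>\<omega>. (X n \<omega> - Y \<omega>)\<^sup>2)"
      by (intro integrableI_bounded) auto
    have i1: "integrable M (\<lambda>\<omega>. iexp (X n \<omega>))" "integrable M (\<lambda>\<omega>. iexp (Y \<omega>))"
      by (auto intro!: integrable_const_bound[where B = 1])
    have "norm (expectation (\<lambda>\<omega>. iexp (X n \<omega>)) - expectation (\<lambda>\<omega>. iexp (Y \<omega>))) =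
        norm (expectation (\<lambda>\<omega>. iexp (X n \<omega>) - iexp (Y \<omega>)))"
      using i1 by simp
    also have "\<dots> \<le> expectation (\<lambda>\<omega>. norm (iexp (X n \<omega>) - iexp (Y \<omega>)))"
      by (rule integral_norm_bound)
    also have "\<dots> \<le> expectation (\<lambda>\<omega>. \<bar>X n \<omega> - Y \<omega>\<bar>)"
    proof (rule integral_mono)
      show "integrable M (\<lambda>\<omega>. norm (iexp (X n \<omega>) - iexp (Y \<omega>)))"
        using i1 by (intro integrable_norm Bochner_Integration.integrable_diff)
      show "integrable M (\<lambda>\<omega>. \<bar>X n \<omega> - Y \<omega>\<bar>)"
        using expectation_abs_le_sqrt(1)[OF _ int] by simp
    qed (rule cmod_iexp_diff_le)
    also have "\<dots> \<le> sqrt (d n)"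
      unfolding d_def by (rule expectation_abs_le_sqrt(2)[OF _ int]) simp
    finally show ?case .
  qed
  ultimately have "(\<lambda>n. expectation (\<lambda>\<omega>. iexp (X n \<omega>)) - expectation (\<lambda>\<omega>. iexp (Y \<omega>))) \<longlonglongrightarrow> 0"
    by (rule Lim_null_comparison[rotated])
  then show ?thesis by (rule LIM_zero_cancel)
qed

section \<open>Linearity, existence and characteristic function of the compensated integral\<close>

context poisson_random_measure_space
begin

lemma integral_Q_add:
  fixes G H :: "'e \<Rightarrow> real"
  assumes "integrable m G" "integrable m H"
  shows "AE \<omega> in N. (LINT z|Q \<omega>. G z + H z) = (LINT z|Q \<omega>. G z) + (LINT z|Q \<omega>. H z)"
  using integrable_Q(1)[OF assms(1)] integrable_Q(1)[OF assms(2)]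
  by eventually_elim (rule Bochner_Integration.integral_add)

lemma integral_Q_diff:
  fixes G H :: "'e \<Rightarrow> real"
  assumes "integrable m G" "integrable m H"
  shows "AE \<omega> in N. (LINT z|Q \<omega>. G z - H z) = (LINT z|Q \<omega>. G z) - (LINT z|Q \<omega>. H z)"
  using integrable_Q(1)[OF assms(1)] integrable_Q(1)[OF assms(2)]
  by eventually_elim (rule Bochner_Integration.integral_diff)

lemma is_compensated_integral_zero: "is_compensated_integral N m Q (\<lambda>_. 0) (\<lambda>_. 0)"
  unfolding is_compensated_integral_def by (auto intro!: exI[of _ "\<lambda>_ _. 0"])

lemma is_compensated_integral_scale:
  assumes "is_compensated_integral N m Q g Y"
  shows "is_compensated_integral N m Q (\<lambda>z. t * g z) (\<lambda>\<omega>. t * Y \<omega>)"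
proof -
  from assms obtain G where [measurable]: "g \<in> borel_measurable m" "Y \<in> borel_measurable N"
    and int: "\<And>n. integrable m (G n)" "\<And>n. integrable m (\<lambda>z. (G n z)\<^sup>2)"
    and conv: "(\<lambda>n. \<integral>\<^sup>+z. ennreal ((G n z - g z)\<^sup>2) \<partial>m) \<longlonglongrightarrow> 0"
    "(\<lambda>n. \<integral>\<^sup>+\<omega>. ennreal (((LINT z|Q \<omega>. G n z) - (LINT z|m. G n z) - Y \<omega>)\<^sup>2) \<partial>N) \<longlonglongrightarrow> 0"
    unfolding is_compensated_integral_def by blast
  have [measurable]: "G n \<in> borel_measurable m" for n using int(1) by simp
  have [measurable]: "(\<lambda>\<omega>. LINT z|Q \<omega>. G n z) \<in> borel_measurable N" for n
    by (rule integral_Q_measurable) simp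
  have sq: "ennreal ((t * x)\<^sup>2) = ennreal (t\<^sup>2) * ennreal (x\<^sup>2)" for x
    by (simp add: power_mult_distrib ennreal_mult)
  have lim: "(\<lambda>n. ennreal (t\<^sup>2) * u n) \<longlonglongrightarrow> 0" if "u \<longlonglongrightarrow> 0" for u :: "nat \<Rightarrow> ennreal"
    using ennreal_tendsto_cmult[OF _ that, of "ennreal (t\<^sup>2)"] by simp
  have 1: "(\<integral>\<^sup>+z. ennreal ((t * G n z - t * g z)\<^sup>2) \<partial>m) = ennreal (t\<^sup>2) * (\<integral>\<^sup>+z. ennreal ((G n z - g z)\<^sup>2) \<partial>m)" for n
    unfolding right_diff_distrib[symmetric] sq by (rule nn_integral_cmult) simp
  have 2: "(\<integral>\<^sup>+\<omega>. ennreal (((LINT z|Q \<omega>. t * G n z) - (LINT z|m. t * G n z) - t * Y \<omega>)\<^sup>2) \<partial>N) =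
      ennreal (t\<^sup>2) * (\<integral>\<^sup>+\<omega>. ennreal (((LINT z|Q \<omega>. G n z) - (LINT z|m. G n z) - Y \<omega>)\<^sup>2) \<partial>N)" for n
    unfolding integral_mult_right_zero right_diff_distrib[symmetric] sq by (rule nn_integral_cmult) measurable
  show ?thesis
    unfolding is_compensated_integral_def
  proof (intro conjI exI[of _ "\<lambda>n z. t * G n z"] allI)
    show "(\<lambda>n. \<integral>\<^sup>+z. ennreal ((t * G n z - t * g z)\<^sup>2) \<partial>m) \<longlonglongrightarrow> 0"
      unfolding 1 by (intro lim conv)
    show "(\<lambda>n. \<integral>\<^sup>+\<omega>. ennreal (((LINT z|Q \<omega>. t * G n z) - (LINT z|m. t * G n z) - t * Y \<omega>)\<^sup>2) \<partial>N) \<longlonglongrightarrow> 0"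
      unfolding 2 by (intro lim conv)
  qed (use int in \<open>auto simp: power_mult_distrib\<close>)
qed

lemma is_compensated_integral_add:
  assumes "is_compensated_integral N m Q g Y" "is_compensated_integral N m Q g' Y'"
  shows "is_compensated_integral N m Q (\<lambda>z. g z + g' z) (\<lambda>\<omega>. Y \<omega> + Y' \<omega>)"
proof -
  from assms(1) obtain G where [measurable]: "g \<in> borel_measurable m" "Y \<in> borel_measurable N"
    and int: "\<And>n. integrable m (G n)" "\<And>n. integrable m (\<lambda>z. (G n z)\<^sup>2)"
    and conv: "(\<lambda>n. \<integral>\<^sup>+z. ennreal ((G n z - g z)\<^sup>2) \<partial>m) \<longlonglongrightarrow> 0"
    "(\<lambda>n. \<integral>\<^sup>+\<omega>. ennreal (((LINT z|Q \<omega>. G n z) - (LINT z|m. G n z) - Y \<omega>)\<^sup>2) \<partial>N) \<longlonglongrightarrow> 0"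
    unfolding is_compensated_integral_def by blast
  from assms(2) obtain G' where [measurable]: "g' \<in> borel_measurable m" "Y' \<in> borel_measurable N"
    and int': "\<And>n. integrable m (G' n)" "\<And>n. integrable m (\<lambda>z. (G' n z)\<^sup>2)"
    and conv': "(\<lambda>n. \<integral>\<^sup>+z. ennreal ((G' n z - g' z)\<^sup>2) \<partial>m) \<longlonglongrightarrow> 0"
    "(\<lambda>n. \<integral>\<^sup>+\<omega>. ennreal (((LINT z|Q \<omega>. G' n z) - (LINT z|m. G' n z) - Y' \<omega>)\<^sup>2) \<partial>N) \<longlonglongrightarrow> 0"
    unfolding is_compensated_integral_def by blast
  have [measurable]: "G n \<in> borel_measurable m" "G' n \<in> borel_measurable m" for n
    using int(1) int'(1) by simp_all
  have [measurable]: "(\<lambda>\<omega>. LINT z|Q \<omega>. G n z) \<in> borel_measurable N"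
    "(\<lambda>\<omega>. LINT z|Q \<omega>. G' n z) \<in> borel_measurable N" for n
    by (rule integral_Q_measurable, simp)+
  have 1: "(\<integral>\<^sup>+z. ennreal ((G n z + G' n z - (g z + g' z))\<^sup>2) \<partial>m) \<le>
      2 * (\<integral>\<^sup>+z. ennreal ((G n z - g z)\<^sup>2) \<partial>m) + 2 * (\<integral>\<^sup>+z. ennreal ((G' n z - g' z)\<^sup>2) \<partial>m)" for n
    unfolding add_diff_add by (rule nn_integral_square_add_le) measurable
  have 2: "(\<integral>\<^sup>+\<omega>. ennreal (((LINT z|Q \<omega>. G n z + G' n z) - (LINT z|m. G n z + G' n z) - (Y \<omega> + Y' \<omega>))\<^sup>2) \<partial>N) \<le>
      2 * (\<integral>\<^sup>+\<omega>. ennreal (((LINT z|Q \<omega>. G n z) - (LINT z|m. G n z) - Y \<omega>)\<^sup>2) \<partial>N) +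
      2 * (\<integral>\<^sup>+\<omega>. ennreal (((LINT z|Q \<omega>. G' n z) - (LINT z|m. G' n z) - Y' \<omega>)\<^sup>2) \<partial>N)" for n
  proof -
    have "(\<integral>\<^sup>+\<omega>. ennreal (((LINT z|Q \<omega>. G n z + G' n z) - (LINT z|m. G n z + G' n z) - (Y \<omega> + Y' \<omega>))\<^sup>2) \<partial>N) =
       (\<integral>\<^sup>+\<omega>. ennreal ((((LINT z|Q \<omega>. G n z) - (LINT z|m. G n z) - Y \<omega>) +
         ((LINT z|Q \<omega>. G' n z) - (LINT z|m. G' n z) - Y' \<omega>))\<^sup>2) \<partial>N)"
    proof (intro nn_integral_cong_AE, use integral_Q_add[OF int(1)[of n] int'(1)[of n]] in eventually_elim)
      case (elim \<omega>)
      then show ?case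
        using int(1)[of n] int'(1)[of n] by (simp add: algebra_simps)
    qed
    also have "\<dots> \<le> 2 * (\<integral>\<^sup>+\<omega>. ennreal (((LINT z|Q \<omega>. G n z) - (LINT z|m. G n z) - Y \<omega>)\<^sup>2) \<partial>N) +
      2 * (\<integral>\<^sup>+\<omega>. ennreal (((LINT z|Q \<omega>. G' n z) - (LINT z|m. G' n z) - Y' \<omega>)\<^sup>2) \<partial>N)"
      by (rule nn_integral_square_add_le) measurable
    finally show ?thesis .
  qed
  have sq: "integrable m (\<lambda>z. (G n z + G' n z)\<^sup>2)" for n
  proof -
    have "integrable m (\<lambda>z. G n z * G' n z)"
      by (rule integral_abs_mult_le_sqrt) (use int int' in auto)
    then show ?thesis
      using int(2)[of n] int'(2)[of n] by (simp add: power2_sum mult.assoc)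
  qed
  show ?thesis
    unfolding is_compensated_integral_def
    using tendsto_zero_double_sum[OF conv(1) conv'(1) 1] tendsto_zero_double_sum[OF conv(2) conv'(2) 2] int int' sq
    by (intro conjI exI[of _ "\<lambda>n z. G n z + G' n z"] allI) auto
qed

text \<open>The field picks each of its values separately by Hilbert choice. Linearity of the
  relation makes a linear combination of these values a compensated integral of the combined
  integrand, which determines the joint law.\<close>

lemma is_compensated_integral_sum:
  assumes "finite I" "\<And>i. i \<in> I \<Longrightarrow> is_compensated_integral N m Q (g i) (Y i)"
  shows "is_compensated_integral N m Q (\<lambda>z. \<Sum>i\<in>I. t i * g i z) (\<lambda>\<omega>. \<Sum>i\<in>I. t i * Y i \<omega>)"
  using assms
proof (induction rule: finite_induct)
  case empty
  show ?case by (simp add: is_compensated_integral_zero)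
next
  case (insert i J)
  from is_compensated_integral_add[OF is_compensated_integral_scale[OF insert.prems[of i], of "t i"]
      insert.IH[OF insert.prems]]
  show ?case using insert.hyps by simp
qed

text \<open>Simple functions approximate \<open>g\<close> in mean square, the isometry makes their
  compensated integrals a Cauchy sequence, and completeness supplies the limit.\<close>

lemma compensated_integral_exists:
  assumes [measurable]: "g \<in> borel_measurable m" and g2: "integrable m (\<lambda>z. (g z)\<^sup>2)"
  shows "\<exists>Y. is_compensated_integral N m Q g Y"
proof -
  obtain F where F: "\<And>i. simple_function m (F i)" "\<And>z. z \<in> space m \<Longrightarrow> (\<lambda>i. F i z) \<longlonglongrightarrow> g z"
    "\<And>i z. z \<in> space m \<Longrightarrow> \<bar>F i z\<bar> \<le> 2 * \<bar>g z\<bar>"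
    using borel_measurable_implies_sequence_metric[of g m 0] by (simp add: dist_real_def) blast
  have Fm[measurable]: "F i \<in> borel_measurable m" for i
    using F(1) by (rule borel_measurable_simple_function)
  have bound2: "(F i z)\<^sup>2 \<le> 4 * (g z)\<^sup>2" if "z \<in> space m" for i z
    using power_mono[OF F(3)[OF that, of i], of 2] by (simp add: power_mult_distrib)
  have F2: "integrable m (\<lambda>z. (F i z)\<^sup>2)" for i
    by (rule Bochner_Integration.integrable_bound[OF integrable_mult_right[OF g2, of 4]])
      (use bound2 in auto)
  have F1: "integrable m (F i)" for i
    by (rule simple_function_square_integrable[OF F(1) F2])
  have "(\<lambda>i. \<integral>\<^sup>+z. ennreal ((F i z - g z)\<^sup>2) \<partial>m) \<longlonglongrightarrow> (\<integral>\<^sup>+z. 0 \<partial>m)"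
  \<comment> \<open>The constant 10 comes from (F - g)^2 \<le> 2 F^2 + 2 g^2 together with F^2 \<le>
    4 g^2.\<close>
  proof (rule nn_integral_dominated_convergence[where w = "\<lambda>z. ennreal (10 * (g z)\<^sup>2)"])
    show "AE z in m. ennreal ((F i z - g z)\<^sup>2) \<le> ennreal (10 * (g z)\<^sup>2)" for i
    proof (rule AE_I2, rule ennreal_leI)
      fix z assume "z \<in> space m"
      from bound2[OF this, of i] zero_le_power2[of "F i z + g z"]
      show "(F i z - g z)\<^sup>2 \<le> 10 * (g z)\<^sup>2"
        by (simp add: power2_sum power2_diff)
    qed
    show "(\<integral>\<^sup>+z. ennreal (10 * (g z)\<^sup>2) \<partial>m) < \<infinity>"
      using integrable_mult_right[OF g2, of 10] by (simp add: nn_integral_eq_integral)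
    show "AE z in m. (\<lambda>i. ennreal ((F i z - g z)\<^sup>2)) \<longlonglongrightarrow> 0"
    proof (rule AE_I2)
      fix z assume "z \<in> space m"
      then have "(\<lambda>i. ennreal ((F i z - g z)\<^sup>2)) \<longlonglongrightarrow> ennreal ((g z - g z)\<^sup>2)"
        by (intro tendsto_ennrealI tendsto_intros F(2))
      then show "(\<lambda>i. ennreal ((F i z - g z)\<^sup>2)) \<longlonglongrightarrow> 0" by simp
    qed
  qed auto
  then have conv: "(\<lambda>i. \<integral>\<^sup>+z. ennreal ((F i z - g z)\<^sup>2) \<partial>m) \<longlonglongrightarrow> 0" by simp
  \<comment> \<open>The extra factor 1/4 pays for the two terms of weight 2 in the quadratic
    triangle inequality, so the Cauchy bound becomes exactly (1/4)^k.\<close>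
  have "\<exists>i. (\<integral>\<^sup>+z. ennreal ((F i z - g z)\<^sup>2) \<partial>m) < ennreal ((1/4) ^ Suc k)" for k
  proof -
    have "0 < ennreal ((1/4) ^ Suc k)" by (simp add: ennreal_zero_less_divide)
    from order_tendstoD(2)[OF conv this] show ?thesis
      by (auto simp: eventually_sequentially)
  qed
  then obtain r where r: "\<And>k. (\<integral>\<^sup>+z. ennreal ((F (r k) z - g z)\<^sup>2) \<partial>m) < ennreal ((1/4) ^ Suc k)"
    by metis
  define G where "G k = F (r k)" for k
  note Gr = r[folded G_def]
  have [measurable]: "G k \<in> borel_measurable m" for k unfolding G_def by simp
  define I where "I k \<omega> = (LINT z|Q \<omega>. G k z) - (LINT z|m. G k z)" for k \<omega>
  have Im[measurable]: "I k \<in> borel_measurable N" for k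
    using integral_Q_measurable[of "G k"] unfolding I_def by simp
  have Cauchy: "(\<integral>\<^sup>+\<omega>. ennreal ((I k \<omega> - I l \<omega>)\<^sup>2) \<partial>N) \<le> ennreal ((1/4) ^ k)" if "k \<le> l" for k l
  proof -
    have simple: "simple_function m (\<lambda>z. G k z - G l z)" "integrable m (\<lambda>z. G k z - G l z)"
      using F(1) F1 unfolding G_def by auto
    have "(\<integral>\<^sup>+\<omega>. ennreal ((I k \<omega> - I l \<omega>)\<^sup>2) \<partial>N) =
        (\<integral>\<^sup>+\<omega>. ennreal (((LINT z|Q \<omega>. G k z - G l z) - (LINT z|m. G k z - G l z))\<^sup>2) \<partial>N)"
    proof (intro nn_integral_cong_AE, use integral_Q_diff[OF F1[of "r k"] F1[of "r l"]] in eventually_elim)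
      case (elim \<omega>)
      have mdiff: "(LINT z|m. F (r k) z - F (r l) z) = (LINT z|m. F (r k) z) - (LINT z|m. F (r l) z)"
        by (rule Bochner_Integration.integral_diff) (rule F1)+
      then show ?case
        unfolding I_def G_def elim mdiff by (simp add: algebra_simps)
    qed
    also have "\<dots> = (\<integral>\<^sup>+z. ennreal ((G k z - G l z)\<^sup>2) \<partial>m)"
      by (rule simple_isometry[OF simple])
    also have "\<dots> = (\<integral>\<^sup>+z. ennreal (((G k z - g z) + (g z - G l z))\<^sup>2) \<partial>m)"
      by simp
    also have "\<dots> \<le> 2 * (\<integral>\<^sup>+z. ennreal ((G k z - g z)\<^sup>2) \<partial>m) + 2 * (\<integral>\<^sup>+z. ennreal ((g z - G l z)\<^sup>2) \<partial>m)"
      by (rule nn_integral_square_add_le) measurable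
    also have "\<dots> \<le> 2 * ennreal ((1/4) ^ Suc k) + 2 * ennreal ((1/4) ^ Suc k)"
    proof (intro add_mono mult_left_mono)
      show "(\<integral>\<^sup>+z. ennreal ((G k z - g z)\<^sup>2) \<partial>m) \<le> ennreal ((1/4) ^ Suc k)"
        using Gr by (rule less_imp_le)
      have "(\<integral>\<^sup>+z. ennreal ((g z - G l z)\<^sup>2) \<partial>m) \<le> ennreal ((1/4) ^ Suc l)"
        using Gr[of l] by (simp add: power2_commute less_imp_le)
      also have "\<dots> \<le> ennreal ((1/4) ^ Suc k)"
        using that by (intro ennreal_leI power_decreasing) auto
      finally show "(\<integral>\<^sup>+z. ennreal ((g z - G l z)\<^sup>2) \<partial>m) \<le> ennreal ((1/4) ^ Suc k)" .
    qed auto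
    also have "\<dots> = ennreal (2 * (1/4) ^ Suc k + 2 * (1/4) ^ Suc k)"
      by (simp only: ennreal_plus ennreal_mult' ennreal_numeral zero_le_power zero_le_mult_iff
        zero_le_numeral zero_le_divide_1_iff simp_thms)
    also have "2 * (1/4) ^ Suc k + 2 * (1/4) ^ Suc k = (1/4::real) ^ k"
      by simp
    finally show ?thesis .
  qed
  obtain Y where Y: "Y \<in> borel_measurable N" "(\<lambda>k. \<integral>\<^sup>+\<omega>. ennreal ((I k \<omega> - Y \<omega>)\<^sup>2) \<partial>N) \<longlonglongrightarrow> 0"
    using L2_limit[OF Im Cauchy] by blast
  have "(\<lambda>k. \<integral>\<^sup>+z. ennreal ((G k z - g z)\<^sup>2) \<partial>m) \<longlonglongrightarrow> 0"
  proof (rule tendsto_sandwich[where f = "\<lambda>_. 0"])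
    show "\<forall>\<^sub>F k in sequentially. (\<integral>\<^sup>+z. ennreal ((G k z - g z)\<^sup>2) \<partial>m) \<le> ennreal ((1/4) ^ Suc k)"
      by (intro always_eventually allI less_imp_le Gr)
    have "(\<lambda>k. (1/4::real) ^ k) \<longlonglongrightarrow> 0" by (rule LIMSEQ_realpow_zero) auto
    then have "(\<lambda>k. ennreal ((1/4) ^ Suc k)) \<longlonglongrightarrow> ennreal 0"
      by (intro tendsto_ennrealI LIMSEQ_Suc)
    then show "(\<lambda>k. ennreal ((1/4) ^ Suc k)) \<longlonglongrightarrow> 0" by (simp only: ennreal_0)
  qed (simp, rule tendsto_const)
  then have "is_compensated_integral N m Q g Y"
    unfolding is_compensated_integral_def using Y F1 F2
    by (intro conjI exI[of _ G] allI) (auto simp: G_def I_def)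
  then show ?thesis by blast
qed

text \<open>Subtracting the mean of an integrable \<open>G n\<close> turns the exponent
  \<open>iexp - 1\<close> into \<open>compensated_iexp\<close>, and this formula passes to the L2
  limit. Square integrability of \<open>g\<close> follows since some \<open>G n\<close> is at finite
  L2 distance from it.\<close>

lemma compensated_integral_characteristic:
  assumes "is_compensated_integral N m Q g Y"
  shows "integrable m (\<lambda>z. (g z)\<^sup>2)"
    and "expectation (\<lambda>\<omega>. iexp (Y \<omega>)) = exp (LINT z|m. compensated_iexp (g z))"
proof -
  from assms obtain G where [measurable]: "g \<in> borel_measurable m" "Y \<in> borel_measurable N"
    and int: "\<And>n. integrable m (G n)" "\<And>n. integrable m (\<lambda>z. (G n z)\<^sup>2)"
    and conv: "(\<lambda>n. \<integral>\<^sup>+z. ennreal ((G n z - g z)\<^sup>2) \<partial>m) \<longlonglongrightarrow> 0"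
    "(\<lambda>n. \<integral>\<^sup>+\<omega>. ennreal (((LINT z|Q \<omega>. G n z) - (LINT z|m. G n z) - Y \<omega>)\<^sup>2) \<partial>N) \<longlonglongrightarrow> 0"
    unfolding is_compensated_integral_def by blast
  have [measurable]: "G n \<in> borel_measurable m" for n using int(1) by simp
  have [measurable]: "(\<lambda>\<omega>. LINT z|Q \<omega>. G n z) \<in> borel_measurable N" for n
    by (rule integral_Q_measurable) simp
  have fin: "\<forall>\<^sub>F n in sequentially. (\<integral>\<^sup>+z. ennreal ((G n z - g z)\<^sup>2) \<partial>m) < \<infinity>"
    using order_tendstoD(2)[OF conv(1), of \<infinity>] by simp
  then obtain n where "(\<integral>\<^sup>+z. ennreal ((G n z - g z)\<^sup>2) \<partial>m) < \<infinity>"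
    by (auto simp: eventually_sequentially)
  then have "integrable m (\<lambda>z. (G n z - g z)\<^sup>2)"
    by (intro integrableI_bounded) auto
  then have "integrable m (\<lambda>z. 2 * (G n z - g z)\<^sup>2 + 2 * (G n z)\<^sup>2)"
    using int(2) by simp
  then show g2: "integrable m (\<lambda>z. (g z)\<^sup>2)"
  proof (rule Bochner_Integration.integrable_bound)
    have "(g z)\<^sup>2 \<le> 2 * (G n z - g z)\<^sup>2 + 2 * (G n z)\<^sup>2" for z
      using zero_le_power2[of "2 * G n z - g z"] by (simp add: power2_sum power2_diff power_mult_distrib)
    then show "AE z in m. norm ((g z)\<^sup>2) \<le> norm (2 * (G n z - g z)\<^sup>2 + 2 * (G n z)\<^sup>2)"
      by simp
  qed simp
  have comp_int: "integrable m (\<lambda>z. compensated_iexp (u z))"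
    if [measurable]: "u \<in> borel_measurable m" and "integrable m (\<lambda>z. (u z)\<^sup>2)" for u
    by (rule Bochner_Integration.integrable_bound[OF that(2)])
      (auto intro!: AE_I2 order_trans[OF cmod_compensated_iexp_le])
  define d where "d n = (LINT z|m. (G n z - g z)\<^sup>2)" for n
  have "(\<lambda>n. enn2real (\<integral>\<^sup>+z. ennreal ((G n z - g z)\<^sup>2) \<partial>m)) \<longlonglongrightarrow> enn2real 0"
    using tendsto_enn2real[OF conv(1)[folded ennreal_0]] by simp
  then have d0: "d \<longlonglongrightarrow> 0"
    unfolding d_def by (simp add: integral_eq_nn_integral)
  have "(\<lambda>n. LINT z|m. compensated_iexp (G n z)) \<longlonglongrightarrow> (LINT z|m. compensated_iexp (g z))"
  proof (rule LIM_zero_cancel, rule Lim_null_comparison)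
    show "\<forall>\<^sub>F n in sequentially. norm ((LINT z|m. compensated_iexp (G n z)) - (LINT z|m. compensated_iexp (g z))) \<le>
      2 * (d n + sqrt (d n * (LINT z|m. (g z)\<^sup>2)))"
      using fin
    proof eventually_elim
      case (elim n)
      then have i: "integrable m (\<lambda>z. (G n z - g z)\<^sup>2)"
        by (intro integrableI_bounded) auto
      have CS: "integrable m (\<lambda>z. (G n z - g z) * g z)"
        "(LINT z|m. \<bar>(G n z - g z) * g z\<bar>) \<le> sqrt (d n * (LINT z|m. (g z)\<^sup>2))"
        unfolding d_def by (rule integral_abs_mult_le_sqrt; (use i g2 in simp))+
      have "norm ((LINT z|m. compensated_iexp (G n z)) - (LINT z|m. compensated_iexp (g z))) =
          norm (LINT z|m. compensated_iexp (G n z) - compensated_iexp (g z))"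
        using comp_int int(2) g2 by simp
      also have "\<dots> \<le> (LINT z|m. norm (compensated_iexp (G n z) - compensated_iexp (g z)))"
        by (rule integral_norm_bound)
      also have "\<dots> \<le> (LINT z|m. 2 * ((G n z - g z)\<^sup>2 + \<bar>(G n z - g z) * g z\<bar>))"
        by (intro integral_mono cmod_compensated_iexp_diff_le integrable_norm
          Bochner_Integration.integrable_diff comp_int integrable_mult_right Bochner_Integration.integrable_add
          integrable_abs CS i int(2) g2) simp_all
      also have "\<dots> = 2 * (d n + (LINT z|m. \<bar>(G n z - g z) * g z\<bar>))"
        using i integrable_abs[OF CS(1)] by (simp add: d_def)
      also have "\<dots> \<le> 2 * (d n + sqrt (d n * (LINT z|m. (g z)\<^sup>2)))"
        using CS(2) by simp
      finally show ?case .
    qed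
    have "(\<lambda>n. 2 * (d n + sqrt (d n * (LINT z|m. (g z)\<^sup>2)))) \<longlonglongrightarrow> 2 * (0 + sqrt (0 * (LINT z|m. (g z)\<^sup>2)))"
      by (intro tendsto_intros d0)
    then show "(\<lambda>n. 2 * (d n + sqrt (d n * (LINT z|m. (g z)\<^sup>2)))) \<longlonglongrightarrow> 0" by simp
  qed
  then have "(\<lambda>n. exp (LINT z|m. compensated_iexp (G n z))) \<longlonglongrightarrow> exp (LINT z|m. compensated_iexp (g z))"
    by (rule tendsto_exp)
  moreover have "expectation (\<lambda>\<omega>. iexp ((LINT z|Q \<omega>. G n z) - (LINT z|m. G n z))) =
      exp (LINT z|m. compensated_iexp (G n z))" for n
  proof -
    have i: "integrable m (\<lambda>z. iexp (G n z) - 1)"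
      by (rule Bochner_Integration.integrable_bound[OF int(1)[of n]])
        (use cmod_iexp_minus_one_le[of "G n _"] in \<open>auto intro!: AE_I2\<close>)
    have "iexp ((LINT z|Q \<omega>. G n z) - (LINT z|m. G n z)) =
        iexp (LINT z|Q \<omega>. G n z) * iexp (- (LINT z|m. G n z))" for \<omega>
      by (simp add: exp_add[symmetric] algebra_simps)
    then have "expectation (\<lambda>\<omega>. iexp ((LINT z|Q \<omega>. G n z) - (LINT z|m. G n z))) =
        exp (LINT z|m. iexp (G n z) - 1) * iexp (- (LINT z|m. G n z))"
      using integral_characteristic[OF int(1)[of n]] by simp
    also have "\<dots> = exp ((LINT z|m. iexp (G n z) - 1) - \<i> * (LINT z|m. complex_of_real (G n z)))"
      by (simp add: exp_add[symmetric])
    also have "(LINT z|m. iexp (G n z) - 1) - \<i> * (LINT z|m. complex_of_real (G n z)) =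
        (LINT z|m. compensated_iexp (G n z))"
      unfolding compensated_iexp_def using i int(1)[of n]
      by (subst Bochner_Integration.integral_diff) (auto simp del: integral_complex_of_real intro!: integrable_mult_right)
    finally show ?thesis .
  qed
  moreover have "(\<lambda>n. expectation (\<lambda>\<omega>. iexp ((LINT z|Q \<omega>. G n z) - (LINT z|m. G n z)))) \<longlonglongrightarrow>
      expectation (\<lambda>\<omega>. iexp (Y \<omega>))"
    by (rule tendsto_expectation_iexp) (use conv(2) in auto)
  ultimately show "expectation (\<lambda>\<omega>. iexp (Y \<omega>)) = exp (LINT z|m. compensated_iexp (g z))"
    by (simp add: LIMSEQ_unique)
qed

lemma is_compensated_integral_compensated_integral:
  assumes "g \<in> borel_measurable m" "integrable m (\<lambda>z. (g z)\<^sup>2)"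
  shows "is_compensated_integral N m Q g (compensated_integral N m Q g)"
  unfolding compensated_integral_def using compensated_integral_exists[OF assms] by (rule someI_ex)

end

section \<open>Second moments of determinantal processes\<close>

text \<open>The mean of a weighted random sum is an integral against the measure \<open>P\<close>.
  Formulas for such sums can thus be verified as equalities of measures, on a generating class of
  sets. It is applied to points and to ordered pairs of points.\<close>

lemma (in prob_space) nn_integral_point_measure:
  fixes W :: "'i::countable \<Rightarrow> 'a \<Rightarrow> ennreal" and Z :: "'i \<Rightarrow> 'a \<Rightarrow> 'e"
  assumes [measurable]: "\<And>i. W i \<in> borel_measurable M" "\<And>i. Z i \<in> measurable M S"
    and [measurable]: "g \<in> borel_measurable S"
  defines "P \<equiv> distr (density (M \<Otimes>\<^sub>M count_space UNIV) (\<lambda>p. W (snd p) (fst p))) S (\<lambda>p. Z (snd p) (fst p))"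
  shows "(\<integral>\<^sup>+z. g z \<partial>P) = (\<integral>\<^sup>+\<omega>. (\<integral>\<^sup>+i. W i \<omega> * g (Z i \<omega>) \<partial>count_space UNIV) \<partial>M)"
proof -
  interpret C: sigma_finite_measure "count_space (UNIV :: 'i set)"
    by (rule sigma_finite_measure_count_space_countable) simp
  have W[measurable]: "(\<lambda>p. W (snd p) (fst p)) \<in> borel_measurable (M \<Otimes>\<^sub>M count_space UNIV)"
    by (rule measurable_compose_countable[where f = "\<lambda>i p. W i (fst p)" and g = snd]) auto
  have Z[measurable]: "(\<lambda>p. Z (snd p) (fst p)) \<in> measurable (M \<Otimes>\<^sub>M count_space UNIV) S"
    by (rule measurable_compose_countable[where f = "\<lambda>i p. Z i (fst p)" and g = snd]) auto
  have "(\<integral>\<^sup>+z. g z \<partial>P) = (\<integral>\<^sup>+p. W (snd p) (fst p) * g (Z (snd p) (fst p)) \<partial>(M \<Otimes>\<^sub>M count_space UNIV))"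
    unfolding P_def by (simp add: nn_integral_distr nn_integral_density)
  also have "\<dots> = (\<integral>\<^sup>+\<omega>. (\<integral>\<^sup>+i. W i \<omega> * g (Z i \<omega>) \<partial>count_space UNIV) \<partial>M)"
    by (subst C.nn_integral_fst[symmetric]) auto
  finally show ?thesis .
qed

lemma correlation_det_1: "correlation_det k (Suc 0) x = k (x 0) (x 0)"
  unfolding correlation_det_def by (subst det_single) auto

lemma det_two_by_two:
  fixes A :: "'c::comm_ring_1 mat"
  assumes A: "A \<in> carrier_mat 2 2"
  shows "det A = A $$ (0, 0) * A $$ (1, 1) - A $$ (0, 1) * A $$ (1, 0)"
proof -
  have 0: "det (mat_delete A 0 0) = A $$ (1, 1)"
    by (subst det_single) (use A in \<open>simp_all add: mat_delete_def\<close>)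
  have 1: "det (mat_delete A 0 1) = A $$ (1, 0)"
    by (subst det_single) (use A in \<open>simp_all add: mat_delete_def\<close>)
  have "det A = (\<Sum>j<2. A $$ (0, j) * cofactor A 0 j)"
    by (rule laplace_expansion_row[OF A]) simp
  also have "\<dots> = A $$ (0, 0) * cofactor A 0 0 + A $$ (0, 1) * cofactor A 0 1"
    by (simp add: numeral_2_eq_2)
  finally show ?thesis
    unfolding cofactor_def 0 1 by simp
qed

lemma correlation_det_2:
  "correlation_det k 2 x = k (x 0) (x 0) * k (x 1) (x 1) - k (x 0) (x 1) * k (x 1) (x 0)"
  unfolding correlation_det_def by (subst det_two_by_two) simp_all

lemma nn_integral_reflect_shift:
  fixes g :: "'a::euclidean_space \<Rightarrow> ennreal"
  assumes [measurable]: "g \<in> borel_measurable borel"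
  shows "(\<integral>\<^sup>+y. g (x - y) \<partial>lborel) = (\<integral>\<^sup>+y. g y \<partial>lborel)"
    and "(\<integral>\<^sup>+y. g (y - x) \<partial>lborel) = (\<integral>\<^sup>+y. g y \<partial>lborel)"
proof -
  have *: "(\<integral>\<^sup>+y. g y \<partial>lborel) = (\<integral>\<^sup>+y. g (t + c *\<^sub>R y) \<partial>lborel)" if "\<bar>c\<bar> = 1" for t c
    using that by (subst lborel_affine[of c t]) (auto simp: nn_integral_density nn_integral_distr)
  show "(\<integral>\<^sup>+y. g (x - y) \<partial>lborel) = (\<integral>\<^sup>+y. g y \<partial>lborel)"
    using *[of "- 1" x] by simp
  show "(\<integral>\<^sup>+y. g (y - x) \<partial>lborel) = (\<integral>\<^sup>+y. g y \<partial>lborel)"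
    using *[of 1 "- x"] by simp
qed

lemma two_mult_le_ennreal: "2 * (x * y) \<le> x\<^sup>2 + (y::ennreal)\<^sup>2"
proof (cases "x = \<infinity> \<or> y = \<infinity>")
  case True
  then show ?thesis by (auto simp: power2_eq_square ennreal_top_mult ennreal_mult_top)
next
  case False
  then obtain a b where "0 \<le> a" "0 \<le> b" "x = ennreal a" "y = ennreal b"
    by (cases x; cases y) auto
  moreover have "2 * (a * b) \<le> a\<^sup>2 + b\<^sup>2"
    using zero_le_power2[of "a - b"] by (simp add: power2_diff)
  then have "ennreal (2 * (a * b)) \<le> ennreal (a\<^sup>2 + b\<^sup>2)" by (rule ennreal_leI)
  ultimately show ?thesis
    by (simp add: ennreal_mult ennreal_plus ennreal_power)
qed

lemma ennreal_half_le: "2 * (x::ennreal) \<le> 2 * y \<Longrightarrow> x \<le> y"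
  by (simp add: ennreal_mult_le_mult_iff)

lemma borel_measurable_lborel_pair:
  "borel_measurable ((lborel :: 'a::euclidean_space measure) \<Otimes>\<^sub>M (lborel :: 'b::euclidean_space measure)) = borel_measurable borel"
  by (simp add: lborel_prod)

lemma borel_rectangle:
  fixes A :: "'a::euclidean_space set" and B :: "'b::euclidean_space set"
  shows "A \<in> sets borel \<Longrightarrow> B \<in> sets borel \<Longrightarrow> A \<times> B \<in> sets borel"
  unfolding borel_prod[symmetric] by (rule pair_measureI)

text \<open>The determinantal identity speaks about disjoint sets only, that is, about rectangles
  that avoid the diagonal. Countably many of them exhaust its complement, and bounded sides keep
  their measures finite.\<close>

lemma countable_disjoint_rectangle_cover:
  obtains \<C> :: "('a::euclidean_space set \<times> 'a set) set" where "countable \<C>"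
    "\<And>U V. (U, V) \<in> \<C> \<Longrightarrow> open U \<and> open V \<and> bounded U \<and> bounded V \<and> U \<inter> V = {}"
    "(\<Union>(U, V)\<in>\<C>. U \<times> V) = {(x, y). x \<noteq> y}"
proof -
  obtain \<B> :: "'a set set" where \<B>: "countable \<B>" "topological_basis \<B>"
    using ex_countable_basis by blast
  define \<C> where "\<C> = {(U, V). U \<in> \<B> \<and> V \<in> \<B> \<and> bounded U \<and> bounded V \<and> U \<inter> V = {}}"
  have "\<C> \<subseteq> \<B> \<times> \<B>" by (auto simp: \<C>_def)
  then have "countable \<C>" by (rule countable_subset) (intro countable_SIGMA \<B>(1))
  moreover have "open U \<and> open V \<and> bounded U \<and> bounded V \<and> U \<inter> V = {}" if "(U, V) \<in> \<C>" for U V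
    using that topological_basis_open[OF \<B>(2)] by (auto simp: \<C>_def)
  moreover have "\<exists>(U, V)\<in>\<C>. x \<in> U \<and> y \<in> V" if xy: "x \<noteq> y" for x y
  proof -
    define e where "e = dist x y / 2"
    have "e > 0" using xy by (simp add: e_def)
    obtain U where U: "U \<in> \<B>" "x \<in> U" "U \<subseteq> ball x e"
      using topological_basisE[OF \<B>(2), of "ball x e" x] \<open>e > 0\<close> by auto
    obtain V where V: "V \<in> \<B>" "y \<in> V" "V \<subseteq> ball y e"
      using topological_basisE[OF \<B>(2), of "ball y e" y] \<open>e > 0\<close> by auto
    have "ball x e \<inter> ball y e = {}"
      by (rule disjoint_ballI) (simp add: e_def)
    then have "(U, V) \<in> \<C>"
      using U V bounded_subset[OF bounded_ball] by (auto simp: \<C>_def)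
    then show ?thesis using U V by auto
  qed
  then have "{(x, y). x \<noteq> y} \<subseteq> (\<Union>(U, V)\<in>\<C>. U \<times> V)" by fastforce
  moreover have "(\<Union>(U, V)\<in>\<C>. U \<times> V) \<subseteq> {(x, y). x \<noteq> y}"
    by (auto simp: \<C>_def)
  ultimately show ?thesis using that by blast
qed

section \<open>Campbell formulas for points and for pairs of points\<close>

locale determinantal_enumeration = prob_space M
  for M :: "'w measure" +
  fixes N :: "'w \<Rightarrow> enat" and X :: "nat \<Rightarrow> 'w \<Rightarrow> 'a::euclidean_space"
    and \<phi> :: "'w \<Rightarrow> 'a measure" and k :: "'a \<Rightarrow> complex"
  assumes N_measurable[measurable]: "N \<in> measurable M (count_space UNIV)"
    and X_measurable[measurable]: "\<And>i. X i \<in> borel_measurable M"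
    and enumeration: "\<And>\<omega> B. \<omega> \<in> space M \<Longrightarrow> B \<in> sets borel \<Longrightarrow>
      emeasure (\<phi> \<omega>) B = (\<Sum>i. if enat i < N \<omega> then indicator B (X i \<omega>) else 0)"
    and dpp: "determinantal M \<phi> (\<lambda>x y. k (x - y)) lborel"
    and k2: "integrable lborel (\<lambda>x. (cmod (k x))\<^sup>2)"
begin

definition k0 :: real where "k0 = Re (k 0)"

definition \<kappa> :: real where "\<kappa> = (LINT x|lborel. (cmod (k x))\<^sup>2)"

definition w :: "nat \<Rightarrow> 'w \<Rightarrow> ennreal" where "w i \<omega> = (if enat i < N \<omega> then 1 else 0)"

lemma w_measurable[measurable]: "w i \<in> borel_measurable M"
proof -
  have "{\<omega>\<in>space M. enat i < N \<omega>} \<in> sets M"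
    using measurable_sets[OF N_measurable, of "{n. enat i < n}"] by (simp add: vimage_def Int_def conj_commute)
  then show ?thesis unfolding w_def[abs_def] by (intro measurable_If) auto
qed

lemma k_measurable[measurable]: "k \<in> borel_measurable borel"
proof -
  have "case_prod (\<lambda>x y. k (x - y)) \<in> borel_measurable (borel \<Otimes>\<^sub>M borel)"
    using dpp by (simp add: determinantal_def)
  then have "(\<lambda>x. case_prod (\<lambda>x y. k (x - y)) (x, 0)) \<in> borel_measurable borel"
    by (rule measurable_compose[rotated]) measurable
  then show ?thesis by simp
qed

lemma phi_eq: "\<omega> \<in> space M \<Longrightarrow> B \<in> sets borel \<Longrightarrow> emeasure (\<phi> \<omega>) B = (\<Sum>i. w i \<omega> * indicator B (X i \<omega>))"
  unfolding enumeration w_def by (intro suminf_cong) auto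

lemma dpp_moment:
  assumes "n \<ge> 1" "\<And>i. i < n \<Longrightarrow> D i \<in> sets borel" "disjoint_family_on D {..<n}"
  shows "(\<integral>\<^sup>+\<omega>. (\<Prod>i<n. emeasure (\<phi> \<omega>) (D i)) \<partial>M) =
    (\<integral>\<^sup>+x. ennreal (Re (correlation_det (\<lambda>x y. k (x - y)) n x)) * indicator (Pi\<^sub>E {..<n} D) x \<partial>(\<Pi>\<^sub>M i\<in>{..<n}. lborel))"
  using dpp assms by (simp add: determinantal_def)

text \<open>For a single point the determinant is the constant \<open>k 0\<close>, and Lebesgue
  measure is not zero, so an almost everywhere statement about this constant holds outright.\<close>

lemma k0_nonneg: "0 \<le> k0" and k_0: "k 0 = complex_of_real k0"
proof -
  interpret product_sigma_finite "\<lambda>_::nat. lborel :: 'a measure" ..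
  have 1: "{..<1} = {0::nat}" by auto
  have "AE x in (\<Pi>\<^sub>M i\<in>{..<1::nat}. lborel :: 'a measure). k 0 \<in> \<real>\<^sub>\<ge>\<^sub>0"
    using dpp unfolding determinantal_def by (auto simp: correlation_det_1 elim!: allE[of _ 1])
  moreover have "(\<integral>\<^sup>+x. 1 \<partial>(\<Pi>\<^sub>M i\<in>{0::nat}. lborel :: 'a measure)) = \<infinity>"
    using product_nn_integral_singleton[of "\<lambda>_. 1" 0] by simp
  then have "\<not> (AE x in (\<Pi>\<^sub>M i\<in>{..<1::nat}. lborel :: 'a measure). False)"
    unfolding 1 by (auto simp: AE_iff_null null_sets_def)
  ultimately have "k 0 \<in> \<real>\<^sub>\<ge>\<^sub>0" by (cases "k 0 \<in> \<real>\<^sub>\<ge>\<^sub>0") auto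
  then show "0 \<le> k0" "k 0 = complex_of_real k0"
    by (auto simp: k0_def nonneg_Reals_def)
qed

lemma first_moment:
  assumes B: "B \<in> sets borel"
  shows "(\<integral>\<^sup>+\<omega>. emeasure (\<phi> \<omega>) B \<partial>M) = ennreal k0 * emeasure lborel B"
proof -
  interpret product_sigma_finite "\<lambda>_::nat. lborel :: 'a measure" ..
  have 1: "{..<1} = {0::nat}" by auto
  note [measurable] = B
  have "(\<integral>\<^sup>+\<omega>. emeasure (\<phi> \<omega>) B \<partial>M) =
      (\<integral>\<^sup>+x. ennreal k0 * indicator (Pi\<^sub>E {..<1} (\<lambda>_. B)) x \<partial>(\<Pi>\<^sub>M i\<in>{..<1::nat}. lborel))"
    using dpp_moment[of 1 "\<lambda>_. B"] B by (simp add: correlation_det_1 k0_def disjoint_family_on_def)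
  also have "\<dots> = (\<integral>\<^sup>+x. ennreal k0 * indicator B (x 0) \<partial>(\<Pi>\<^sub>M i\<in>{0::nat}. lborel))"
    unfolding 1 by (intro nn_integral_cong) (auto simp: space_PiM PiE_iff split: split_indicator)
  also have "\<dots> = (\<integral>\<^sup>+x. ennreal k0 * indicator B x \<partial>lborel)"
    by (rule product_nn_integral_singleton) simp
  finally show ?thesis by (simp add: nn_integral_cmult_indicator)
qed

text \<open>The mean counting measure of the points agrees with \<open>k0\<close> times Lebesgue
  measure on Borel sets, by the identity for n = 1.\<close>

lemma campbell:
  assumes [measurable]: "g \<in> borel_measurable borel"
  shows "(\<integral>\<^sup>+\<omega>. (\<Sum>i. w i \<omega> * g (X i \<omega>)) \<partial>M) = ennreal k0 * (\<integral>\<^sup>+x. g x \<partial>lborel)"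
proof -
  define P where "P = distr (density (M \<Otimes>\<^sub>M count_space UNIV) (\<lambda>p. w (snd p) (fst p))) borel (\<lambda>p. X (snd p) (fst p))"
  note P = nn_integral_point_measure[of w X borel, folded P_def, OF w_measurable X_measurable]
  have "P = density lborel (\<lambda>_. ennreal k0)"
  proof (rule measure_eqI)
    fix B assume "B \<in> sets P"
    then have B[measurable]: "B \<in> sets borel" by (simp add: P_def)
    have "emeasure P B = (\<integral>\<^sup>+x. indicator B x \<partial>P)"
      by (simp add: P_def)
    also have "\<dots> = (\<integral>\<^sup>+\<omega>. emeasure (\<phi> \<omega>) B \<partial>M)"
      by (subst P) (auto simp: nn_integral_count_space_nat phi_eq intro!: nn_integral_cong)
    also have "\<dots> = ennreal k0 * emeasure lborel B"
      by (rule first_moment) (rule B)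
    finally show "emeasure P B = emeasure (density lborel (\<lambda>_. ennreal k0)) B"
      by (simp add: emeasure_density nn_integral_cmult_indicator)
  qed (simp add: P_def)
  then have "(\<integral>\<^sup>+x. g x \<partial>P) = ennreal k0 * (\<integral>\<^sup>+x. g x \<partial>lborel)"
    by (simp add: nn_integral_density nn_integral_cmult)
  then show ?thesis
    by (subst (asm) P) (auto simp: nn_integral_count_space_nat)
qed

text \<open>The two-point determinant subtracts \<open>k (x - y) * k (y - x)\<close>, whose modulus
  is \<open>q (x - y)\<close>; it depends on the difference only and so acts by convolution.\<close>

definition q :: "'a \<Rightarrow> ennreal" where "q x = ennreal (cmod (k x) * cmod (k (- x)))"

lemma q_measurable[measurable]: "q \<in> borel_measurable borel"
  unfolding q_def[abs_def] by measurable

text \<open>By 2ab \<le> a^2 + b^2 the product is split into two squares, and reflection x \<mapsto>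
  -x preserves Lebesgue measure.\<close>

lemma q_integral_le: "(\<integral>\<^sup>+x. q x \<partial>lborel) \<le> ennreal \<kappa>"
proof (rule ennreal_half_le)
  have k2': "(\<integral>\<^sup>+x. (ennreal (cmod (k x)))\<^sup>2 \<partial>lborel) = ennreal \<kappa>"
    unfolding \<kappa>_def using k2 by (simp add: ennreal_power nn_integral_eq_integral)
  have "2 * (\<integral>\<^sup>+x. q x \<partial>lborel) = (\<integral>\<^sup>+x. 2 * (ennreal (cmod (k x)) * ennreal (cmod (k (- x)))) \<partial>lborel)"
    by (subst nn_integral_cmult[symmetric]) (auto simp: q_def ennreal_mult)
  also have "\<dots> \<le> (\<integral>\<^sup>+x. (ennreal (cmod (k x)))\<^sup>2 + (ennreal (cmod (k (- x))))\<^sup>2 \<partial>lborel)"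
    by (intro nn_integral_mono two_mult_le_ennreal)
  also have "\<dots> = ennreal \<kappa> + (\<integral>\<^sup>+x. (ennreal (cmod (k (0 - x))))\<^sup>2 \<partial>lborel)"
    by (subst nn_integral_add) (auto simp: k2')
  also have "(\<integral>\<^sup>+x. (ennreal (cmod (k (0 - x))))\<^sup>2 \<partial>lborel) = ennreal \<kappa>"
    by (subst nn_integral_reflect_shift(1)[where g = "\<lambda>x. (ennreal (cmod (k x)))\<^sup>2"]) (auto simp: k2')
  finally show "2 * (\<integral>\<^sup>+x. q x \<partial>lborel) \<le> 2 * ennreal \<kappa>"
    by (simp add: mult_2)
qed

text \<open>The two-point correlation function in the form in which \<open>determinantal\<close>
  integrates it: \<open>ennreal\<close> of the real part, so negative real parts are cut off at
  0.\<close>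

definition pair_density :: "'a \<times> 'a \<Rightarrow> ennreal" where
  "pair_density = (\<lambda>(x, y). ennreal (Re (k 0 * k 0 - k (x - y) * k (y - x))))"

lemma pair_density_measurable[measurable]: "pair_density \<in> borel_measurable borel"
proof -
  have "pair_density \<in> borel_measurable (borel \<Otimes>\<^sub>M borel)"
    unfolding pair_density_def by measurable
  then show ?thesis by (simp add: borel_prod)
qed

lemma pair_density_le: "pair_density (x, y) \<le> ennreal k0 * ennreal k0 + q (x - y)"
proof -
  have "Re (k 0 * k 0 - k (x - y) * k (y - x)) = k0 * k0 - Re (k (x - y) * k (y - x))"
    by (simp add: k_0)
  also have "\<dots> \<le> k0 * k0 + cmod (k (x - y)) * cmod (k (- (x - y)))"
    using abs_Re_le_cmod[of "k (x - y) * k (y - x)"] by (simp add: norm_mult)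
  finally have "pair_density (x, y) \<le> ennreal (k0 * k0 + cmod (k (x - y)) * cmod (k (- (x - y))))"
    unfolding pair_density_def prod.case by (rule ennreal_leI)
  then show ?thesis
    by (simp add: q_def ennreal_mult k0_nonneg)
qed

text \<open>Weights for ordered pairs of distinct points. Leaving out equal indices produces the
  factorial second moment, which is the one that correlation functions describe.\<close>

definition pair_w :: "nat \<times> nat \<Rightarrow> 'w \<Rightarrow> ennreal" where
  "pair_w = (\<lambda>(i, j) \<omega>. if i = j then 0 else w i \<omega> * w j \<omega>)"

lemma pair_w_measurable[measurable]: "pair_w p \<in> borel_measurable M"
  unfolding pair_w_def by (cases p) auto

lemma second_moment:
  assumes A: "A \<in> sets borel" and B: "B \<in> sets borel" and disj: "A \<inter> B = {}"
  shows "(\<integral>\<^sup>+\<omega>. emeasure (\<phi> \<omega>) A * emeasure (\<phi> \<omega>) B \<partial>M) = (\<integral>\<^sup>+z. pair_density z * indicator (A \<times> B) z \<partial>lborel)"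
proof -
  interpret product_sigma_finite "\<lambda>_::nat. lborel :: 'a measure" ..
  note [measurable] = A B
  have 2: "{..<2} = insert 1 {0::nat}" by auto
  define D where "D = (\<lambda>i::nat. if i = 0 then A else B)"
  have "(\<integral>\<^sup>+\<omega>. emeasure (\<phi> \<omega>) A * emeasure (\<phi> \<omega>) B \<partial>M) = (\<integral>\<^sup>+\<omega>. (\<Prod>i<2. emeasure (\<phi> \<omega>) (D i)) \<partial>M)"
    by (simp add: D_def numeral_2_eq_2)
  also have "\<dots> = (\<integral>\<^sup>+x. ennreal (Re (correlation_det (\<lambda>x y. k (x - y)) 2 x)) * indicator (Pi\<^sub>E {..<2} D) x \<partial>(\<Pi>\<^sub>M i\<in>{..<2}. lborel))"
    by (rule dpp_moment) (use A B disj in \<open>auto simp: D_def disjoint_family_on_def\<close>)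
  also have "\<dots> = (\<integral>\<^sup>+x. pair_density (x 0, x 1) * indicator (A \<times> B) (x 0, x 1) \<partial>(\<Pi>\<^sub>M i\<in>insert 1 {0::nat}. lborel))"
    unfolding 2 by (intro nn_integral_cong)
      (auto simp: correlation_det_2 pair_density_def D_def space_PiM PiE_iff split: split_indicator)
  also have "\<dots> = (\<integral>\<^sup>+x. (\<integral>\<^sup>+y. pair_density (x 0, y) * indicator (A \<times> B) (x 0, y) \<partial>lborel) \<partial>(\<Pi>\<^sub>M i\<in>{0::nat}. lborel))"
    by (subst product_nn_integral_insert) auto
  also have "\<dots> = (\<integral>\<^sup>+x. (\<integral>\<^sup>+y. pair_density (x, y) * indicator (A \<times> B) (x, y) \<partial>lborel) \<partial>lborel)"
    by (rule product_nn_integral_singleton[where f = "\<lambda>x. \<integral>\<^sup>+y. pair_density (x, y) * indicator (A \<times> B) (x, y) \<partial>lborel"]) measurable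
  also have "\<dots> = (\<integral>\<^sup>+z. pair_density z * indicator (A \<times> B) z \<partial>(lborel \<Otimes>\<^sub>M lborel))"
    by (rule lborel.nn_integral_fst) (use borel_rectangle[OF A B] in \<open>simp add: borel_measurable_lborel_pair\<close>)
  finally show ?thesis by (simp add: lborel_prod)
qed

text \<open>Two indices at one location would create an atom of mass at least 2, contrary to
  simplicity of the process.\<close>

lemma simple_enumeration:
  assumes "\<omega> \<in> space M" "enat i < N \<omega>" "enat j < N \<omega>" "i \<noteq> j"
  shows "X i \<omega> \<noteq> X j \<omega>"
proof
  assume eq: "X i \<omega> = X j \<omega>"
  define f where "f l = w l \<omega> * indicator {X i \<omega>} (X l \<omega>)" for l
  have "2 = f i + f j"
    using assms eq by (simp add: w_def f_def)
  also have "\<dots> = sum f {i, j}"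
    using assms(4) by simp
  also have "\<dots> \<le> (\<Sum>l. f l)"
    by (intro sum_le_suminf) auto
  also have "\<dots> = (\<Sum>l. w l \<omega> * indicator {X i \<omega>} (X l \<omega>))"
    by (simp add: f_def)
  also have "\<dots> = emeasure (\<phi> \<omega>) {X i \<omega>}"
    using assms(1) by (simp add: phi_eq)
  also have "\<dots> \<le> 1"
    using dpp assms(1) by (simp add: determinantal_def simple_point_process_def)
  finally show False by simp
qed

text \<open>The identity for n = 2 determines the mean measure of pairs on rectangles with disjoint
  sides, and these generate the Borel sets off the diagonal. The diagonal itself is null on both
  sides: under the density because it is a Lebesgue null set, and for the pairs because the process
  is simple.\<close>

lemma pair_campbell:
  assumes [measurable]: "g \<in> borel_measurable (borel :: ('a \<times> 'a) measure)"
  shows "(\<integral>\<^sup>+\<omega>. (\<integral>\<^sup>+p. pair_w p \<omega> * g (X (fst p) \<omega>, X (snd p) \<omega>) \<partial>count_space UNIV) \<partial>M) =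
    (\<integral>\<^sup>+z. pair_density z * g z \<partial>lborel)"
proof -
  let ?Z = "\<lambda>p \<omega>. (X (fst p) \<omega>, X (snd p) \<omega>)"
  have Z: "?Z p \<in> measurable M borel" for p
    unfolding borel_prod[symmetric] by measurable
  define P where "P = distr (density (M \<Otimes>\<^sub>M count_space UNIV) (\<lambda>p. pair_w (snd p) (fst p))) borel (\<lambda>p. ?Z (snd p) (fst p))"
  note P = nn_integral_point_measure[of pair_w ?Z borel, folded P_def, OF pair_w_measurable Z]
  have sets_P: "sets P = sets borel" by (simp add: P_def)
  define R where "R = density lborel pair_density"
  have sets_R: "sets R = sets borel" by (simp add: R_def)
  define \<Omega> :: "('a \<times> 'a) set" where "\<Omega> = {(x, y). x \<noteq> y}"
  define E where "E = {A \<times> B | A B. A \<in> sets borel \<and> B \<in> sets borel \<and> A \<inter> B = ({} :: 'a set)}"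
  obtain \<C> :: "('a set \<times> 'a set) set" where \<C>: "countable \<C>"
    "\<And>U V. (U, V) \<in> \<C> \<Longrightarrow> open U \<and> open V \<and> bounded U \<and> bounded V \<and> U \<inter> V = {}"
    "(\<Union>(U, V)\<in>\<C>. U \<times> V) = {(x, y). x \<noteq> y}"
    by (rule countable_disjoint_rectangle_cover, rule that) assumption+
  note \<C> = \<C>(1,2) \<C>(3)[folded \<Omega>_def]
  have "open \<Omega>"
    unfolding \<C>(3)[symmetric] using \<C>(2) by (auto intro!: open_UN open_Times)
  then have [measurable]: "\<Omega> \<in> sets borel" by simp
  have agree: "emeasure P (A \<times> B) = emeasure R (A \<times> B)"
    if A: "A \<in> sets borel" and B: "B \<in> sets borel" and disj: "A \<inter> B = {}" for A B
  proof -
    note [measurable] = A B borel_rectangle[OF A B]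
    have "emeasure P (A \<times> B) = (\<integral>\<^sup>+z. indicator (A \<times> B) z \<partial>P)"
      by (simp add: sets_P)
    also have "\<dots> = (\<integral>\<^sup>+\<omega>. (\<integral>\<^sup>+p. pair_w p \<omega> * indicator (A \<times> B) (?Z p \<omega>) \<partial>count_space UNIV) \<partial>M)"
      by (rule P) simp
    also have "\<dots> = (\<integral>\<^sup>+\<omega>. emeasure (\<phi> \<omega>) A * emeasure (\<phi> \<omega>) B \<partial>M)"
    proof (rule nn_integral_cong)
      fix \<omega> assume \<omega>: "\<omega> \<in> space M"
      have "(\<integral>\<^sup>+p. pair_w p \<omega> * indicator (A \<times> B) (?Z p \<omega>) \<partial>count_space UNIV) =
          (\<integral>\<^sup>+p. (w (fst p) \<omega> * indicator A (X (fst p) \<omega>)) * (w (snd p) \<omega> * indicator B (X (snd p) \<omega>)) \<partial>count_space UNIV)"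
        using disj by (intro nn_integral_cong) (auto simp: pair_w_def split: split_indicator)
      also have "\<dots> = (\<integral>\<^sup>+i. (\<integral>\<^sup>+j. (w i \<omega> * indicator A (X i \<omega>)) * (w j \<omega> * indicator B (X j \<omega>)) \<partial>count_space UNIV) \<partial>count_space UNIV)"
        by (subst nn_integral_fst_count_space[symmetric]) simp
      also have "\<dots> = (\<integral>\<^sup>+i. w i \<omega> * indicator A (X i \<omega>) \<partial>count_space UNIV) * (\<integral>\<^sup>+j. w j \<omega> * indicator B (X j \<omega>) \<partial>count_space UNIV)"
        by (simp add: nn_integral_cmult nn_integral_multc)
      also have "\<dots> = emeasure (\<phi> \<omega>) A * emeasure (\<phi> \<omega>) B"
        using \<omega> A B by (simp add: phi_eq nn_integral_count_space_nat)
      finally show "(\<integral>\<^sup>+p. pair_w p \<omega> * indicator (A \<times> B) (?Z p \<omega>) \<partial>count_space UNIV) =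
        emeasure (\<phi> \<omega>) A * emeasure (\<phi> \<omega>) B" .
    qed
    also have "\<dots> = emeasure R (A \<times> B)"
      unfolding second_moment[OF A B disj] R_def by (subst emeasure_density) auto
    finally show ?thesis .
  qed
  \<comment> \<open>Uniqueness of measures is invoked on the complement of the diagonal, where
    \<open>E\<close> is an intersection-stable generator with a countable cover of finite
    measure.\<close>
  have "restrict_space P \<Omega> = restrict_space R \<Omega>"
  proof (rule measure_eqI_generator_eq_countable[where E = E and \<Omega> = \<Omega> and A = "(\<lambda>(U, V). U \<times> V) ` \<C>"])
    show "Int_stable E"
      unfolding Int_stable_def E_def
    proof clarify
      fix A B A' B' :: "'a set"
      assume *: "A \<in> sets borel" "B \<in> sets borel" "A \<inter> B = {}" "A' \<in> sets borel" "B' \<in> sets borel" "A' \<inter> B' = {}"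
      show "\<exists>C D. A \<times> B \<inter> A' \<times> B' = C \<times> D \<and> C \<in> sets borel \<and> D \<in> sets borel \<and> C \<inter> D = {}"
        using * by (intro exI[of _ "A \<inter> A'"] exI[of _ "B \<inter> B'"]) auto
    qed
    show "E \<subseteq> Pow \<Omega>" by (auto simp: E_def \<Omega>_def)
    have sub: "A \<times> B \<subseteq> \<Omega>" if "A \<inter> B = {}" for A B using that by (auto simp: \<Omega>_def)
    show "emeasure (restrict_space P \<Omega>) Y = emeasure (restrict_space R \<Omega>) Y" if "Y \<in> E" for Y
      using that agree sub by (auto simp: E_def emeasure_restrict_space sets_P sets_R)
    have "sets (borel :: ('a \<times> 'a) measure) = sigma_sets UNIV {A \<times> B | A B. A \<in> sets borel \<and> B \<in> sets borel}"
      unfolding borel_prod[symmetric] by (simp add: sets_pair_measure)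
    moreover have "(\<inter>) \<Omega> ` sigma_sets UNIV {A \<times> B | A B. A \<in> sets borel \<and> B \<in> sets borel} =
        sigma_sets \<Omega> ((\<inter>) \<Omega> ` {A \<times> B | A B. A \<in> sets borel \<and> B \<in> sets borel})"
      by (rule sigma_sets_Int) (auto simp: calculation[symmetric])
    moreover have "sigma_sets \<Omega> ((\<inter>) \<Omega> ` {A \<times> B | A B. A \<in> sets borel \<and> B \<in> sets borel}) = sigma_sets \<Omega> E"
    proof (rule sigma_sets_eqI)
      fix Y assume "Y \<in> (\<inter>) \<Omega> ` {A \<times> B | A B. A \<in> sets borel \<and> B \<in> sets borel}"
      then obtain A B where Y: "Y = \<Omega> \<inter> A \<times> B" and AB: "A \<in> sets borel" "B \<in> sets borel" by auto
      \<comment> \<open>Cutting an arbitrary rectangle along the cover gives countably many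
        rectangles with disjoint sides, so \<open>E\<close> generates everything off the
        diagonal.\<close>
      have "Y = (\<Union>((\<lambda>(U, V). (A \<inter> U) \<times> (B \<inter> V)) ` \<C>))"
        unfolding Y \<C>(3)[symmetric] by auto
      also have "\<dots> \<in> sigma_sets \<Omega> E"
      proof (rule sigma_sets_UNION)
        show "countable ((\<lambda>(U, V). (A \<inter> U) \<times> (B \<inter> V)) ` \<C>)" using \<C>(1) by simp
        fix Z assume "Z \<in> (\<lambda>(U, V). (A \<inter> U) \<times> (B \<inter> V)) ` \<C>"
        then obtain U V where "(U, V) \<in> \<C>" "Z = (A \<inter> U) \<times> (B \<inter> V)" by auto
        moreover have "A \<inter> U \<in> sets borel" "B \<inter> V \<in> sets borel" "(A \<inter> U) \<inter> (B \<inter> V) = {}"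
          using \<C>(2)[OF \<open>(U, V) \<in> \<C>\<close>] AB by auto
        ultimately have "Z \<in> E" unfolding E_def by blast
        then show "Z \<in> sigma_sets \<Omega> E" by (rule sigma_sets.Basic)
      qed
      finally show "Y \<in> sigma_sets \<Omega> E" .
    next
      fix Y assume "Y \<in> E"
      then obtain A B where "Y = A \<times> B" "A \<in> sets borel" "B \<in> sets borel" "A \<inter> B = {}"
        by (auto simp: E_def)
      moreover from this have "Y = \<Omega> \<inter> A \<times> B" using sub[of A B] by auto
      ultimately have "Y \<in> (\<inter>) \<Omega> ` {A \<times> B | A B. A \<in> sets borel \<and> B \<in> sets borel}" by blast
      then show "Y \<in> sigma_sets \<Omega> ((\<inter>) \<Omega> ` {A \<times> B | A B. A \<in> sets borel \<and> B \<in> sets borel})"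
        by (rule sigma_sets.Basic)
    qed
    ultimately have "(\<inter>) \<Omega> ` sets (borel :: ('a \<times> 'a) measure) = sigma_sets \<Omega> E" by simp
    then show "sets (restrict_space P \<Omega>) = sigma_sets \<Omega> E" "sets (restrict_space R \<Omega>) = sigma_sets \<Omega> E"
      by (simp_all add: sets_restrict_space sets_P sets_R)
    show "(\<lambda>(U, V). U \<times> V) ` \<C> \<subseteq> E"
      using \<C>(2) by (fastforce simp: E_def)
    show "\<Union> ((\<lambda>(U, V). U \<times> V) ` \<C>) = \<Omega>" using \<C>(3) by simp
    show "countable ((\<lambda>(U, V). U \<times> V) ` \<C>)" using \<C>(1) by simp
    fix Y assume "Y \<in> (\<lambda>(U, V). U \<times> V) ` \<C>"
    then obtain U V where Y: "Y = U \<times> V" and UV: "(U, V) \<in> \<C>" by auto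
    then have U: "open U" "bounded U" and V: "open V" "bounded V" and disj: "U \<inter> V = {}"
      using \<C>(2)[OF UV] by auto
    have [measurable]: "U \<in> sets borel" "V \<in> sets borel" using U V by auto
    have "emeasure P Y = emeasure R Y"
      unfolding Y by (rule agree) (use U V disj in auto)
    also have "\<dots> = (\<integral>\<^sup>+z. pair_density z * indicator (U \<times> V) z \<partial>(lborel \<Otimes>\<^sub>M lborel))"
      unfolding R_def Y using borel_rectangle[of U V] U V by (subst emeasure_density) (auto simp: lborel_prod)
    also have "\<dots> = (\<integral>\<^sup>+x. (\<integral>\<^sup>+y. pair_density (x, y) * indicator (U \<times> V) (x, y) \<partial>lborel) \<partial>lborel)"
      by (rule lborel.nn_integral_fst[symmetric])
        (use borel_rectangle[of U V] in \<open>simp add: borel_measurable_lborel_pair\<close>)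
    \<comment> \<open>In the \<open>q\<close> part the indicator of \<open>V\<close> is dropped: the
      integral of \<open>q (x - y)\<close> over all y is finite and independent of x.\<close>
    also have "\<dots> \<le> (\<integral>\<^sup>+x. (\<integral>\<^sup>+y. indicator U x * (ennreal k0 * ennreal k0 * indicator V y + q (x - y)) \<partial>lborel) \<partial>lborel)"
      using pair_density_le by (intro nn_integral_mono) (auto split: split_indicator)
    also have "\<dots> = (\<integral>\<^sup>+x. indicator U x * (ennreal k0 * ennreal k0 * emeasure lborel V + (\<integral>\<^sup>+y. q y \<partial>lborel)) \<partial>lborel)"
      by (intro nn_integral_cong)
        (simp add: nn_integral_cmult nn_integral_add nn_integral_reflect_shift(1)[of q] nn_integral_cmult_indicator)
    also have "\<dots> = emeasure lborel U * (ennreal k0 * ennreal k0 * emeasure lborel V + (\<integral>\<^sup>+y. q y \<partial>lborel))"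
      by (simp add: nn_integral_multc)
    also have "\<dots> < \<infinity>"
      using emeasure_bounded_finite[OF U(2)] emeasure_bounded_finite[OF V(2)] q_integral_le
      by (auto simp: ennreal_mult_less_top ennreal_add_less_top order_le_less_trans)
    finally have "emeasure P Y < \<infinity>" .
    then show "emeasure (restrict_space P \<Omega>) Y \<noteq> \<infinity>"
      using sub[OF disj] by (subst emeasure_restrict_space) (auto simp: Y sets_P)
  qed
  then have "(\<integral>\<^sup>+z. g z \<partial>restrict_space P \<Omega>) = (\<integral>\<^sup>+z. g z \<partial>restrict_space R \<Omega>)" by simp
  then have "(\<integral>\<^sup>+z. g z * indicator \<Omega> z \<partial>P) = (\<integral>\<^sup>+z. g z * indicator \<Omega> z \<partial>R)"
    by (simp add: nn_integral_restrict_space sets_P sets_R)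
  also have "\<dots> = (\<integral>\<^sup>+z. g z \<partial>R)"
  proof (rule nn_integral_cong_AE)
    have "emeasure (lborel :: ('a \<times> 'a) measure) (- \<Omega>) = (\<integral>\<^sup>+x. (\<integral>\<^sup>+y. indicator (- \<Omega>) (x, y) \<partial>lborel) \<partial>(lborel :: 'a measure))"
    proof -
      have "- \<Omega> \<in> sets ((lborel :: 'a measure) \<Otimes>\<^sub>M (lborel :: 'a measure))"
        unfolding lborel_prod by simp
      from lborel.emeasure_pair_measure[OF this] show ?thesis unfolding lborel_prod .
    qed
    also have "\<dots> = (\<integral>\<^sup>+x. (\<integral>\<^sup>+y. indicator {x} y \<partial>lborel) \<partial>(lborel :: 'a measure))"
      by (intro nn_integral_cong) (auto simp: \<Omega>_def split: split_indicator)
    also have "\<dots> = 0" by simp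
    finally have "AE z in lborel. z \<in> \<Omega>"
      by (intro AE_I[where N = "- \<Omega>"]) auto
    then show "AE z in R. g z * indicator \<Omega> z = g z"
      unfolding R_def by (subst AE_density) (auto elim!: eventually_mono)
  qed
  also have "\<dots> = (\<integral>\<^sup>+z. pair_density z * g z \<partial>lborel)"
    unfolding R_def by (rule nn_integral_density) auto
  also have "(\<integral>\<^sup>+z. g z * indicator \<Omega> z \<partial>P) =
      (\<integral>\<^sup>+\<omega>. (\<integral>\<^sup>+p. pair_w p \<omega> * (g (?Z p \<omega>) * indicator \<Omega> (?Z p \<omega>)) \<partial>count_space UNIV) \<partial>M)"
    by (rule P) simp
  \<comment> \<open>Distinct indices sit at distinct locations, so the indicator of the complement
    of the diagonal is 1 on all pairs of positive weight.\<close>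
  also have "\<dots> = (\<integral>\<^sup>+\<omega>. (\<integral>\<^sup>+p. pair_w p \<omega> * g (?Z p \<omega>) \<partial>count_space UNIV) \<partial>M)"
  proof (intro nn_integral_cong)
    fix \<omega> and p :: "nat \<times> nat" assume "\<omega> \<in> space M"
    then show "pair_w p \<omega> * (g (?Z p \<omega>) * indicator \<Omega> (?Z p \<omega>)) = pair_w p \<omega> * g (?Z p \<omega>)"
      using simple_enumeration[of \<omega> "fst p" "snd p"]
      by (cases p) (auto simp: pair_w_def w_def \<Omega>_def split: split_indicator)
  qed
  finally show ?thesis .
qed

text \<open>Equal indices contribute \<open>k0\<close> times the integral of U^2. For distinct ones,
  the constant part of the pair density reproduces the squared mean and the \<open>q\<close> part is
  a convolution form, bounded by \<open>\<kappa>\<close> times the integral of U^2. After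
  subtracting the squared mean only the factor \<open>k0 + \<kappa>\<close> remains.\<close>

lemma second_moment_sum_le:
  assumes [measurable]: "U \<in> borel_measurable borel"
  shows "(\<integral>\<^sup>+\<omega>. (\<Sum>i. w i \<omega> * U (X i \<omega>))\<^sup>2 \<partial>M) \<le>
    ennreal (k0 + \<kappa>) * (\<integral>\<^sup>+x. (U x)\<^sup>2 \<partial>lborel) + (ennreal k0 * (\<integral>\<^sup>+x. U x \<partial>lborel))\<^sup>2"
proof -
  define I2 where "I2 = (\<integral>\<^sup>+x. (U x)\<^sup>2 \<partial>lborel)"
  have UU[measurable]: "(\<lambda>z. U (fst z) * U (snd z)) \<in> borel_measurable (borel :: ('a \<times> 'a) measure)"
    unfolding borel_prod[symmetric] by measurable
  have pt: "(\<Sum>i. w i \<omega> * U (X i \<omega>))\<^sup>2 = (\<Sum>i. w i \<omega> * (U (X i \<omega>))\<^sup>2) +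
      (\<integral>\<^sup>+p. pair_w p \<omega> * (U (X (fst p) \<omega>) * U (X (snd p) \<omega>)) \<partial>count_space UNIV)" for \<omega>
  proof -
    let ?a = "\<lambda>i. w i \<omega> * U (X i \<omega>)"
    have "(\<Sum>i. ?a i)\<^sup>2 = (\<integral>\<^sup>+i. (\<integral>\<^sup>+j. ?a i * ?a j \<partial>count_space UNIV) \<partial>count_space UNIV)"
      by (simp add: nn_integral_cmult nn_integral_multc power2_eq_square nn_integral_count_space_nat)
    also have "\<dots> = (\<integral>\<^sup>+i. (\<integral>\<^sup>+j. ?a i * ?a i * indicator {i} j +
        pair_w (i, j) \<omega> * (U (X i \<omega>) * U (X j \<omega>)) \<partial>count_space UNIV) \<partial>count_space UNIV)"
      by (intro nn_integral_cong) (auto simp: pair_w_def ac_simps split: split_indicator)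
    also have "\<dots> = (\<integral>\<^sup>+i. ?a i * ?a i + (\<integral>\<^sup>+j. pair_w (i, j) \<omega> * (U (X i \<omega>) * U (X j \<omega>)) \<partial>count_space UNIV) \<partial>count_space UNIV)"
      by (intro nn_integral_cong) (simp add: nn_integral_add nn_integral_cmult_indicator)
    also have "\<dots> = (\<integral>\<^sup>+i. ?a i * ?a i \<partial>count_space UNIV) +
        (\<integral>\<^sup>+p. pair_w p \<omega> * (U (X (fst p) \<omega>) * U (X (snd p) \<omega>)) \<partial>count_space UNIV)"
      by (simp add: nn_integral_add nn_integral_fst_count_space[symmetric])
    also have "(\<integral>\<^sup>+i. ?a i * ?a i \<partial>count_space UNIV) = (\<Sum>i. w i \<omega> * (U (X i \<omega>))\<^sup>2)"
      unfolding nn_integral_count_space_nat by (intro suminf_cong) (simp add: w_def power2_eq_square)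
    finally show ?thesis .
  qed
  have [measurable]: "(\<lambda>\<omega>. \<integral>\<^sup>+p. pair_w p \<omega> * (U (X (fst p) \<omega>) * U (X (snd p) \<omega>)) \<partial>count_space UNIV) \<in> borel_measurable M"
    unfolding nn_integral_fst_count_space[symmetric] nn_integral_count_space_nat by measurable
  have "(\<integral>\<^sup>+\<omega>. (\<Sum>i. w i \<omega> * U (X i \<omega>))\<^sup>2 \<partial>M) = ennreal k0 * I2 +
      (\<integral>\<^sup>+\<omega>. (\<integral>\<^sup>+p. pair_w p \<omega> * (U (X (fst p) \<omega>) * U (X (snd p) \<omega>)) \<partial>count_space UNIV) \<partial>M)"
    unfolding pt I2_def by (subst nn_integral_add) (auto simp: campbell[where g = "\<lambda>x. (U x)\<^sup>2"])
  also have "(\<integral>\<^sup>+\<omega>. (\<integral>\<^sup>+p. pair_w p \<omega> * (U (X (fst p) \<omega>) * U (X (snd p) \<omega>)) \<partial>count_space UNIV) \<partial>M) =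
      (\<integral>\<^sup>+z. pair_density z * (U (fst z) * U (snd z)) \<partial>(lborel \<Otimes>\<^sub>M lborel))"
    using pair_campbell[OF UU] by (simp add: lborel_prod)
  also have "\<dots> = (\<integral>\<^sup>+x. (\<integral>\<^sup>+y. pair_density (x, y) * (U x * U y) \<partial>lborel) \<partial>lborel)"
    using UU by (subst lborel.nn_integral_fst[symmetric]) (auto simp: borel_measurable_lborel_pair)
  also have "\<dots> \<le> (\<integral>\<^sup>+x. (\<integral>\<^sup>+y. (ennreal k0 * U x) * (ennreal k0 * U y) + q (x - y) * (U x * U y) \<partial>lborel) \<partial>lborel)"
  proof (intro nn_integral_mono)
    fix x y
    have "pair_density (x, y) * (U x * U y) \<le> (ennreal k0 * ennreal k0 + q (x - y)) * (U x * U y)"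
      by (intro mult_right_mono pair_density_le) simp
    then show "pair_density (x, y) * (U x * U y) \<le> (ennreal k0 * U x) * (ennreal k0 * U y) + q (x - y) * (U x * U y)"
      by (simp add: distrib_right distrib_left ac_simps)
  qed
  also have "\<dots> = (\<integral>\<^sup>+x. (ennreal k0 * U x) * (ennreal k0 * (\<integral>\<^sup>+y. U y \<partial>lborel)) \<partial>lborel) +
      (\<integral>\<^sup>+x. (\<integral>\<^sup>+y. q (x - y) * (U x * U y) \<partial>lborel) \<partial>lborel)"
    by (subst nn_integral_add[symmetric]) (auto intro!: nn_integral_cong simp: nn_integral_add nn_integral_cmult)
  also have "(\<integral>\<^sup>+x. (ennreal k0 * U x) * (ennreal k0 * (\<integral>\<^sup>+y. U y \<partial>lborel)) \<partial>lborel) = (ennreal k0 * (\<integral>\<^sup>+x. U x \<partial>lborel))\<^sup>2"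
    by (simp add: nn_integral_multc nn_integral_cmult power2_eq_square)
  also have "(\<integral>\<^sup>+x. (\<integral>\<^sup>+y. q (x - y) * (U x * U y) \<partial>lborel) \<partial>lborel) \<le> ennreal \<kappa> * I2"
  \<comment> \<open>A Schur-type estimate: U(x) U(y) is replaced by the mean of the two squares, and
    in each term \<open>q\<close> is integrated over the free variable.\<close>
  proof (rule ennreal_half_le)
    have swap: "(\<integral>\<^sup>+x. (\<integral>\<^sup>+y. q (x - y) * (U y)\<^sup>2 \<partial>lborel) \<partial>lborel) = (\<integral>\<^sup>+y. (\<integral>\<^sup>+x. q (x - y) * (U y)\<^sup>2 \<partial>lborel) \<partial>lborel)"
      by (rule lborel_pair.Fubini') measurable
    have "2 * (\<integral>\<^sup>+x. (\<integral>\<^sup>+y. q (x - y) * (U x * U y) \<partial>lborel) \<partial>lborel) =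
        (\<integral>\<^sup>+x. (\<integral>\<^sup>+y. q (x - y) * (2 * (U x * U y)) \<partial>lborel) \<partial>lborel)"
      by (simp add: nn_integral_cmult[symmetric] ac_simps)
    also have "\<dots> \<le> (\<integral>\<^sup>+x. (\<integral>\<^sup>+y. q (x - y) * ((U x)\<^sup>2 + (U y)\<^sup>2) \<partial>lborel) \<partial>lborel)"
      by (intro nn_integral_mono mult_left_mono two_mult_le_ennreal) simp
    also have "\<dots> = (\<integral>\<^sup>+x. (\<integral>\<^sup>+y. q (x - y) * (U x)\<^sup>2 \<partial>lborel) \<partial>lborel) + (\<integral>\<^sup>+x. (\<integral>\<^sup>+y. q (x - y) * (U y)\<^sup>2 \<partial>lborel) \<partial>lborel)"
      by (subst nn_integral_add[symmetric]) (auto intro!: nn_integral_cong simp: nn_integral_add distrib_left)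
    also have "\<dots> = 2 * ((\<integral>\<^sup>+y. q y \<partial>lborel) * I2)"
      unfolding swap I2_def
      by (simp add: nn_integral_multc nn_integral_cmult nn_integral_reflect_shift[of q] mult_2)
    also have "\<dots> \<le> 2 * (ennreal \<kappa> * I2)"
      by (intro mult_left_mono mult_right_mono q_integral_le) simp_all
    finally show "2 * (\<integral>\<^sup>+x. (\<integral>\<^sup>+y. q (x - y) * (U x * U y) \<partial>lborel) \<partial>lborel) \<le> 2 * (ennreal \<kappa> * I2)" .
  qed
  finally have "(\<integral>\<^sup>+\<omega>. (\<Sum>i. w i \<omega> * U (X i \<omega>))\<^sup>2 \<partial>M) \<le>
      ennreal k0 * I2 + ((ennreal k0 * (\<integral>\<^sup>+x. U x \<partial>lborel))\<^sup>2 + ennreal \<kappa> * I2)"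
    by (simp add: add_left_mono)
  moreover have "0 \<le> \<kappa>" by (simp add: \<kappa>_def)
  ultimately show ?thesis
    by (simp add: I2_def k0_nonneg ennreal_plus distrib_right add_ac)
qed

end

section \<open>Products of factors in the unit disc\<close>

lemma norm_exp_diff_le:
  fixes a b :: complex
  assumes "Re a \<le> 0" "Re b \<le> 0"
  shows "norm (exp a - exp b) \<le> norm (a - b)"
proof -
  have "norm (exp a - exp b) \<le> 1 * norm (a - b)"
  \<comment> \<open>The left half-plane is convex and exp, which is its own derivative, has modulus
    at most 1 on it.\<close>
  proof (rule field_differentiable_bound[where S = "{z. Re z \<le> 0}" and f' = exp])
    show "convex {z. Re z \<le> 0}" by (rule convex_halfspace_Re_le)
    show "(exp has_field_derivative exp z) (at z within {z. Re z \<le> 0})" for z :: complex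
      by (intro derivative_eq_intros) auto
  qed (use assms in auto)
  then show ?thesis by simp
qed

text \<open>Second-order Taylor remainder of exp; the constant \<open>exp 2\<close> bounds exp |Re
  u| for |u| \<le> 2.\<close>

lemma norm_one_plus_minus_exp_le:
  fixes u :: complex
  assumes "norm u \<le> 2"
  shows "norm (1 + u - exp u) \<le> exp 2 * (norm u)\<^sup>2"
proof -
  have "norm (1 + u - exp u) = norm (exp u - (\<Sum>k\<le>1. u ^ k / fact k))"
    by (simp add: norm_minus_commute algebra_simps)
  also have "\<dots> \<le> exp \<bar>Re u\<bar> * (norm u)\<^sup>2"
    using Taylor_exp[of u 1] by (simp add: numeral_2_eq_2)
  also have "\<dots> \<le> exp 2 * (norm u)\<^sup>2"
    using abs_Re_le_cmod[of u] assms by (intro mult_right_mono) auto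
  finally show ?thesis .
qed

text \<open>If 1 + u lies in the unit disc then Re u \<le> 0, so exp u lies there as well. Factors
  of modulus at most 1 let the factorwise errors add without growing, hence a bound free of the
  number of factors.\<close>

lemma norm_prod_one_plus_minus_exp_sum_le:
  fixes u :: "'i \<Rightarrow> complex"
  assumes "finite I" and u: "\<And>i. i \<in> I \<Longrightarrow> norm (1 + u i) \<le> 1"
  shows "norm ((\<Prod>i\<in>I. 1 + u i) - exp (\<Sum>i\<in>I. u i)) \<le> exp 2 * (\<Sum>i\<in>I. (norm (u i))\<^sup>2)"
proof -
  have Re_u: "Re (u i) \<le> 0" if "i \<in> I" for i
    using complex_Re_le_cmod[of "1 + u i"] u[OF that] by simp
  have u2: "norm (u i) \<le> 2" if "i \<in> I" for i
    using norm_triangle_ineq4[of "1 + u i" 1] u[OF that] by simp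
  have "norm ((\<Prod>i\<in>I. 1 + u i) - (\<Prod>i\<in>I. exp (u i))) \<le> (\<Sum>i\<in>I. norm (1 + u i - exp (u i)))"
    by (rule norm_prod_diff) (use u Re_u in auto)
  also have "\<dots> \<le> (\<Sum>i\<in>I. exp 2 * (norm (u i))\<^sup>2)"
    by (intro sum_mono norm_one_plus_minus_exp_le u2)
  finally show ?thesis
    using \<open>finite I\<close> by (simp add: exp_sum sum_distrib_left)
qed

section \<open>Concentration of sums over determinantal points\<close>

context determinantal_enumeration
begin

text \<open>A fixed index set with zeros beyond the random number of points turns the random sum
  into a series. \<open>suminf\<close> means nothing for a divergent series, so almost sure
  summability accompanies each use.\<close>

definition point_sum :: "('a \<Rightarrow> 'b::real_normed_vector) \<Rightarrow> 'w \<Rightarrow> 'b" where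
  "point_sum v \<omega> = (\<Sum>i. if enat i < N \<omega> then v (X i \<omega>) else 0)"

lemma less_N_measurable[measurable]: "Measurable.pred M (\<lambda>\<omega>. enat i < N \<omega>)"
  using measurable_sets[OF N_measurable, of "{n. enat i < n}"]
  by (simp add: pred_def vimage_def Int_def conj_commute)

lemma AE_summable_point_sum:
  fixes v :: "'a \<Rightarrow> 'b::{banach, second_countable_topology}"
  assumes v: "integrable lborel v"
  shows "AE \<omega> in M. summable (\<lambda>i. norm (if enat i < N \<omega> then v (X i \<omega>) else 0))"
proof -
  have [measurable]: "v \<in> borel_measurable borel" using v by simp
  have "(\<integral>\<^sup>+\<omega>. (\<Sum>i. w i \<omega> * ennreal (norm (v (X i \<omega>)))) \<partial>M) = ennreal k0 * (\<integral>\<^sup>+x. ennreal (norm (v x)) \<partial>lborel)"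
    by (rule campbell) measurable
  also have "\<dots> < \<infinity>"
    using v by (simp add: integrable_iff_bounded ennreal_mult_less_top)
  finally have "AE \<omega> in M. (\<Sum>i. w i \<omega> * ennreal (norm (v (X i \<omega>)))) \<noteq> \<infinity>"
    by (intro nn_integral_PInf_AE) auto
  then show ?thesis
  proof eventually_elim
    case (elim \<omega>)
    have "(\<Sum>i. w i \<omega> * ennreal (norm (v (X i \<omega>)))) = (\<Sum>i. ennreal (norm (if enat i < N \<omega> then v (X i \<omega>) else 0)))"
      by (intro suminf_cong) (simp add: w_def)
    then show ?case
      using elim by (intro summable_suminf_not_top) (auto simp: top_ennreal_def)
  qed
qed

lemma point_sum_measurable[measurable]:
  fixes v :: "'a \<Rightarrow> 'b::{banach, second_countable_topology}"
  assumes [measurable]: "v \<in> borel_measurable borel"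
  shows "point_sum v \<in> borel_measurable M"
  unfolding point_sum_def[abs_def] by measurable

text \<open>The sum has mean \<open>k0\<close> times the integral of \<open>v\<close>, and the
  second moment bound contains exactly its square; what is left bounds the variance, and the L1
  deviation is at most its square root.\<close>

lemma concentration_nonneg:
  fixes v :: "'a \<Rightarrow> real"
  assumes nonneg: "\<And>x. 0 \<le> v x" and v: "integrable lborel v" and v2: "integrable lborel (\<lambda>x. (v x)\<^sup>2)"
  shows "integrable M (point_sum v)"
    and "expectation (\<lambda>\<omega>. \<bar>point_sum v \<omega> - k0 * (LINT x|lborel. v x)\<bar>) \<le> sqrt ((k0 + \<kappa>) * (LINT x|lborel. (v x)\<^sup>2))"
proof -
  have [measurable]: "v \<in> borel_measurable borel" using v by simp
  define T where "T = point_sum v"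
  have [measurable]: "T \<in> borel_measurable M" unfolding T_def by measurable
  define I1 where "I1 = (LINT x|lborel. v x)"
  define I2 where "I2 = (LINT x|lborel. (v x)\<^sup>2)"
  have "0 \<le> I1" "0 \<le> I2" "0 \<le> \<kappa>" by (auto simp: I1_def I2_def \<kappa>_def nonneg)
  have T_eq: "AE \<omega> in M. ennreal (T \<omega>) = (\<Sum>i. w i \<omega> * ennreal (v (X i \<omega>)))"
    using AE_summable_point_sum[OF v]
  proof eventually_elim
    case (elim \<omega>)
    have "(\<Sum>i. w i \<omega> * ennreal (v (X i \<omega>))) = (\<Sum>i. ennreal (if enat i < N \<omega> then v (X i \<omega>) else 0))"
      by (intro suminf_cong) (simp add: w_def)
    also have "\<dots> = ennreal (T \<omega>)"
      unfolding T_def point_sum_def using summable_norm_cancel[OF elim] nonneg by (intro suminf_ennreal2) auto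
    finally show ?case ..
  qed
  have T0: "0 \<le> T \<omega>" if "ennreal (T \<omega>) = s" "summable (\<lambda>i. norm (if enat i < N \<omega> then v (X i \<omega>) else 0))" for \<omega> s
    unfolding T_def point_sum_def using summable_norm_cancel[OF that(2)] nonneg by (intro suminf_nonneg) auto
  have Tpos: "AE \<omega> in M. 0 \<le> T \<omega>"
    using AE_summable_point_sum[OF v] by eventually_elim (auto intro: T0)
  have "(\<integral>\<^sup>+\<omega>. ennreal (T \<omega>) \<partial>M) = (\<integral>\<^sup>+\<omega>. (\<Sum>i. w i \<omega> * ennreal (v (X i \<omega>))) \<partial>M)"
    using T_eq by (intro nn_integral_cong_AE)
  also have "\<dots> = ennreal k0 * (\<integral>\<^sup>+x. ennreal (v x) \<partial>lborel)"
    by (rule campbell) measurable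
  also have "\<dots> = ennreal (k0 * I1)"
    unfolding I1_def using v nonneg by (simp add: nn_integral_eq_integral ennreal_mult k0_nonneg)
  finally have ET: "(\<integral>\<^sup>+\<omega>. ennreal (T \<omega>) \<partial>M) = ennreal (k0 * I1)" .
  then show T_int: "integrable M (point_sum v)"
    unfolding T_def[symmetric] using Tpos by (intro integrableI_nonneg) auto
  have ET': "expectation T = k0 * I1"
    using ET Tpos k0_nonneg \<open>0 \<le> I1\<close> by (subst integral_eq_nn_integral) auto
  have "(\<integral>\<^sup>+\<omega>. ennreal ((T \<omega>)\<^sup>2) \<partial>M) = (\<integral>\<^sup>+\<omega>. (\<Sum>i. w i \<omega> * ennreal (v (X i \<omega>)))\<^sup>2 \<partial>M)"
  proof (intro nn_integral_cong_AE, use T_eq Tpos in eventually_elim)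
    case (elim \<omega>)
    show ?case unfolding elim(1)[symmetric] using elim(2) by (simp add: ennreal_power)
  qed
  also have "\<dots> \<le> ennreal (k0 + \<kappa>) * (\<integral>\<^sup>+x. (ennreal (v x))\<^sup>2 \<partial>lborel) + (ennreal k0 * (\<integral>\<^sup>+x. ennreal (v x) \<partial>lborel))\<^sup>2"
    by (rule second_moment_sum_le) measurable
  also have "\<dots> = ennreal ((k0 + \<kappa>) * I2 + (k0 * I1)\<^sup>2)"
  proof -
    have "(\<integral>\<^sup>+x. (ennreal (v x))\<^sup>2 \<partial>lborel) = ennreal I2"
      unfolding I2_def using v2 nonneg by (simp add: ennreal_power nn_integral_eq_integral)
    moreover have "(\<integral>\<^sup>+x. ennreal (v x) \<partial>lborel) = ennreal I1"
      unfolding I1_def using v nonneg by (simp add: nn_integral_eq_integral)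
    ultimately show ?thesis
      using k0_nonneg \<open>0 \<le> I1\<close> \<open>0 \<le> I2\<close> \<open>0 \<le> \<kappa>\<close>
      by (simp add: ennreal_mult[symmetric] ennreal_power ennreal_plus[symmetric] del: ennreal_plus)
  qed
  finally have ET2: "(\<integral>\<^sup>+\<omega>. ennreal ((T \<omega>)\<^sup>2) \<partial>M) \<le> ennreal ((k0 + \<kappa>) * I2 + (k0 * I1)\<^sup>2)" .
  then have T2_int: "integrable M (\<lambda>\<omega>. (T \<omega>)\<^sup>2)"
    by (intro integrableI_nonneg) (auto intro: order_le_less_trans)
  have "expectation (\<lambda>\<omega>. (T \<omega>)\<^sup>2) \<le> (k0 + \<kappa>) * I2 + (k0 * I1)\<^sup>2"
  proof -
    have "ennreal (expectation (\<lambda>\<omega>. (T \<omega>)\<^sup>2)) \<le> ennreal ((k0 + \<kappa>) * I2 + (k0 * I1)\<^sup>2)"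
      using ET2 T2_int by (subst (asm) nn_integral_eq_integral) (simp_all del: ennreal_plus)
    then show ?thesis
      using k0_nonneg \<open>0 \<le> I2\<close> \<open>0 \<le> \<kappa>\<close> by (subst (asm) ennreal_le_iff) simp_all
  qed
  moreover have sq: "(T \<omega> - k0 * I1)\<^sup>2 = (T \<omega>)\<^sup>2 - 2 * (k0 * I1) * T \<omega> + (k0 * I1)\<^sup>2" for \<omega>
    by (simp add: power2_diff)
  have sq_int: "integrable M (\<lambda>\<omega>. (T \<omega> - k0 * I1)\<^sup>2)"
    unfolding sq using T2_int T_int[folded T_def] by simp
  have "expectation (\<lambda>\<omega>. (T \<omega> - k0 * I1)\<^sup>2) = expectation (\<lambda>\<omega>. (T \<omega>)\<^sup>2) - (k0 * I1)\<^sup>2"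
    unfolding sq using T2_int T_int[folded T_def] by (simp add: ET' prob_space power2_eq_square)
  ultimately have "expectation (\<lambda>\<omega>. (T \<omega> - k0 * I1)\<^sup>2) \<le> (k0 + \<kappa>) * I2" by simp
  then have "sqrt (expectation (\<lambda>\<omega>. (T \<omega> - k0 * I1)\<^sup>2)) \<le> sqrt ((k0 + \<kappa>) * I2)" by simp
  with expectation_abs_le_sqrt(2)[OF _ sq_int]
  show "expectation (\<lambda>\<omega>. \<bar>point_sum v \<omega> - k0 * (LINT x|lborel. v x)\<bar>) \<le> sqrt ((k0 + \<kappa>) * (LINT x|lborel. (v x)\<^sup>2))"
    unfolding T_def[symmetric] I1_def[symmetric] I2_def[symmetric] by (auto intro: order_trans)
qed

text \<open>The second moment bound is stated for nonnegative extended values, so \<open>u\<close>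
  is split into the positive and negative parts of its real and imaginary parts. Each is at most
  |u|, which explains the factor 4.\<close>

lemma concentration:
  fixes u :: "'a \<Rightarrow> complex"
  assumes u: "integrable lborel u" and u2: "integrable lborel (\<lambda>x. (cmod (u x))\<^sup>2)"
  shows "integrable M (point_sum u)"
    and "expectation (\<lambda>\<omega>. cmod (point_sum u \<omega> - k0 * (CLINT x|lborel. u x))) \<le>
      4 * sqrt ((k0 + \<kappa>) * (LINT x|lborel. (cmod (u x))\<^sup>2))"
proof -
  have [measurable]: "u \<in> borel_measurable borel" using u by simp
  define bnd where "bnd = sqrt ((k0 + \<kappa>) * (LINT x|lborel. (cmod (u x))\<^sup>2))"
  have good: "integrable lborel v \<and> integrable M (point_sum v) \<and>
      expectation (\<lambda>\<omega>. \<bar>point_sum v \<omega> - k0 * (LINT x|lborel. v x)\<bar>) \<le> bnd"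
    if [measurable]: "v \<in> borel_measurable borel" and v: "\<And>x. 0 \<le> v x" "\<And>x. v x \<le> cmod (u x)" for v :: "'a \<Rightarrow> real"
  proof -
    have i1: "integrable lborel v"
      by (rule Bochner_Integration.integrable_bound[OF integrable_norm[OF u]]) (use v in auto)
    have i2: "integrable lborel (\<lambda>x. (v x)\<^sup>2)"
      by (rule Bochner_Integration.integrable_bound[OF u2]) (use v in \<open>auto intro!: power_mono\<close>)
    have "(LINT x|lborel. (v x)\<^sup>2) \<le> (LINT x|lborel. (cmod (u x))\<^sup>2)"
      by (rule integral_mono[OF i2 u2]) (use v in \<open>auto intro!: power_mono\<close>)
    then have "sqrt ((k0 + \<kappa>) * (LINT x|lborel. (v x)\<^sup>2)) \<le> bnd"
      unfolding bnd_def using k0_nonneg by (intro real_sqrt_le_mono mult_left_mono) (auto simp: \<kappa>_def)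
    with concentration_nonneg[OF v(1) i1 i2] i1 show ?thesis by auto
  qed
  define v1 where "v1 = (\<lambda>x. max 0 (Re (u x)))"
  define v2 where "v2 = (\<lambda>x. max 0 (- Re (u x)))"
  define v3 where "v3 = (\<lambda>x. max 0 (Im (u x)))"
  define v4 where "v4 = (\<lambda>x. max 0 (- Im (u x)))"
  note v_defs = v1_def v2_def v3_def v4_def
  have meas: "v1 \<in> borel_measurable borel" "v2 \<in> borel_measurable borel"
    "v3 \<in> borel_measurable borel" "v4 \<in> borel_measurable borel"
    unfolding v_defs by measurable
  have le: "v1 x \<le> cmod (u x)" "v2 x \<le> cmod (u x)" "v3 x \<le> cmod (u x)" "v4 x \<le> cmod (u x)" for x
    using abs_Re_le_cmod[of "u x"] abs_Im_le_cmod[of "u x"] unfolding v_defs by auto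
  have ge: "0 \<le> v1 x" "0 \<le> v2 x" "0 \<le> v3 x" "0 \<le> v4 x" for x
    unfolding v_defs by auto
  note g1 = good[OF meas(1) ge(1) le(1)] and g2 = good[OF meas(2) ge(2) le(2)]
    and g3 = good[OF meas(3) ge(3) le(3)] and g4 = good[OF meas(4) ge(4) le(4)]
  have u_eq: "u x = (complex_of_real (v1 x) - complex_of_real (v2 x)) +
      \<i> * (complex_of_real (v3 x) - complex_of_real (v4 x))" for x
    unfolding v_defs by (auto simp: complex_eq_iff max_def)
  have Iu: "(CLINT x|lborel. u x) = (complex_of_real (LINT x|lborel. v1 x) - complex_of_real (LINT x|lborel. v2 x)) +
      \<i> * (complex_of_real (LINT x|lborel. v3 x) - complex_of_real (LINT x|lborel. v4 x))"
    unfolding u_eq using g1 g2 g3 g4 by simp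
  define T where "T v \<omega> = point_sum v \<omega> - k0 * (LINT x|lborel. v x)" for v :: "'a \<Rightarrow> real" and \<omega>
  have pu: "AE \<omega> in M. point_sum u \<omega> = (complex_of_real (point_sum v1 \<omega>) - complex_of_real (point_sum v2 \<omega>)) +
      \<i> * (complex_of_real (point_sum v3 \<omega>) - complex_of_real (point_sum v4 \<omega>))"
    using AE_summable_point_sum[OF g1[THEN conjunct1]] AE_summable_point_sum[OF g2[THEN conjunct1]]
      AE_summable_point_sum[OF g3[THEN conjunct1]] AE_summable_point_sum[OF g4[THEN conjunct1]]
  proof eventually_elim
    case (elim \<omega>)
    let ?s = "\<lambda>v i. if enat i < N \<omega> then v (X i \<omega>) else 0"
    note sums = summable_sums[OF summable_norm_cancel[OF elim(1)]] summable_sums[OF summable_norm_cancel[OF elim(2)]]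
      summable_sums[OF summable_norm_cancel[OF elim(3)]] summable_sums[OF summable_norm_cancel[OF elim(4)]]
    have "(\<lambda>i. (complex_of_real (?s v1 i) - complex_of_real (?s v2 i)) + \<i> * (complex_of_real (?s v3 i) - complex_of_real (?s v4 i)))
      sums ((complex_of_real (point_sum v1 \<omega>) - complex_of_real (point_sum v2 \<omega>)) +
      \<i> * (complex_of_real (point_sum v3 \<omega>) - complex_of_real (point_sum v4 \<omega>)))"
      unfolding point_sum_def by (intro sums_add sums_diff sums_mult sums_of_real sums)
    also have "(\<lambda>i. (complex_of_real (?s v1 i) - complex_of_real (?s v2 i)) + \<i> * (complex_of_real (?s v3 i) - complex_of_real (?s v4 i))) =
        (\<lambda>i. if enat i < N \<omega> then u (X i \<omega>) else 0)"
      by (auto simp: fun_eq_iff u_eq[of "X _ \<omega>"])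
    finally show ?case by (simp add: point_sum_def sums_iff)
  qed
  have i4: "integrable M (\<lambda>\<omega>. (complex_of_real (point_sum v1 \<omega>) - complex_of_real (point_sum v2 \<omega>)) +
      \<i> * (complex_of_real (point_sum v3 \<omega>) - complex_of_real (point_sum v4 \<omega>)))"
    using g1 g2 g3 g4 by simp
  show pu_int: "integrable M (point_sum u)"
    by (rule integrable_cong_AE_imp[OF i4]) (use pu in \<open>auto elim: eventually_mono\<close>)
  have T_int: "integrable M (\<lambda>\<omega>. \<bar>T v1 \<omega>\<bar>)" "integrable M (\<lambda>\<omega>. \<bar>T v2 \<omega>\<bar>)"
    "integrable M (\<lambda>\<omega>. \<bar>T v3 \<omega>\<bar>)" "integrable M (\<lambda>\<omega>. \<bar>T v4 \<omega>\<bar>)"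
    unfolding T_def using g1 g2 g3 g4 by auto
  have "expectation (\<lambda>\<omega>. cmod (point_sum u \<omega> - k0 * (CLINT x|lborel. u x))) \<le>
      expectation (\<lambda>\<omega>. \<bar>T v1 \<omega>\<bar> + \<bar>T v2 \<omega>\<bar> + (\<bar>T v3 \<omega>\<bar> + \<bar>T v4 \<omega>\<bar>))"
  proof (rule integral_mono_AE)
    show "integrable M (\<lambda>\<omega>. cmod (point_sum u \<omega> - k0 * (CLINT x|lborel. u x)))"
      using pu_int by (intro integrable_norm Bochner_Integration.integrable_diff) auto
    show "integrable M (\<lambda>\<omega>. \<bar>T v1 \<omega>\<bar> + \<bar>T v2 \<omega>\<bar> + (\<bar>T v3 \<omega>\<bar> + \<bar>T v4 \<omega>\<bar>))"
      using T_int by simp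
    show "AE \<omega> in M. cmod (point_sum u \<omega> - k0 * (CLINT x|lborel. u x)) \<le> \<bar>T v1 \<omega>\<bar> + \<bar>T v2 \<omega>\<bar> + (\<bar>T v3 \<omega>\<bar> + \<bar>T v4 \<omega>\<bar>)"
      using pu
    proof eventually_elim
      case (elim \<omega>)
      have "point_sum u \<omega> - k0 * (CLINT x|lborel. u x) = Complex (T v1 \<omega> - T v2 \<omega>) (T v3 \<omega> - T v4 \<omega>)"
        unfolding elim Iu T_def by (simp add: complex_eq_iff algebra_simps)
      then have "cmod (point_sum u \<omega> - k0 * (CLINT x|lborel. u x)) \<le> \<bar>T v1 \<omega> - T v2 \<omega>\<bar> + \<bar>T v3 \<omega> - T v4 \<omega>\<bar>"
        using cmod_le[of "Complex (T v1 \<omega> - T v2 \<omega>) (T v3 \<omega> - T v4 \<omega>)"] by simp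
      then show ?case
        using abs_triangle_ineq4[of "T v1 \<omega>" "T v2 \<omega>"] abs_triangle_ineq4[of "T v3 \<omega>" "T v4 \<omega>"] by linarith
    qed
  qed
  also have "\<dots> = expectation (\<lambda>\<omega>. \<bar>T v1 \<omega>\<bar>) + expectation (\<lambda>\<omega>. \<bar>T v2 \<omega>\<bar>) +
      (expectation (\<lambda>\<omega>. \<bar>T v3 \<omega>\<bar>) + expectation (\<lambda>\<omega>. \<bar>T v4 \<omega>\<bar>))"
    using T_int by simp
  also have "\<dots> \<le> 4 * bnd"
    using g1 g2 g3 g4 unfolding T_def by linarith
  finally show "expectation (\<lambda>\<omega>. cmod (point_sum u \<omega> - k0 * (CLINT x|lborel. u x))) \<le>
      4 * sqrt ((k0 + \<kappa>) * (LINT x|lborel. (cmod (u x))\<^sup>2))"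
    unfolding bnd_def .
qed

end

section \<open>Marked determinantal processes\<close>

text \<open>Only finitely many coordinates occur, so the infinite product measure may be projected
  to a finite one, where integrals of products factorise.\<close>

lemma (in prob_space) integral_iid_prod:
  fixes f :: "nat \<Rightarrow> 'a \<Rightarrow> complex"
  assumes [measurable]: "\<And>j. f j \<in> borel_measurable M" and bnd: "\<And>j x. norm (f j x) \<le> 1"
  shows "(CLINT r|(\<Pi>\<^sub>M i\<in>UNIV. M). (\<Prod>j<n. f j (r j))) = (\<Prod>j<n. CLINT x|M. f j x)"
proof -
  interpret P: product_prob_space "\<lambda>_::nat. M" UNIV ..
  have "(CLINT r|(\<Pi>\<^sub>M i\<in>{..<n}. M). (\<Prod>j<n. f j (r j))) =
      (CLINT r|distr (\<Pi>\<^sub>M i\<in>UNIV. M) (\<Pi>\<^sub>M i\<in>{..<n}. M) (\<lambda>x. restrict x {..<n}). (\<Prod>j<n. f j (r j)))"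
    by (subst P.distr_PiM_restrict_finite) auto
  also have "\<dots> = (CLINT r|(\<Pi>\<^sub>M i\<in>UNIV. M). (\<Prod>j<n. f j (restrict r {..<n} j)))"
    by (rule integral_distr) (auto intro!: measurable_restrict borel_measurable_prod measurable_compose[OF measurable_component_singleton])
  also have "\<dots> = (CLINT r|(\<Pi>\<^sub>M i\<in>UNIV. M). (\<Prod>j<n. f j (r j)))"
    by (intro Bochner_Integration.integral_cong prod.cong) auto
  finally have "(CLINT r|(\<Pi>\<^sub>M i\<in>UNIV. M). (\<Prod>j<n. f j (r j))) = (CLINT r|(\<Pi>\<^sub>M i\<in>{..<n}. M). (\<Prod>j<n. f j (r j)))" ..
  also have "\<dots> = (\<Prod>j<n. CLINT x|M. f j x)"
    by (rule P.product_integral_prod) (use bnd in \<open>auto intro!: integrable_const_bound[where B = 1]\<close>)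
  finally show ?thesis .
qed

locale marked_enumeration = determinantal_enumeration M N X \<phi> k
  for M :: "'w measure" and N :: "'w \<Rightarrow> enat" and X :: "nat \<Rightarrow> 'w \<Rightarrow> 'a::euclidean_space" and \<phi> k +
  fixes R :: "nat \<Rightarrow> 'w \<Rightarrow> real" and \<nu> :: "real measure" and \<Phi> :: "'w \<Rightarrow> ('a \<times> real) measure"
  assumes mark_prob: "prob_space \<nu>" and mark_sets[measurable_cong]: "sets \<nu> = sets borel"
    and R_measurable[measurable]: "\<And>i. R i \<in> borel_measurable M"
    and joint_law: "distr M ((count_space UNIV \<Otimes>\<^sub>M (\<Pi>\<^sub>M i\<in>UNIV. borel)) \<Otimes>\<^sub>M (\<Pi>\<^sub>M i\<in>UNIV. borel))
            (\<lambda>\<omega>. ((N \<omega>, \<lambda>i. X i \<omega>), \<lambda>i. R i \<omega>)) =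
          distr M (count_space UNIV \<Otimes>\<^sub>M (\<Pi>\<^sub>M i\<in>UNIV. borel)) (\<lambda>\<omega>. (N \<omega>, \<lambda>i. X i \<omega>)) \<Otimes>\<^sub>M (\<Pi>\<^sub>M i\<in>UNIV. \<nu>)"
    and \<Phi>_sets: "\<And>\<omega>. \<omega> \<in> space M \<Longrightarrow> sets (\<Phi> \<omega>) = sets borel"
    and \<Phi>_enumeration: "\<And>\<omega> B. \<omega> \<in> space M \<Longrightarrow> B \<in> sets borel \<Longrightarrow>
      emeasure (\<Phi> \<omega>) B = (\<Sum>i. if enat i < N \<omega> then indicator B (X i \<omega>, R i \<omega>) else 0)"
begin

sublocale mark: prob_space \<nu> by (rule mark_prob)

abbreviation "point_space \<equiv> count_space UNIV \<Otimes>\<^sub>M (\<Pi>\<^sub>M i\<in>(UNIV :: nat set). (borel :: 'a measure))"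
abbreviation "mark_space \<equiv> (\<Pi>\<^sub>M i\<in>(UNIV :: nat set). (borel :: real measure))"
abbreviation "marks \<equiv> (\<Pi>\<^sub>M i\<in>(UNIV :: nat set). \<nu>)"

lemma sets_marks[measurable_cong]: "sets marks = sets mark_space"
  by (intro sets_PiM_cong refl mark_sets)

lemma NX_measurable[measurable]: "(\<lambda>\<omega>. (N \<omega>, \<lambda>i. X i \<omega>)) \<in> measurable M point_space"
  by (intro measurable_Pair measurable_PiM_single') auto

lemma NXR_measurable[measurable]: "(\<lambda>\<omega>. ((N \<omega>, \<lambda>i. X i \<omega>), \<lambda>i. R i \<omega>)) \<in> measurable M (point_space \<Otimes>\<^sub>M mark_space)"
  by (intro measurable_Pair NX_measurable measurable_PiM_single') auto

lemma prob_space_marks: "prob_space marks"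
  by (intro prob_space_PiM mark_prob)

lemma point_space_measurable[measurable]:
  "(\<lambda>p. snd p i) \<in> borel_measurable point_space" "(\<lambda>p. if enat i < fst p then 1 else 0 :: ennreal) \<in> borel_measurable point_space"
proof -
  show "(\<lambda>p. snd p i) \<in> borel_measurable point_space"
    by (rule measurable_compose[OF measurable_snd measurable_component_singleton]) simp
  show "(\<lambda>p. if enat i < fst p then 1 else 0 :: ennreal) \<in> borel_measurable point_space"
    by (rule measurable_compose[OF measurable_fst, of "\<lambda>n. if enat i < n then 1 else 0"]) simp
qed

text \<open>The product form of the joint law allows the marks to be integrated first with the
  enumerated points frozen, which replaces conditioning on the points.\<close>

lemma nn_integral_joint:
  assumes F: "F \<in> borel_measurable (point_space \<Otimes>\<^sub>M mark_space)"
  shows "(\<integral>\<^sup>+\<omega>. F ((N \<omega>, \<lambda>i. X i \<omega>), \<lambda>i. R i \<omega>) \<partial>M) = (\<integral>\<^sup>+\<omega>. (\<integral>\<^sup>+r. F ((N \<omega>, \<lambda>i. X i \<omega>), r) \<partial>marks) \<partial>M)"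
proof -
  interpret marks: prob_space marks by (rule prob_space_marks)
  note [measurable] = F
  have "(\<integral>\<^sup>+\<omega>. F ((N \<omega>, \<lambda>i. X i \<omega>), \<lambda>i. R i \<omega>) \<partial>M) = (\<integral>\<^sup>+z. F z \<partial>(distr M point_space (\<lambda>\<omega>. (N \<omega>, \<lambda>i. X i \<omega>)) \<Otimes>\<^sub>M marks))"
    unfolding joint_law[symmetric] by (subst nn_integral_distr) auto
  also have "\<dots> = (\<integral>\<^sup>+p. (\<integral>\<^sup>+r. F (p, r) \<partial>marks) \<partial>distr M point_space (\<lambda>\<omega>. (N \<omega>, \<lambda>i. X i \<omega>)))"
    by (rule marks.nn_integral_fst[symmetric]) measurable
  also have "\<dots> = (\<integral>\<^sup>+\<omega>. (\<integral>\<^sup>+r. F ((N \<omega>, \<lambda>i. X i \<omega>), r) \<partial>marks) \<partial>M)"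
    by (subst nn_integral_distr) auto
  finally show ?thesis .
qed

lemma integral_joint:
  fixes F :: "_ \<Rightarrow> complex"
  assumes F: "F \<in> borel_measurable (point_space \<Otimes>\<^sub>M mark_space)" and bnd: "\<And>z. norm (F z) \<le> 1"
  shows "(CLINT \<omega>|M. F ((N \<omega>, \<lambda>i. X i \<omega>), \<lambda>i. R i \<omega>)) = (CLINT \<omega>|M. (CLINT r|marks. F ((N \<omega>, \<lambda>i. X i \<omega>), r)))"
proof -
  interpret marks: prob_space marks by (rule prob_space_marks)
  interpret D: prob_space "distr M point_space (\<lambda>\<omega>. (N \<omega>, \<lambda>i. X i \<omega>))"
    by (rule prob_space_distr) measurable
  interpret pair_prob_space "distr M point_space (\<lambda>\<omega>. (N \<omega>, \<lambda>i. X i \<omega>))" marks ..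
  note [measurable] = F
  have "(CLINT \<omega>|M. F ((N \<omega>, \<lambda>i. X i \<omega>), \<lambda>i. R i \<omega>)) = (CLINT z|(distr M point_space (\<lambda>\<omega>. (N \<omega>, \<lambda>i. X i \<omega>)) \<Otimes>\<^sub>M marks). F z)"
    unfolding joint_law[symmetric] by (subst integral_distr) auto
  also have "\<dots> = (CLINT p|distr M point_space (\<lambda>\<omega>. (N \<omega>, \<lambda>i. X i \<omega>)). (CLINT r|marks. F (p, r)))"
    by (rule integral_fst'[symmetric], rule P.integrable_const_bound[where B = 1]) (use bnd in auto)
  also have "\<dots> = (CLINT \<omega>|M. (CLINT r|marks. F ((N \<omega>, \<lambda>i. X i \<omega>), r)))"
    by (subst integral_distr) auto
  finally show ?thesis .
qed

text \<open>For each index separately the mark can be averaged out given the point; the remaining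
  sum over points falls under the unmarked formula.\<close>

lemma marked_campbell:
  fixes g :: "'a \<times> real \<Rightarrow> ennreal"
  assumes g: "g \<in> borel_measurable borel"
  shows "(\<integral>\<^sup>+\<omega>. (\<Sum>i. w i \<omega> * g (X i \<omega>, R i \<omega>)) \<partial>M) = ennreal k0 * (\<integral>\<^sup>+x. (\<integral>\<^sup>+r. g (x, r) \<partial>\<nu>) \<partial>lborel)"
proof -
  have gm[measurable]: "g \<in> borel_measurable (borel \<Otimes>\<^sub>M borel)" using g by (simp add: borel_prod)
  define G where "G x = (\<integral>\<^sup>+r. g (x, r) \<partial>\<nu>)" for x
  have [measurable]: "G \<in> borel_measurable borel" unfolding G_def by measurable
  have one: "(\<integral>\<^sup>+\<omega>. w i \<omega> * g (X i \<omega>, R i \<omega>) \<partial>M) = (\<integral>\<^sup>+\<omega>. w i \<omega> * G (X i \<omega>) \<partial>M)" for i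
  proof -
    define F where "F = (\<lambda>z. (if enat i < fst (fst z) then 1 else 0 :: ennreal) * g (snd (fst z) i, snd z i))"
    have Fm: "F \<in> borel_measurable (point_space \<Otimes>\<^sub>M mark_space)"
    proof -
      have 1: "(\<lambda>z. (if enat i < fst (fst z) then 1 else 0 :: ennreal)) \<in> borel_measurable (point_space \<Otimes>\<^sub>M mark_space)"
        by (rule measurable_compose[OF measurable_fst point_space_measurable(2)])
      have 2: "(\<lambda>z. snd (fst z) i) \<in> borel_measurable (point_space \<Otimes>\<^sub>M mark_space)"
        by (rule measurable_compose[OF measurable_fst point_space_measurable(1)])
      have 3: "(\<lambda>z. snd z i) \<in> borel_measurable (point_space \<Otimes>\<^sub>M mark_space)"
        by (rule measurable_compose[OF measurable_snd measurable_component_singleton]) simp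
      show ?thesis
      proof -
        have "(\<lambda>z. g (snd (fst z) i, snd z i)) \<in> borel_measurable (point_space \<Otimes>\<^sub>M mark_space)"
          by (intro measurable_compose[OF _ gm] measurable_Pair 2 3)
        with 1 show ?thesis unfolding F_def by measurable
      qed
    qed
    have "(\<integral>\<^sup>+\<omega>. w i \<omega> * g (X i \<omega>, R i \<omega>) \<partial>M) = (\<integral>\<^sup>+\<omega>. F ((N \<omega>, \<lambda>i. X i \<omega>), \<lambda>i. R i \<omega>) \<partial>M)"
      by (simp add: F_def w_def)
    also have "\<dots> = (\<integral>\<^sup>+\<omega>. (\<integral>\<^sup>+r. w i \<omega> * g (X i \<omega>, r i) \<partial>marks) \<partial>M)"
      unfolding nn_integral_joint[OF Fm] by (simp add: F_def w_def)
    also have "\<dots> = (\<integral>\<^sup>+\<omega>. w i \<omega> * G (X i \<omega>) \<partial>M)"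
    proof (rule nn_integral_cong)
      fix \<omega>
      have "(\<integral>\<^sup>+r. w i \<omega> * g (X i \<omega>, r i) \<partial>marks) = (\<integral>\<^sup>+s. w i \<omega> * g (X i \<omega>, s) \<partial>distr marks \<nu> (\<lambda>r. r i))"
        by (subst nn_integral_distr) auto
      also have "\<dots> = (\<integral>\<^sup>+s. w i \<omega> * g (X i \<omega>, s) \<partial>\<nu>)"
        by (subst distr_PiM_component) (auto intro: mark_prob)
      also have "\<dots> = w i \<omega> * G (X i \<omega>)"
        unfolding G_def by (rule nn_integral_cmult) measurable
      finally show "(\<integral>\<^sup>+r. w i \<omega> * g (X i \<omega>, r i) \<partial>marks) = w i \<omega> * G (X i \<omega>)" .
    qed
    finally show ?thesis .
  qed
  have "(\<integral>\<^sup>+\<omega>. (\<Sum>i. w i \<omega> * g (X i \<omega>, R i \<omega>)) \<partial>M) = (\<Sum>i. \<integral>\<^sup>+\<omega>. w i \<omega> * g (X i \<omega>, R i \<omega>) \<partial>M)"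
    by (rule nn_integral_suminf) measurable
  also have "\<dots> = (\<integral>\<^sup>+\<omega>. (\<Sum>i. w i \<omega> * G (X i \<omega>)) \<partial>M)"
    unfolding one by (rule nn_integral_suminf[symmetric]) measurable
  also have "\<dots> = ennreal k0 * (\<integral>\<^sup>+x. G x \<partial>lborel)"
    by (rule campbell) measurable
  finally show ?thesis by (simp add: G_def)
qed

text \<open>The marking specifies the values of \<open>\<Phi>\<close> on Borel sets. Written as an
  image of a weighted counting measure, it allows integrals against \<open>\<Phi>\<close> to be
  computed as series.\<close>

lemma \<Phi>_eq_distr:
  assumes \<omega>: "\<omega> \<in> space M"
  shows "\<Phi> \<omega> = distr (density (count_space UNIV) (\<lambda>i. w i \<omega>)) borel (\<lambda>i. (X i \<omega>, R i \<omega>))"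
proof (rule measure_eqI)
  fix B assume "B \<in> sets (\<Phi> \<omega>)"
  then have B: "B \<in> sets borel" using \<omega> by (simp add: \<Phi>_sets)
  have "emeasure (distr (density (count_space UNIV) (\<lambda>i. w i \<omega>)) borel (\<lambda>i. (X i \<omega>, R i \<omega>))) B =
      (\<integral>\<^sup>+i. w i \<omega> * indicator ((\<lambda>i. (X i \<omega>, R i \<omega>)) -` B) i \<partial>count_space UNIV)"
    using B by (subst emeasure_distr) (auto simp: emeasure_density)
  also have "\<dots> = emeasure (\<Phi> \<omega>) B"
    unfolding \<Phi>_enumeration[OF \<omega> B] nn_integral_count_space_nat
    by (intro suminf_cong) (simp add: w_def indicator_def)
  finally show "emeasure (\<Phi> \<omega>) B = emeasure (distr (density (count_space UNIV) (\<lambda>i. w i \<omega>)) borel (\<lambda>i. (X i \<omega>, R i \<omega>))) B" ..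
qed (use \<omega> in \<open>simp add: \<Phi>_sets\<close>)

lemma nn_integral_\<Phi>:
  assumes "\<omega> \<in> space M" "g \<in> borel_measurable borel"
  shows "(\<integral>\<^sup>+z. g z \<partial>\<Phi> \<omega>) = (\<Sum>i. w i \<omega> * g (X i \<omega>, R i \<omega>))"
  unfolding \<Phi>_eq_distr[OF assms(1)] using assms(2)
  by (simp add: nn_integral_distr nn_integral_density nn_integral_count_space_nat)

lemma nn_integral_\<Phi>_measurable:
  assumes [measurable]: "g \<in> borel_measurable borel"
  shows "(\<lambda>\<omega>. \<integral>\<^sup>+z. g z \<partial>\<Phi> \<omega>) \<in> borel_measurable M"
proof -
  have "(\<lambda>\<omega>. (X i \<omega>, R i \<omega>)) \<in> borel_measurable M" for i
    unfolding borel_prod[symmetric] by measurable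
  then have [measurable]: "(\<lambda>\<omega>. g (X i \<omega>, R i \<omega>)) \<in> borel_measurable M" for i
    by (rule measurable_compose) measurable
  show ?thesis by (simp add: nn_integral_\<Phi> cong: measurable_cong)
qed

lemma integral_\<Phi>_measurable_nonneg:
  fixes g :: "'a \<times> real \<Rightarrow> real"
  assumes [measurable]: "g \<in> borel_measurable borel" and "\<And>z. 0 \<le> g z"
  shows "(\<lambda>\<omega>. LINT z|\<Phi> \<omega>. g z) \<in> borel_measurable M"
proof -
  have [measurable]: "(\<lambda>\<omega>. \<integral>\<^sup>+z. ennreal (g z) \<partial>\<Phi> \<omega>) \<in> borel_measurable M"
    by (rule nn_integral_\<Phi>_measurable) measurable
  have "(LINT z|\<Phi> \<omega>. g z) = enn2real (\<integral>\<^sup>+z. ennreal (g z) \<partial>\<Phi> \<omega>)" if "\<omega> \<in> space M" for \<omega>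
  proof (rule integral_eq_nn_integral)
    show "g \<in> borel_measurable (\<Phi> \<omega>)"
      using assms(1) \<Phi>_sets[OF that] by (simp cong: measurable_cong_sets)
  qed (use assms(2) in auto)
  then show ?thesis by (simp cong: measurable_cong)
qed

lemma AE_\<Phi>_summable:
  fixes h :: "'a \<times> real \<Rightarrow> real"
  assumes [measurable]: "h \<in> borel_measurable borel"
    and fin: "(\<integral>\<^sup>+x. (\<integral>\<^sup>+r. ennreal \<bar>h (x, r)\<bar> \<partial>\<nu>) \<partial>lborel) < \<infinity>"
  shows "AE \<omega> in M. summable (\<lambda>i. \<bar>if enat i < N \<omega> then h (X i \<omega>, R i \<omega>) else 0\<bar>) \<and> integrable (\<Phi> \<omega>) h \<and>
    (LINT z|\<Phi> \<omega>. h z) = (\<Sum>i. if enat i < N \<omega> then h (X i \<omega>, R i \<omega>) else 0)"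
proof -
  have "(\<integral>\<^sup>+\<omega>. (\<integral>\<^sup>+z. ennreal \<bar>h z\<bar> \<partial>\<Phi> \<omega>) \<partial>M) = (\<integral>\<^sup>+\<omega>. (\<Sum>i. w i \<omega> * ennreal \<bar>h (X i \<omega>, R i \<omega>)\<bar>) \<partial>M)"
    by (intro nn_integral_cong nn_integral_\<Phi>) auto
  also have "\<dots> = ennreal k0 * (\<integral>\<^sup>+x. (\<integral>\<^sup>+r. ennreal \<bar>h (x, r)\<bar> \<partial>\<nu>) \<partial>lborel)"
    by (rule marked_campbell) measurable
  also have "\<dots> < \<infinity>"
    using fin by (simp add: ennreal_mult_less_top)
  finally have "AE \<omega> in M. (\<integral>\<^sup>+z. ennreal \<bar>h z\<bar> \<partial>\<Phi> \<omega>) \<noteq> \<infinity>"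
    by (intro nn_integral_PInf_AE nn_integral_\<Phi>_measurable) auto
  then show ?thesis
    using AE_space
  proof eventually_elim
    case (elim \<omega>)
    let ?s = "\<lambda>i. if enat i < N \<omega> then h (X i \<omega>, R i \<omega>) else 0"
    have "(\<integral>\<^sup>+z. ennreal \<bar>h z\<bar> \<partial>\<Phi> \<omega>) = (\<Sum>i. ennreal \<bar>?s i\<bar>)"
      using elim(2) by (subst nn_integral_\<Phi>) (auto simp: w_def intro!: suminf_cong)
    then have sum: "summable (\<lambda>i. \<bar>?s i\<bar>)"
      using elim(1) by (intro summable_suminf_not_top) (auto simp: top_ennreal_def)
    have hm: "h \<in> borel_measurable (\<Phi> \<omega>)"
      using assms(1) \<Phi>_sets[OF elim(2)] by (simp cong: measurable_cong_sets)
    have int: "integrable (\<Phi> \<omega>) h"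
      using elim(1) hm by (intro integrableI_bounded) (auto simp: less_top)
    have w_eq: "w i \<omega> = ennreal (if enat i < N \<omega> then 1 else 0)" for i
      by (simp add: w_def)
    have "(LINT z|\<Phi> \<omega>. h z) = (LINT i|density (count_space UNIV) (\<lambda>i. w i \<omega>). h (X i \<omega>, R i \<omega>))"
      unfolding \<Phi>_eq_distr[OF elim(2)] by (rule integral_distr) auto
    also have "\<dots> = (LINT i|count_space UNIV. (if enat i < N \<omega> then 1 else 0) *\<^sub>R h (X i \<omega>, R i \<omega>))"
      unfolding w_eq by (rule integral_density) auto
    also have "\<dots> = (LINT i|count_space UNIV. ?s i)"
      by (intro Bochner_Integration.integral_cong) auto
    also have "\<dots> = (\<Sum>i. ?s i)"
      using sum by (intro integral_count_space_nat) (simp add: integrable_count_space_nat_iff)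
    finally show ?case using sum int by simp
  qed
qed

lemma expectation_\<Phi>_nonneg:
  fixes g :: "'a \<times> real \<Rightarrow> real"
  assumes [measurable]: "g \<in> borel_measurable borel" and nonneg: "\<And>z. 0 \<le> g z"
    and fin: "(\<integral>\<^sup>+x. (\<integral>\<^sup>+r. ennreal (g (x, r)) \<partial>\<nu>) \<partial>lborel) < \<infinity>"
  shows "expectation (\<lambda>\<omega>. LINT z|\<Phi> \<omega>. g z) = k0 * enn2real (\<integral>\<^sup>+x. (\<integral>\<^sup>+r. ennreal (g (x, r)) \<partial>\<nu>) \<partial>lborel)"
proof -
  have "AE \<omega> in M. integrable (\<Phi> \<omega>) g"
    using AE_\<Phi>_summable[of g] fin nonneg by (auto elim!: eventually_mono)
  then have "(\<integral>\<^sup>+\<omega>. ennreal (LINT z|\<Phi> \<omega>. g z) \<partial>M) = (\<integral>\<^sup>+\<omega>. (\<integral>\<^sup>+z. ennreal (g z) \<partial>\<Phi> \<omega>) \<partial>M)"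
    by (intro nn_integral_cong_AE) (auto elim!: eventually_mono simp: nn_integral_eq_integral nonneg)
  also have "\<dots> = (\<integral>\<^sup>+\<omega>. (\<Sum>i. w i \<omega> * ennreal (g (X i \<omega>, R i \<omega>))) \<partial>M)"
    by (intro nn_integral_cong nn_integral_\<Phi>) auto
  also have "\<dots> = ennreal k0 * (\<integral>\<^sup>+x. (\<integral>\<^sup>+r. ennreal (g (x, r)) \<partial>\<nu>) \<partial>lborel)"
    by (rule marked_campbell) measurable
  finally have "enn2real (\<integral>\<^sup>+\<omega>. ennreal (LINT z|\<Phi> \<omega>. g z) \<partial>M) = k0 * enn2real (\<integral>\<^sup>+x. (\<integral>\<^sup>+r. ennreal (g (x, r)) \<partial>\<nu>) \<partial>lborel)"
    by (simp add: enn2real_mult k0_nonneg)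
  then show ?thesis
    using integral_\<Phi>_measurable_nonneg[OF assms(1) nonneg] nonneg
    by (subst integral_eq_nn_integral) (auto intro!: Bochner_Integration.integral_nonneg)
qed

lemma integral_\<Phi>_measurable:
  fixes h :: "'a \<times> real \<Rightarrow> real"
  assumes h[measurable]: "h \<in> borel_measurable borel"
  shows "(\<lambda>\<omega>. LINT z|\<Phi> \<omega>. h z) \<in> borel_measurable M"
proof -
  define p where "p \<omega> = (LINT z|\<Phi> \<omega>. max 0 (h z))" for \<omega>
  define n where "n \<omega> = (LINT z|\<Phi> \<omega>. max 0 (- h z))" for \<omega>
  define a where "a \<omega> = (\<integral>\<^sup>+z. ennreal \<bar>h z\<bar> \<partial>\<Phi> \<omega>)" for \<omega>
  have [measurable]: "p \<in> borel_measurable M" "n \<in> borel_measurable M"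
    unfolding p_def n_def by (rule integral_\<Phi>_measurable_nonneg; simp)+
  have [measurable]: "a \<in> borel_measurable M"
    unfolding a_def by (rule nn_integral_\<Phi>_measurable) measurable
  \<comment> \<open>Where |h| has infinite integral the Bochner integral takes the default value 0;
    elsewhere it is the difference of two measurable nonnegative parts.\<close>
  have split: "(LINT z|\<Phi> \<omega>. h z) = (if a \<omega> < \<infinity> then p \<omega> - n \<omega> else 0)" if "\<omega> \<in> space M" for \<omega>
  proof -
    have hm: "h \<in> borel_measurable (\<Phi> \<omega>)"
      using h \<Phi>_sets[OF that] by (simp cong: measurable_cong_sets)
    show ?thesis
    proof (cases "integrable (\<Phi> \<omega>) h")
      case True
      have "(LINT z|\<Phi> \<omega>. h z) = (LINT z|\<Phi> \<omega>. max 0 (h z) - max 0 (- h z))"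
        by (intro Bochner_Integration.integral_cong) (auto simp: max_def)
      also have "\<dots> = p \<omega> - n \<omega>"
        unfolding p_def n_def using True by (intro Bochner_Integration.integral_diff) auto
      finally show ?thesis using True by (simp add: a_def integrable_iff_bounded)
    next
      case False
      then show ?thesis using hm by (simp add: a_def integrable_iff_bounded not_integrable_integral_eq)
    qed
  qed
  have "(\<lambda>\<omega>. if a \<omega> < \<infinity> then p \<omega> - n \<omega> else 0) \<in> borel_measurable M"
    by measurable
  then show ?thesis by (subst measurable_cong[OF split])
qed

text \<open>Averaging the marks gives a product formula for finitely many indices, so the argument
  runs with the first n indices and bounds uniform in n. The first error term is the replacement of
  the product by an exponential, summed with Campbell's formula; the second is the replacement of
  the random exponent by its mean.\<close>

theorem marked_characteristic_bound:
  fixes h :: "'a \<times> real \<Rightarrow> real"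
  assumes [measurable]: "h \<in> borel_measurable borel"
    and fin: "(\<integral>\<^sup>+x. (\<integral>\<^sup>+r. ennreal \<bar>h (x, r)\<bar> \<partial>\<nu>) \<partial>lborel) < \<infinity>"
  defines "u \<equiv> \<lambda>x. CLINT r|\<nu>. iexp (h (x, r)) - 1"
  shows "integrable lborel u" "integrable lborel (\<lambda>x. (cmod (u x))\<^sup>2)"
    and "cmod (expectation (\<lambda>\<omega>. iexp (LINT z|\<Phi> \<omega>. h z)) - exp (k0 * (CLINT x|lborel. u x))) \<le>
      exp 2 * k0 * (LINT x|lborel. (cmod (u x))\<^sup>2) + 4 * sqrt ((k0 + \<kappa>) * (LINT x|lborel. (cmod (u x))\<^sup>2))"
proof -
  have hm[measurable]: "h \<in> borel_measurable (borel \<Otimes>\<^sub>M borel)" using assms(1) by (simp add: borel_prod)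
  have um[measurable]: "u \<in> borel_measurable borel"
    unfolding u_def by measurable
  have int_e: "integrable \<nu> (\<lambda>r. iexp (h (x, r)))" for x
    by (rule mark.integrable_const_bound[where B = 1]) auto
  have u1: "1 + u x = (CLINT r|\<nu>. iexp (h (x, r)))" for x
    unfolding u_def using int_e by (simp add: mark.prob_space)
  have u1_le: "norm (1 + u x) \<le> 1" for x
  proof -
    have "norm (1 + u x) \<le> (LINT r|\<nu>. norm (iexp (h (x, r))))"
      unfolding u1 by (rule integral_norm_bound)
    then show ?thesis by (simp add: mark.prob_space)
  qed
  have Re_u: "Re (u x) \<le> 0" for x
    using complex_Re_le_cmod[of "1 + u x"] u1_le[of x] by simp
  have u2: "norm (u x) \<le> 2" for x
    using norm_triangle_ineq4[of "1 + u x" 1] u1_le[of x] by simp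
  have u_le: "ennreal (norm (u x)) \<le> (\<integral>\<^sup>+r. ennreal \<bar>h (x, r)\<bar> \<partial>\<nu>)" for x
  proof -
    have "ennreal (norm (u x)) \<le> (\<integral>\<^sup>+r. ennreal (norm (iexp (h (x, r)) - 1)) \<partial>\<nu>)"
      unfolding u_def using int_e by (intro integral_norm_bound_ennreal) simp
    also have "\<dots> \<le> (\<integral>\<^sup>+r. ennreal \<bar>h (x, r)\<bar> \<partial>\<nu>)"
      by (intro nn_integral_mono ennreal_leI cmod_iexp_minus_one_le)
    finally show ?thesis .
  qed
  show u_int: "integrable lborel u"
  proof (rule integrableI_bounded)
    have "(\<integral>\<^sup>+x. ennreal (norm (u x)) \<partial>lborel) \<le> (\<integral>\<^sup>+x. (\<integral>\<^sup>+r. ennreal \<bar>h (x, r)\<bar> \<partial>\<nu>) \<partial>lborel)"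
      by (intro nn_integral_mono u_le)
    then show "(\<integral>\<^sup>+x. ennreal (norm (u x)) \<partial>lborel) < \<infinity>" using fin by (rule order_le_less_trans)
  qed simp
  show u2_int: "integrable lborel (\<lambda>x. (cmod (u x))\<^sup>2)"
  proof (rule Bochner_Integration.integrable_bound[OF integrable_mult_right[OF integrable_norm[OF u_int], of 2]])
    show "AE x in lborel. norm ((cmod (u x))\<^sup>2) \<le> norm (2 * norm (u x))"
      using u2 by (auto simp: power2_eq_square intro!: mult_right_mono)
  qed simp
  \<comment> \<open>Indices without a point contribute the neutral values, 1 to the product and 0 to
    the exponent.\<close>
  define e where "e j \<omega> = (if enat j < N \<omega> then iexp (h (X j \<omega>, R j \<omega>)) else 1)" for j \<omega>
  define v where "v j \<omega> = (if enat j < N \<omega> then u (X j \<omega>) else 0)" for j \<omega>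
  have XR: "(\<lambda>\<omega>. h (X j \<omega>, R j \<omega>)) \<in> borel_measurable M" for j
    by measurable
  have [measurable]: "e j \<in> borel_measurable M" for j
    unfolding e_def[abs_def] using XR by measurable
  have [measurable]: "v j \<in> borel_measurable M" for j
    unfolding v_def[abs_def] by measurable
  have prod_eq: "expectation (\<lambda>\<omega>. \<Prod>j<n. e j \<omega>) = expectation (\<lambda>\<omega>. \<Prod>j<n. 1 + v j \<omega>)" for n
  proof -
    define F where "F = (\<lambda>z::(enat \<times> (nat \<Rightarrow> 'a)) \<times> (nat \<Rightarrow> real).
      \<Prod>j<n. if enat j < fst (fst z) then iexp (h (snd (fst z) j, snd z j)) else 1)"
    have Fm: "F \<in> borel_measurable (point_space \<Otimes>\<^sub>M mark_space)"
      unfolding F_def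
    proof (intro borel_measurable_prod measurable_If measurable_const)
      fix j
      have "(\<lambda>z. enat j < fst (fst z)) \<in> measurable (point_space \<Otimes>\<^sub>M mark_space) (count_space UNIV)"
        by (rule measurable_compose[OF measurable_compose[OF measurable_fst measurable_fst]]) simp
      then show "{z \<in> space (point_space \<Otimes>\<^sub>M mark_space). enat j < fst (fst z)} \<in> sets (point_space \<Otimes>\<^sub>M mark_space)"
        by (simp add: pred_def)
      have 2: "(\<lambda>z. snd (fst z) j) \<in> borel_measurable (point_space \<Otimes>\<^sub>M mark_space)"
        by (rule measurable_compose[OF measurable_fst point_space_measurable(1)])
      have 3: "(\<lambda>z. snd z j) \<in> borel_measurable (point_space \<Otimes>\<^sub>M mark_space)"
        by (rule measurable_compose[OF measurable_snd measurable_component_singleton]) simp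
      have "(\<lambda>z. h (snd (fst z) j, snd z j)) \<in> borel_measurable (point_space \<Otimes>\<^sub>M mark_space)"
        by (intro measurable_compose[OF _ hm] measurable_Pair 2 3)
      then show "(\<lambda>z. iexp (h (snd (fst z) j, snd z j))) \<in> borel_measurable (point_space \<Otimes>\<^sub>M mark_space)"
        by measurable
    qed auto
    have F1: "norm (F z) \<le> 1" for z
      unfolding F_def prod_norm[symmetric] by (intro prod_le_1) auto
    have "expectation (\<lambda>\<omega>. \<Prod>j<n. e j \<omega>) = (CLINT \<omega>|M. F ((N \<omega>, \<lambda>i. X i \<omega>), \<lambda>i. R i \<omega>))"
      unfolding F_def e_def fst_conv snd_conv ..
    also have "\<dots> = (CLINT \<omega>|M. (CLINT r|marks. F ((N \<omega>, \<lambda>i. X i \<omega>), r)))"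
      by (rule integral_joint[OF Fm F1])
    also have "\<dots> = expectation (\<lambda>\<omega>. \<Prod>j<n. 1 + v j \<omega>)"
    proof (intro Bochner_Integration.integral_cong refl)
      fix \<omega>
      have "(CLINT r|marks. F ((N \<omega>, \<lambda>i. X i \<omega>), r)) =
          (CLINT r|marks. (\<Prod>j<n. (\<lambda>j s. if enat j < N \<omega> then iexp (h (X j \<omega>, s)) else 1) j (r j)))"
        unfolding F_def fst_conv snd_conv ..
      also have "\<dots> = (\<Prod>j<n. CLINT s|\<nu>. if enat j < N \<omega> then iexp (h (X j \<omega>, s)) else 1)"
        by (rule mark.integral_iid_prod) auto
      also have "\<dots> = (\<Prod>j<n. 1 + v j \<omega>)"
        by (intro prod.cong refl) (auto simp: v_def u1 mark.prob_space)
      finally show "(CLINT r|marks. F ((N \<omega>, \<lambda>i. X i \<omega>), r)) = (\<Prod>j<n. 1 + v j \<omega>)" .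
    qed
    finally show ?thesis .
  qed
  define S2 where "S2 = (LINT x|lborel. (cmod (u x))\<^sup>2)"
  have v1_le: "norm (1 + v j \<omega>) \<le> 1" for j \<omega>
    using u1_le by (simp add: v_def)
  have Re_v: "Re (v j \<omega>) \<le> 0" for j \<omega>
    using Re_u by (simp add: v_def)
  have v_bound: "norm (v j \<omega>) \<le> 2" for j \<omega>
    using u2 by (simp add: v_def)
  \<comment> \<open>The partial sums of |u|^2 over the points are bounded by the full series, whose
    mean is \<open>k0 * S2\<close>; this is why n does not appear on the right.\<close>
  have ptbound: "norm (expectation (\<lambda>\<omega>. \<Prod>j<n. 1 + v j \<omega>) - expectation (\<lambda>\<omega>. exp (\<Sum>j<n. v j \<omega>))) \<le> exp 2 * k0 * S2" for n
  proof -
    have i1: "integrable M (\<lambda>\<omega>. \<Prod>j<n. 1 + v j \<omega>)"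
      by (rule integrable_const_bound[where B = 1]) (auto simp: prod_norm[symmetric] v1_le intro!: AE_I2 prod_le_1)
    have i2: "integrable M (\<lambda>\<omega>. exp (\<Sum>j<n. v j \<omega>))"
      by (rule integrable_const_bound[where B = 1]) (auto simp: Re_v intro!: AE_I2 sum_nonpos)
    have i3: "integrable M (\<lambda>\<omega>. \<Sum>j<n. (norm (v j \<omega>))\<^sup>2)"
    proof (intro Bochner_Integration.integrable_sum)
      have "(norm (v j \<omega>))\<^sup>2 \<le> 2\<^sup>2" for j \<omega>
        by (rule power_mono[OF v_bound norm_ge_zero])
      then show "integrable M (\<lambda>\<omega>. (norm (v j \<omega>))\<^sup>2)" for j
        by (intro integrable_const_bound[where B = "2\<^sup>2"]) auto
    qed
    have "norm (expectation (\<lambda>\<omega>. \<Prod>j<n. 1 + v j \<omega>) - expectation (\<lambda>\<omega>. exp (\<Sum>j<n. v j \<omega>))) =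
        norm (expectation (\<lambda>\<omega>. (\<Prod>j<n. 1 + v j \<omega>) - exp (\<Sum>j<n. v j \<omega>)))"
      using i1 i2 by simp
    also have "\<dots> \<le> expectation (\<lambda>\<omega>. norm ((\<Prod>j<n. 1 + v j \<omega>) - exp (\<Sum>j<n. v j \<omega>)))"
      by (rule integral_norm_bound)
    also have "\<dots> \<le> expectation (\<lambda>\<omega>. exp 2 * (\<Sum>j<n. (norm (v j \<omega>))\<^sup>2))"
      using i1 i2 i3 by (intro integral_mono norm_prod_one_plus_minus_exp_sum_le v1_le) auto
    also have "\<dots> = exp 2 * expectation (\<lambda>\<omega>. \<Sum>j<n. (norm (v j \<omega>))\<^sup>2)"
      by simp
    also have "expectation (\<lambda>\<omega>. \<Sum>j<n. (norm (v j \<omega>))\<^sup>2) \<le> k0 * S2"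
    proof -
      have "ennreal (expectation (\<lambda>\<omega>. \<Sum>j<n. (norm (v j \<omega>))\<^sup>2)) = (\<integral>\<^sup>+\<omega>. ennreal (\<Sum>j<n. (norm (v j \<omega>))\<^sup>2) \<partial>M)"
        using i3 by (intro nn_integral_eq_integral[symmetric]) (auto intro!: AE_I2 sum_nonneg)
      also have "\<dots> \<le> (\<integral>\<^sup>+\<omega>. (\<Sum>j. w j \<omega> * ennreal ((cmod (u (X j \<omega>)))\<^sup>2)) \<partial>M)"
      proof (rule nn_integral_mono)
        fix \<omega>
        have "ennreal (\<Sum>j<n. (norm (v j \<omega>))\<^sup>2) = (\<Sum>j<n. ennreal ((norm (v j \<omega>))\<^sup>2))"
          by (rule sum_ennreal[symmetric]) simp
        also have "\<dots> = (\<Sum>j<n. w j \<omega> * ennreal ((cmod (u (X j \<omega>)))\<^sup>2))"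
          by (intro sum.cong refl) (simp add: v_def w_def)
        also have "\<dots> \<le> (\<Sum>j. w j \<omega> * ennreal ((cmod (u (X j \<omega>)))\<^sup>2))"
          by (intro sum_le_suminf) auto
        finally show "ennreal (\<Sum>j<n. (norm (v j \<omega>))\<^sup>2) \<le> (\<Sum>j. w j \<omega> * ennreal ((cmod (u (X j \<omega>)))\<^sup>2))" .
      qed
      also have "\<dots> = ennreal k0 * (\<integral>\<^sup>+x. ennreal ((cmod (u x))\<^sup>2) \<partial>lborel)"
        by (rule campbell) measurable
      also have "\<dots> = ennreal (k0 * S2)"
        unfolding S2_def using u2_int by (simp add: nn_integral_eq_integral ennreal_mult k0_nonneg)
      finally show ?thesis
        using k0_nonneg by (subst (asm) ennreal_le_iff) (auto simp: S2_def)
    qed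
    finally show ?thesis by (simp add: mult.assoc)
  qed
  have lim1: "(\<lambda>n. expectation (\<lambda>\<omega>. \<Prod>j<n. e j \<omega>)) \<longlonglongrightarrow> expectation (\<lambda>\<omega>. iexp (\<Sum>j. if enat j < N \<omega> then h (X j \<omega>, R j \<omega>) else 0))"
  proof (rule integral_dominated_convergence[where w = "\<lambda>_. 1"])
    show "(\<lambda>\<omega>. iexp (\<Sum>j. if enat j < N \<omega> then h (X j \<omega>, R j \<omega>) else 0)) \<in> borel_measurable M"
      using XR by measurable
    show "AE \<omega> in M. (\<lambda>n. \<Prod>j<n. e j \<omega>) \<longlonglongrightarrow> iexp (\<Sum>j. if enat j < N \<omega> then h (X j \<omega>, R j \<omega>) else 0)"
      using AE_\<Phi>_summable[OF assms(1) fin]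
    proof eventually_elim
      case (elim \<omega>)
      let ?s = "\<lambda>i. if enat i < N \<omega> then h (X i \<omega>, R i \<omega>) else 0"
      have "(\<lambda>n. \<Sum>j<n. ?s j) \<longlonglongrightarrow> (\<Sum>j. ?s j)"
        by (rule summable_LIMSEQ[OF summable_rabs_cancel[OF elim[THEN conjunct1]]])
      then have "(\<lambda>n. iexp (\<Sum>j<n. ?s j)) \<longlonglongrightarrow> iexp (\<Sum>j. ?s j)"
        by (intro tendsto_intros)
      moreover have "iexp (\<Sum>j<n. ?s j) = (\<Prod>j<n. e j \<omega>)" for n
        unfolding of_real_sum sum_distrib_left exp_sum[OF finite_lessThan] by (intro prod.cong) (auto simp: e_def)
      ultimately show ?case by simp
    qed
    show "AE \<omega> in M. norm (\<Prod>j<n. e j \<omega>) \<le> 1" for n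
      by (intro AE_I2) (auto simp: prod_norm[symmetric] e_def intro!: prod_le_1)
  qed auto
  have lim2: "(\<lambda>n. expectation (\<lambda>\<omega>. exp (\<Sum>j<n. v j \<omega>))) \<longlonglongrightarrow> expectation (\<lambda>\<omega>. exp (point_sum u \<omega>))"
  proof (rule integral_dominated_convergence[where w = "\<lambda>_. 1"])
    show "AE \<omega> in M. (\<lambda>n. exp (\<Sum>j<n. v j \<omega>)) \<longlonglongrightarrow> exp (point_sum u \<omega>)"
      using AE_summable_point_sum[OF u_int]
    proof eventually_elim
      case (elim \<omega>)
      have "(\<lambda>n. \<Sum>j<n. v j \<omega>) \<longlonglongrightarrow> point_sum u \<omega>"
        unfolding point_sum_def v_def by (rule summable_LIMSEQ[OF summable_norm_cancel[OF elim]])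
      then show ?case by (rule tendsto_exp)
    qed
    show "AE \<omega> in M. norm (exp (\<Sum>j<n. v j \<omega>)) \<le> 1" for n
      by (intro AE_I2) (auto simp: Re_v intro!: sum_nonpos)
  qed auto
  have first: "norm (expectation (\<lambda>\<omega>. iexp (\<Sum>j. if enat j < N \<omega> then h (X j \<omega>, R j \<omega>) else 0)) - expectation (\<lambda>\<omega>. exp (point_sum u \<omega>))) \<le> exp 2 * k0 * S2"
  proof (rule LIMSEQ_le_const2)
    show "(\<lambda>n. norm (expectation (\<lambda>\<omega>. \<Prod>j<n. e j \<omega>) - expectation (\<lambda>\<omega>. exp (\<Sum>j<n. v j \<omega>)))) \<longlonglongrightarrow>
      norm (expectation (\<lambda>\<omega>. iexp (\<Sum>j. if enat j < N \<omega> then h (X j \<omega>, R j \<omega>) else 0)) - expectation (\<lambda>\<omega>. exp (point_sum u \<omega>)))"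
      by (intro tendsto_norm tendsto_diff lim1 lim2)
    show "\<exists>n0. \<forall>n\<ge>n0. norm (expectation (\<lambda>\<omega>. \<Prod>j<n. e j \<omega>) - expectation (\<lambda>\<omega>. exp (\<Sum>j<n. v j \<omega>))) \<le> exp 2 * k0 * S2"
      unfolding prod_eq using ptbound by blast
  qed
  \<comment> \<open>Both exponents lie in the left half-plane, so the exponentials differ by no more
    than the exponents do, and L1 concentration finishes the estimate.\<close>
  have second: "norm (expectation (\<lambda>\<omega>. exp (point_sum u \<omega>)) - exp (k0 * (CLINT x|lborel. u x))) \<le> 4 * sqrt ((k0 + \<kappa>) * S2)"
  proof -
    have Re_pu: "AE \<omega> in M. Re (point_sum u \<omega>) \<le> 0"
      using AE_summable_point_sum[OF u_int]
    proof eventually_elim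
      case (elim \<omega>)
      have sms: "(\<lambda>j. Re (v j \<omega>)) sums Re (point_sum u \<omega>)"
        unfolding point_sum_def v_def by (rule sums_Re[OF summable_sums[OF summable_norm_cancel[OF elim]]])
      show ?case by (rule sums_le[OF _ sms sums_zero]) (rule Re_v)
    qed
    have Re_int: "Re (k0 * (CLINT x|lborel. u x)) \<le> 0"
    proof -
      have "Re (CLINT x|lborel. u x) = (LINT x|lborel. Re (u x))"
        using u_int by (simp add: integral_Re)
      also have "\<dots> \<le> 0"
      proof -
        have "0 \<le> (LINT x|lborel. - Re (u x))"
          using Re_u by (intro Bochner_Integration.integral_nonneg) simp
        then show ?thesis by simp
      qed
      finally show ?thesis using k0_nonneg by (simp add: mult_nonneg_nonpos)
    qed
    note conc = concentration[OF u_int u2_int]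
    have i: "integrable M (\<lambda>\<omega>. exp (point_sum u \<omega>))"
      by (rule integrable_const_bound[where B = 1]) (use Re_pu in auto)
    have "norm (expectation (\<lambda>\<omega>. exp (point_sum u \<omega>)) - exp (k0 * (CLINT x|lborel. u x))) =
        norm (expectation (\<lambda>\<omega>. exp (point_sum u \<omega>) - exp (k0 * (CLINT x|lborel. u x))))"
      using i by (simp add: prob_space)
    also have "\<dots> \<le> expectation (\<lambda>\<omega>. norm (exp (point_sum u \<omega>) - exp (k0 * (CLINT x|lborel. u x))))"
      by (rule integral_norm_bound)
    also have "\<dots> \<le> expectation (\<lambda>\<omega>. norm (point_sum u \<omega> - k0 * (CLINT x|lborel. u x)))"
    proof (rule integral_mono_AE)
      show "AE \<omega> in M. norm (exp (point_sum u \<omega>) - exp (k0 * (CLINT x|lborel. u x))) \<le> norm (point_sum u \<omega> - k0 * (CLINT x|lborel. u x))"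
        using Re_pu by eventually_elim (rule norm_exp_diff_le[OF _ Re_int])
    qed (use i conc(1) in \<open>auto intro!: integrable_norm Bochner_Integration.integrable_diff\<close>)
    also have "\<dots> \<le> 4 * sqrt ((k0 + \<kappa>) * S2)"
      unfolding S2_def by (rule conc)
    finally show ?thesis .
  qed
  have E_eq: "expectation (\<lambda>\<omega>. iexp (LINT z|\<Phi> \<omega>. h z)) = expectation (\<lambda>\<omega>. iexp (\<Sum>j. if enat j < N \<omega> then h (X j \<omega>, R j \<omega>) else 0))"
  proof -
    have ae: "AE \<omega> in M. (LINT z|\<Phi> \<omega>. h z) = (\<Sum>j. if enat j < N \<omega> then h (X j \<omega>, R j \<omega>) else 0)"
      using AE_\<Phi>_summable[OF assms(1) fin] by eventually_elim simp
    have "(\<lambda>\<omega>. LINT z|\<Phi> \<omega>. h z) \<in> borel_measurable M"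
      by (rule integral_\<Phi>_measurable) measurable
    then have 1: "(\<lambda>\<omega>. iexp (LINT z|\<Phi> \<omega>. h z)) \<in> borel_measurable M"
      by measurable
    have 2: "(\<lambda>\<omega>. iexp (\<Sum>j. if enat j < N \<omega> then h (X j \<omega>, R j \<omega>) else 0)) \<in> borel_measurable M"
      using XR by measurable
    have "AE \<omega> in M. iexp (LINT z|\<Phi> \<omega>. h z) = iexp (\<Sum>j. if enat j < N \<omega> then h (X j \<omega>, R j \<omega>) else 0)"
      using ae by eventually_elim (rule arg_cong)
    then show ?thesis by (rule integral_cong_AE[OF 1 2])
  qed
  have "cmod (expectation (\<lambda>\<omega>. iexp (LINT z|\<Phi> \<omega>. h z)) - exp (k0 * (CLINT x|lborel. u x))) \<le>
      norm (expectation (\<lambda>\<omega>. iexp (\<Sum>j. if enat j < N \<omega> then h (X j \<omega>, R j \<omega>) else 0)) - expectation (\<lambda>\<omega>. exp (point_sum u \<omega>))) +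
      norm (expectation (\<lambda>\<omega>. exp (point_sum u \<omega>)) - exp (k0 * (CLINT x|lborel. u x)))"
    unfolding E_eq by (rule norm_diff_triangle_le[OF order_refl order_refl])
  also have "\<dots> \<le> exp 2 * k0 * S2 + 4 * sqrt ((k0 + \<kappa>) * S2)"
    by (rule add_mono[OF first second])
  finally show "cmod (expectation (\<lambda>\<omega>. iexp (LINT z|\<Phi> \<omega>. h z)) - exp (k0 * (CLINT x|lborel. u x))) \<le>
      exp 2 * k0 * (LINT x|lborel. (cmod (u x))\<^sup>2) + 4 * sqrt ((k0 + \<kappa>) * (LINT x|lborel. (cmod (u x))\<^sup>2))"
    unfolding S2_def .
qed

end

section \<open>Heavy-tailed radii and ball masses\<close>

lemma nn_integral_powr_from_0:
  assumes "e > -1"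
  shows "(\<integral>\<^sup>+r. ennreal (r powr e) * indicator {0..1::real} r \<partial>lborel) < \<infinity>"
proof -
  have "(\<integral>\<^sup>+r. ennreal (r powr e) * indicator {0..1} r \<partial>lborel) = (\<integral>\<^sup>+r. ennreal (indicator {0..1} r * r powr e) \<partial>lborel)"
    by (intro nn_integral_cong) (auto split: split_indicator)
  also have "\<dots> = ennreal (1 powr (e + 1) / (e + 1))"
  proof (rule nn_integral_has_integral_lborel)
    have "((\<lambda>r. if r \<in> {0..1} then r powr e else 0) has_integral (1 powr (e + 1) / (e + 1))) UNIV"
      unfolding has_integral_restrict_UNIV by (rule has_integral_powr_from_0[OF assms]) simp
    moreover have "(\<lambda>r. if r \<in> {0..1} then r powr e else 0) = (\<lambda>r. indicator {0..1} r * r powr e)"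
      by (auto simp: fun_eq_iff indicator_def)
    ultimately show "((\<lambda>r. indicator {0..1} r * r powr e) has_integral (1 powr (e + 1) / (e + 1))) UNIV" by simp
  qed auto
  finally show ?thesis by simp
qed

lemma nn_integral_powr_to_inf:
  assumes "e < -1"
  shows "(\<integral>\<^sup>+r. ennreal (r powr e) * indicator {1::real..} r \<partial>lborel) < \<infinity>"
proof -
  have "(\<integral>\<^sup>+r. ennreal (r powr e) * indicator {1..} r \<partial>lborel) = (\<integral>\<^sup>+r. ennreal (indicator {1..} r * r powr e) \<partial>lborel)"
    by (intro nn_integral_cong) (auto split: split_indicator)
  also have "\<dots> = ennreal (- (1 powr (e + 1)) / (e + 1))"
  proof (rule nn_integral_has_integral_lborel)
    have "((\<lambda>r. if r \<in> {1..} then r powr e else 0) has_integral (- (1 powr (e + 1)) / (e + 1))) UNIV"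
      unfolding has_integral_restrict_UNIV by (rule has_integral_powr_to_inf[OF assms]) simp
    moreover have "(\<lambda>r. if r \<in> {1..} then r powr e else 0) = (\<lambda>r. indicator {1..} r * r powr e)"
      by (auto simp: fun_eq_iff indicator_def)
    ultimately show "((\<lambda>r. indicator {1..} r * r powr e) has_integral (- (1 powr (e + 1)) / (e + 1))) UNIV" by simp
  qed auto
  finally show ?thesis by simp
qed

locale radius_density =
  fixes f :: "real \<Rightarrow> real" and \<beta> C\<^sub>0 :: real
  assumes f_measurable[measurable]: "f \<in> borel_measurable borel"
    and f_nonneg: "\<And>r. 0 \<le> f r" and f_neg: "\<And>r. r < 0 \<Longrightarrow> f r = 0"
    and f_prob: "(\<integral>\<^sup>+r. ennreal (f r) \<partial>lborel) = 1"
    and f_tail: "\<And>r. 0 \<le> r \<Longrightarrow> r powr (\<beta> + 1) * f r \<le> C\<^sub>0"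
begin

lemma C0_nonneg: "0 \<le> C\<^sub>0"
  using f_tail[of 1] f_nonneg[of 1] by simp

definition moment :: "real \<Rightarrow> ennreal" where
  "moment s = (\<integral>\<^sup>+r. ennreal (r powr s * f r) \<partial>lborel)"

text \<open>Below radius 1 the integrand is at most f, which has mass 1; beyond it the tail bound
  leaves \<open>C\<^sub>0\<close> times r^(s-\<beta>-1), integrable since s < \<beta>.\<close>

lemma moment_finite:
  assumes "0 < s" "s < \<beta>"
  shows "moment s < \<infinity>"
proof -
  have "moment s \<le> (\<integral>\<^sup>+r. ennreal (f r) + ennreal C\<^sub>0 * (ennreal (r powr (s - \<beta> - 1)) * indicator {1..} r) \<partial>lborel)"
    unfolding moment_def
  proof (rule nn_integral_mono)
    fix r :: real
    consider "r < 0" | "0 \<le> r" "r < 1" | "1 \<le> r" by linarith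
    then show "ennreal (r powr s * f r) \<le> ennreal (f r) + ennreal C\<^sub>0 * (ennreal (r powr (s - \<beta> - 1)) * indicator {1..} r)"
    proof cases
      case 1
      then show ?thesis by (simp add: f_neg)
    next
      case 2
      then have "r powr s \<le> 1" using assms by (intro powr_le1) auto
      then have "r powr s * f r \<le> 1 * f r" by (rule mult_right_mono) (rule f_nonneg)
      then show ?thesis using 2 by (simp add: ennreal_leI)
    next
      case 3
      have "r powr s * f r = r powr (s - \<beta> - 1) * (r powr (\<beta> + 1) * f r)"
        by (simp add: mult.assoc[symmetric] powr_add[symmetric])
      also have "\<dots> \<le> r powr (s - \<beta> - 1) * C\<^sub>0"
        using 3 by (intro mult_left_mono f_tail) auto
      finally have "ennreal (r powr s * f r) \<le> ennreal C\<^sub>0 * ennreal (r powr (s - \<beta> - 1))"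
        using C0_nonneg by (simp add: ennreal_mult[symmetric] mult.commute ennreal_leI)
      then show ?thesis using 3 by (simp add: add_increasing)
    qed
  qed
  also have "\<dots> = 1 + ennreal C\<^sub>0 * (\<integral>\<^sup>+r. ennreal (r powr (s - \<beta> - 1)) * indicator {1..} r \<partial>lborel)"
    by (simp add: nn_integral_add nn_integral_cmult f_prob)
  also have "\<dots> < \<infinity>"
    using nn_integral_powr_to_inf[of "s - \<beta> - 1"] assms by (simp add: ennreal_mult_less_top)
  finally show ?thesis .
qed

lemma sets_mark_law[measurable_cong]: "sets (mark_law f \<rho>) = sets borel"
  by (simp add: mark_law_def)

lemma nn_integral_mark_law:
  assumes "\<rho> > 0" and [measurable]: "g \<in> borel_measurable borel"
  shows "(\<integral>\<^sup>+r. g r \<partial>mark_law f \<rho>) = (\<integral>\<^sup>+r. g r * ennreal (f (r / \<rho>) / \<rho>) \<partial>lborel)"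
  unfolding mark_law_def by (subst nn_integral_density) (auto simp: mult.commute)

lemma nn_integral_mark_law_scale:
  assumes "\<rho> > 0" and [measurable]: "g \<in> borel_measurable borel"
  shows "(\<integral>\<^sup>+r. g r \<partial>mark_law f \<rho>) = (\<integral>\<^sup>+r. g (\<rho> * r) * ennreal (f r) \<partial>lborel)"
proof -
  have "(\<integral>\<^sup>+r. g r \<partial>mark_law f \<rho>) = ennreal \<bar>\<rho>\<bar> * (\<integral>\<^sup>+r. g (0 + \<rho> * r) * ennreal (f ((0 + \<rho> * r) / \<rho>) / \<rho>) \<partial>lborel)"
    unfolding nn_integral_mark_law[OF assms] using assms by (intro nn_integral_real_affine) auto
  also have "\<dots> = (\<integral>\<^sup>+r. ennreal \<rho> * (g (\<rho> * r) * ennreal (f r / \<rho>)) \<partial>lborel)"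
    using assms by (subst nn_integral_cmult) auto
  also have "\<dots> = (\<integral>\<^sup>+r. g (\<rho> * r) * ennreal (f r) \<partial>lborel)"
  proof (rule nn_integral_cong)
    fix r
    have "ennreal (f r) = ennreal \<rho> * ennreal (f r / \<rho>)"
      using assms f_nonneg by (subst ennreal_mult[symmetric]) auto
    then show "ennreal \<rho> * (g (\<rho> * r) * ennreal (f r / \<rho>)) = g (\<rho> * r) * ennreal (f r)"
      by (simp add: ac_simps)
  qed
  finally show ?thesis .
qed

lemma prob_space_mark_law:
  assumes "\<rho> > 0"
  shows "prob_space (mark_law f \<rho>)"
proof
  have "emeasure (mark_law f \<rho>) (space (mark_law f \<rho>)) = (\<integral>\<^sup>+r. 1 \<partial>mark_law f \<rho>)" by simp
  also have "\<dots> = 1"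
    using assms by (subst nn_integral_mark_law_scale) (auto simp: f_prob)
  finally show "emeasure (mark_law f \<rho>) (space (mark_law f \<rho>)) = 1" .
qed

text \<open>A mark at scale \<rho> is \<rho> times a mark with density f.\<close>

lemma mark_moment:
  assumes "\<rho> > 0"
  shows "(\<integral>\<^sup>+r. ennreal (r powr s) \<partial>mark_law f \<rho>) = ennreal (\<rho> powr s) * moment s"
proof -
  have "(\<integral>\<^sup>+r. ennreal (r powr s) \<partial>mark_law f \<rho>) = (\<integral>\<^sup>+r. ennreal ((\<rho> * r) powr s) * ennreal (f r) \<partial>lborel)"
    using assms by (subst nn_integral_mark_law_scale) auto
  also have "\<dots> = (\<integral>\<^sup>+r. ennreal (\<rho> powr s) * ennreal (r powr s * f r) \<partial>lborel)"
  proof (rule nn_integral_cong)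
    fix r :: real
    show "ennreal ((\<rho> * r) powr s) * ennreal (f r) = ennreal (\<rho> powr s) * ennreal (r powr s * f r)"
    proof (cases "r < 0")
      case True
      then show ?thesis by (simp add: f_neg)
    next
      case False
      then show ?thesis
        using assms f_nonneg by (simp add: powr_mult ennreal_mult mult.assoc)
    qed
  qed
  finally show ?thesis unfolding moment_def by (simp add: nn_integral_cmult)
qed

lemma AE_mark_law_pos:
  assumes "\<rho> > 0"
  shows "AE r in mark_law f \<rho>. 0 < r"
proof -
  have "AE r in lborel. r \<noteq> (0::real)" by (rule AE_lborel_singleton)
  then have "AE r in lborel. 0 < ennreal (f (r / \<rho>) / \<rho>) \<longrightarrow> 0 < r"
  proof eventually_elim
    case (elim r)
    show ?case
    proof (intro impI)
      assume "0 < ennreal (f (r / \<rho>) / \<rho>)"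
      then have "f (r / \<rho>) \<noteq> 0" by auto
      then have "\<not> r / \<rho> < 0" using f_neg by blast
      then have "0 \<le> r" using assms by (simp add: not_less zero_le_divide_iff)
      with elim show "0 < r" by simp
    qed
  qed
  then show ?thesis unfolding mark_law_def by (subst AE_density) auto
qed

text \<open>Multiplied by \<lambda>(\<rho>), the right side involves \<rho> only through the
  convergent factor \<lambda>(\<rho>) \<rho>^\<beta>. This is the domination behind the limit of the
  exponents.\<close>

lemma density_bound:
  assumes "\<rho> > 0" "r > 0"
  shows "f (r / \<rho>) / \<rho> \<le> C\<^sub>0 * \<rho> powr \<beta> * r powr (- \<beta> - 1)"
proof -
  have "f (r / \<rho>) = (r / \<rho>) powr (- \<beta> - 1) * ((r / \<rho>) powr (\<beta> + 1) * f (r / \<rho>))"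
    using assms by (simp add: mult.assoc[symmetric] powr_add[symmetric])
  also have "\<dots> \<le> (r / \<rho>) powr (- \<beta> - 1) * C\<^sub>0"
    using assms by (intro mult_left_mono f_tail) auto
  finally have "f (r / \<rho>) / \<rho> \<le> (r / \<rho>) powr (- \<beta> - 1) * C\<^sub>0 / \<rho>"
    using assms by (intro divide_right_mono) auto
  also have "(r / \<rho>) powr (- \<beta> - 1) * C\<^sub>0 / \<rho> = C\<^sub>0 * \<rho> powr \<beta> * r powr (- \<beta> - 1)"
  proof -
    have "(r / \<rho>) powr (- \<beta> - 1) = r powr (- \<beta> - 1) * \<rho> powr (\<beta> + 1)"
      using assms by (simp add: powr_divide powr_minus_divide[of \<rho> "\<beta> + 1", symmetric] field_simps flip: powr_minus)
        (simp add: powr_minus field_simps powr_add[symmetric])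
    moreover have "\<rho> powr (\<beta> + 1) = \<rho> powr \<beta> * \<rho>"
      using assms by (simp add: powr_add)
    ultimately show ?thesis using assms by simp
  qed
  finally show ?thesis .
qed

text \<open>Cauchy-Schwarz in the radius after inserting r^(-s/2) r^(s/2): one factor is the moment
  of order s, the other becomes one of order q - s once the position is integrated out. A direct use
  of the second moment of \<open>h\<close> would need the moment of order q > \<beta>; splitting the
  order avoids this.\<close>

lemma square_mark_mean_le:
  fixes h :: "'a::euclidean_space \<times> real \<Rightarrow> real"
  assumes [measurable]: "h \<in> borel_measurable borel"
    and h2: "\<And>r. 0 < r \<Longrightarrow> (\<integral>\<^sup>+x. ennreal ((h (x, r))\<^sup>2) \<partial>lborel) \<le> ennreal (C * r powr q)"
    and "0 \<le> C" "\<rho> > 0"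
  shows "(\<integral>\<^sup>+x. (\<integral>\<^sup>+r. ennreal \<bar>h (x, r)\<bar> \<partial>mark_law f \<rho>)\<^sup>2 \<partial>lborel) \<le>
    ennreal C * moment s * moment (q - s) * ennreal (\<rho> powr q)"
proof -
  interpret mark: prob_space "mark_law f \<rho>" by (rule prob_space_mark_law) fact
  interpret pair_sigma_finite "lborel :: 'a measure" "mark_law f \<rho>" ..
  have [measurable]: "h \<in> borel_measurable (borel \<Otimes>\<^sub>M borel)" using assms(1) by (simp add: borel_prod)
  have p2: "(r powr (t / 2))\<^sup>2 = r powr t" for r t :: real
    by (simp add: power2_eq_square flip: powr_add)
  have e1: "(ennreal (r powr (s / 2)))\<^sup>2 = ennreal (r powr s)" for r
    by (subst ennreal_power) (simp_all only: p2 powr_ge_zero)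
  have e2: "(ennreal (\<bar>y\<bar> * r powr (- s / 2)))\<^sup>2 = ennreal (y\<^sup>2 * r powr (- s))" for y r
    by (subst ennreal_power) (simp_all only: p2 powr_ge_zero power_mult_distrib power2_abs zero_le_mult_iff abs_ge_zero simp_thms)
  have CS: "(\<integral>\<^sup>+r. ennreal \<bar>h (x, r)\<bar> \<partial>mark_law f \<rho>)\<^sup>2 \<le>
      (\<integral>\<^sup>+r. ennreal ((h (x, r))\<^sup>2 * r powr (- s)) \<partial>mark_law f \<rho>) * (ennreal (\<rho> powr s) * moment s)" for x
  proof -
    \<comment> \<open>The two powers multiply to 1 only for r > 0, hence the appeal to almost sure
      positivity of the mark.\<close>
    have eq: "(\<integral>\<^sup>+r. ennreal \<bar>h (x, r)\<bar> \<partial>mark_law f \<rho>) =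
        (\<integral>\<^sup>+r. ennreal (\<bar>h (x, r)\<bar> * r powr (- s / 2)) * ennreal (r powr (s / 2)) \<partial>mark_law f \<rho>)"
    proof (intro nn_integral_cong_AE, use AE_mark_law_pos[OF \<open>\<rho> > 0\<close>] in eventually_elim)
      case (elim r)
      have "r powr (- s / 2) * r powr (s / 2) = 1"
        using elim by (simp add: powr_add[symmetric])
      then show ?case by (simp add: ennreal_mult[symmetric] mult.assoc)
    qed
    have "(\<integral>\<^sup>+r. ennreal (\<bar>h (x, r)\<bar> * r powr (- s / 2)) * ennreal (r powr (s / 2)) \<partial>mark_law f \<rho>)\<^sup>2 \<le>
        (\<integral>\<^sup>+r. (ennreal (\<bar>h (x, r)\<bar> * r powr (- s / 2)))\<^sup>2 \<partial>mark_law f \<rho>) *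
        (\<integral>\<^sup>+r. (ennreal (r powr (s / 2)))\<^sup>2 \<partial>mark_law f \<rho>)"
      by (rule Cauchy_Schwarz_nn_integral) measurable
    then show ?thesis unfolding eq e1 e2 mark_moment[OF \<open>\<rho> > 0\<close>] .
  qed
  have "(\<integral>\<^sup>+x. (\<integral>\<^sup>+r. ennreal \<bar>h (x, r)\<bar> \<partial>mark_law f \<rho>)\<^sup>2 \<partial>lborel) \<le>
      (\<integral>\<^sup>+x. (\<integral>\<^sup>+r. ennreal ((h (x, r))\<^sup>2 * r powr (- s)) \<partial>mark_law f \<rho>) * (ennreal (\<rho> powr s) * moment s) \<partial>lborel)"
    by (intro nn_integral_mono CS)
  also have "\<dots> = (\<integral>\<^sup>+x. (\<integral>\<^sup>+r. ennreal ((h (x, r))\<^sup>2 * r powr (- s)) \<partial>mark_law f \<rho>) \<partial>lborel) * (ennreal (\<rho> powr s) * moment s)"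
    by (rule nn_integral_multc) measurable
  also have "(\<integral>\<^sup>+x. (\<integral>\<^sup>+r. ennreal ((h (x, r))\<^sup>2 * r powr (- s)) \<partial>mark_law f \<rho>) \<partial>lborel) =
      (\<integral>\<^sup>+r. (\<integral>\<^sup>+x. ennreal ((h (x, r))\<^sup>2 * r powr (- s)) \<partial>lborel) \<partial>mark_law f \<rho>)"
    by (rule Fubini'[symmetric]) measurable
  also have "\<dots> \<le> (\<integral>\<^sup>+r. ennreal C * ennreal (r powr (q - s)) \<partial>mark_law f \<rho>)"
  proof (intro nn_integral_mono_AE, use AE_mark_law_pos[OF \<open>\<rho> > 0\<close>] in eventually_elim)
    case (elim r)
    have "(\<integral>\<^sup>+x. ennreal ((h (x, r))\<^sup>2 * r powr (- s)) \<partial>lborel) = (\<integral>\<^sup>+x. ennreal ((h (x, r))\<^sup>2) \<partial>lborel) * ennreal (r powr (- s))"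
      by (simp add: ennreal_mult nn_integral_multc)
    also have "\<dots> \<le> ennreal (C * r powr q) * ennreal (r powr (- s))"
      by (intro mult_right_mono h2 elim) simp
    also have "\<dots> = ennreal C * ennreal (r powr (q - s))"
      using \<open>0 \<le> C\<close> by (simp add: ennreal_mult[symmetric] mult.assoc powr_add[symmetric])
    finally show ?case .
  qed
  also have "\<dots> = ennreal C * (ennreal (\<rho> powr (q - s)) * moment (q - s))"
    by (simp add: nn_integral_cmult mark_moment[OF \<open>\<rho> > 0\<close>])
  finally have "(\<integral>\<^sup>+x. (\<integral>\<^sup>+r. ennreal \<bar>h (x, r)\<bar> \<partial>mark_law f \<rho>)\<^sup>2 \<partial>lborel) \<le>
      ennreal C * (ennreal (\<rho> powr (q - s)) * moment (q - s)) * (ennreal (\<rho> powr s) * moment s)"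
    by (simp add: mult_right_mono)
  also have "\<dots> = ennreal C * moment s * moment (q - s) * (ennreal (\<rho> powr (q - s)) * ennreal (\<rho> powr s))"
    by (simp add: ac_simps)
  also have "ennreal (\<rho> powr (q - s)) * ennreal (\<rho> powr s) = ennreal (\<rho> powr q)"
    by (simp add: ennreal_mult[symmetric] powr_add[symmetric])
  finally show ?thesis .
qed

end

text \<open>Near 0 the bound r^q beats r^(-\<beta>-1) because q > \<beta>, and at infinity r^p does
  because p < \<beta>. The second form, written against Lebesgue measure, serves as dominating
  function for the limit of the exponents.\<close>

lemma square_integrable_limit_intensity:
  fixes h :: "'a::euclidean_space \<times> real \<Rightarrow> real"
  assumes [measurable]: "h \<in> borel_measurable borel"
    and h2: "\<And>r. 0 < r \<Longrightarrow> (\<integral>\<^sup>+x. ennreal ((h (x, r))\<^sup>2) \<partial>lborel) \<le> ennreal (C * min (r powr p) (r powr q))"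
    and "0 \<le> C" "0 \<le> c" "p < \<beta>" "\<beta> < q"
  shows "integrable (limit_intensity c \<beta>) (\<lambda>z. (h z)\<^sup>2)"
    and "integrable lborel (\<lambda>z. (h z)\<^sup>2 * (c * snd z powr (- \<beta> - 1)) * indicator {0<..} (snd z))"
proof -
  have hm[measurable]: "h \<in> borel_measurable (borel \<Otimes>\<^sub>M borel)" using assms(1) by (simp add: borel_prod)
  let ?d = "\<lambda>r. ennreal (c * r powr (- \<beta> - 1)) * indicator {0<..} r"
  have dm: "(\<lambda>(x::'a, r). ?d r) \<in> borel_measurable lborel"
  proof -
    have "(\<lambda>(x::'a, r). ?d r) \<in> borel_measurable (borel \<Otimes>\<^sub>M borel)" by measurable
    then show ?thesis by (simp add: borel_prod)
  qed
  have "(\<integral>\<^sup>+z. ennreal ((h z)\<^sup>2) * ?d (snd z) \<partial>lborel) = (\<integral>\<^sup>+z. ennreal ((h z)\<^sup>2) * ?d (snd z) \<partial>(lborel \<Otimes>\<^sub>M lborel))"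
    by (simp add: lborel_prod)
  also have "\<dots> = (\<integral>\<^sup>+r. (\<integral>\<^sup>+x. ennreal ((h (x, r))\<^sup>2) * ?d r \<partial>lborel) \<partial>lborel)"
    by (subst lborel_pair.nn_integral_snd[symmetric]) (auto simp: split_beta')
  also have "\<dots> = (\<integral>\<^sup>+r. (\<integral>\<^sup>+x. ennreal ((h (x, r))\<^sup>2) \<partial>lborel) * ?d r \<partial>lborel)"
    by (intro nn_integral_cong nn_integral_multc) measurable
  also have "\<dots> \<le> (\<integral>\<^sup>+r. ennreal (C * c) * (ennreal (r powr (q - \<beta> - 1)) * indicator {0..1} r + ennreal (r powr (p - \<beta> - 1)) * indicator {1..} r) \<partial>lborel)"
  proof (rule nn_integral_mono)
    fix r :: real
    show "(\<integral>\<^sup>+x. ennreal ((h (x, r))\<^sup>2) \<partial>lborel) * ?d r \<le>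
      ennreal (C * c) * (ennreal (r powr (q - \<beta> - 1)) * indicator {0..1} r + ennreal (r powr (p - \<beta> - 1)) * indicator {1..} r)"
    proof (cases "0 < r")
      case True
      \<comment> \<open>The exponent e stands for q at radii up to 1 and for p beyond.\<close>
      have le: "(\<integral>\<^sup>+x. ennreal ((h (x, r))\<^sup>2) \<partial>lborel) * ?d r \<le> ennreal (C * c) * ennreal (r powr (e - \<beta> - 1))"
        if "min (r powr p) (r powr q) \<le> r powr e" for e
      proof -
        have "(\<integral>\<^sup>+x. ennreal ((h (x, r))\<^sup>2) \<partial>lborel) * ?d r \<le> ennreal (C * r powr e) * ennreal (c * r powr (- \<beta> - 1))"
        proof (intro mult_mono)
          show "(\<integral>\<^sup>+x. ennreal ((h (x, r))\<^sup>2) \<partial>lborel) \<le> ennreal (C * r powr e)"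
            using that \<open>0 \<le> C\<close> by (intro order_trans[OF h2[OF True]] ennreal_leI mult_left_mono)
          show "?d r \<le> ennreal (c * r powr (- \<beta> - 1))" by (simp split: split_indicator)
        qed auto
        also have "\<dots> = ennreal (C * c) * ennreal (r powr (e - \<beta> - 1))"
        proof -
          have "r powr e * r powr (- \<beta> - 1) = r powr (e - \<beta> - 1)"
            by (simp add: powr_add[symmetric] algebra_simps)
          then have "(C * r powr e) * (c * r powr (- \<beta> - 1)) = (C * c) * r powr (e - \<beta> - 1)"
            by (metis mult.assoc mult.left_commute)
          then show ?thesis
            using \<open>0 \<le> C\<close> \<open>0 \<le> c\<close> by (simp add: ennreal_mult[symmetric] del: mult_eq_0_iff)
        qed
        finally show ?thesis .
      qed
      show ?thesis
      proof (cases "r \<le> 1")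
        case r1: True
        have "(\<integral>\<^sup>+x. ennreal ((h (x, r))\<^sup>2) \<partial>lborel) * ?d r \<le> ennreal (C * c) * ennreal (r powr (q - \<beta> - 1))"
          by (rule le) simp
        also have "\<dots> \<le> ennreal (C * c) * (ennreal (r powr (q - \<beta> - 1)) * indicator {0..1} r + ennreal (r powr (p - \<beta> - 1)) * indicator {1..} r)"
          using True r1 by (intro mult_left_mono) auto
        finally show ?thesis .
      next
        case r1: False
        have "(\<integral>\<^sup>+x. ennreal ((h (x, r))\<^sup>2) \<partial>lborel) * ?d r \<le> ennreal (C * c) * ennreal (r powr (p - \<beta> - 1))"
          by (rule le) simp
        also have "\<dots> \<le> ennreal (C * c) * (ennreal (r powr (q - \<beta> - 1)) * indicator {0..1} r + ennreal (r powr (p - \<beta> - 1)) * indicator {1..} r)"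
          using True r1 by (intro mult_left_mono) auto
        finally show ?thesis .
      qed
    qed simp
  qed
  also have "\<dots> = ennreal (C * c) * ((\<integral>\<^sup>+r. ennreal (r powr (q - \<beta> - 1)) * indicator {0..1} r \<partial>lborel) +
      (\<integral>\<^sup>+r. ennreal (r powr (p - \<beta> - 1)) * indicator {1..} r \<partial>lborel))"
    by (simp add: nn_integral_add nn_integral_cmult)
  also have "\<dots> < \<infinity>"
    using nn_integral_powr_from_0[of "q - \<beta> - 1"] nn_integral_powr_to_inf[of "p - \<beta> - 1"] assms(5,6)
    by (simp add: ennreal_mult_less_top)
  finally have fin: "(\<integral>\<^sup>+z. ennreal ((h z)\<^sup>2) * ?d (snd z) \<partial>lborel) < \<infinity>" .
  show "integrable (limit_intensity c \<beta>) (\<lambda>z. (h z)\<^sup>2)"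
  proof (rule integrableI_bounded)
    have "(\<integral>\<^sup>+z. ennreal (norm ((h z)\<^sup>2)) \<partial>limit_intensity c \<beta>) = (\<integral>\<^sup>+z. ennreal ((h z)\<^sup>2) * ?d (snd z) \<partial>lborel)"
      unfolding limit_intensity_def using dm
      by (subst nn_integral_density) (auto simp: split_beta' mult.commute)
    then show "(\<integral>\<^sup>+z. ennreal (norm ((h z)\<^sup>2)) \<partial>limit_intensity c \<beta>) < \<infinity>" using fin by simp
  qed (simp add: limit_intensity_def)
  show "integrable lborel (\<lambda>z. (h z)\<^sup>2 * (c * snd z powr (- \<beta> - 1)) * indicator {0<..} (snd z))"
  proof (rule integrableI_bounded)
    have "(\<lambda>z. (h z)\<^sup>2 * (c * snd z powr (- \<beta> - 1)) * indicator {0<..} (snd z)) \<in> borel_measurable (borel \<Otimes>\<^sub>M borel)"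
      by measurable
    then show "(\<lambda>z. (h z)\<^sup>2 * (c * snd z powr (- \<beta> - 1)) * indicator {0<..} (snd z)) \<in> borel_measurable lborel"
      by (simp add: borel_prod)
    have "ennreal (norm ((h z)\<^sup>2 * (c * snd z powr (- \<beta> - 1)) * indicator {0<..} (snd z))) = ennreal ((h z)\<^sup>2) * ?d (snd z)" for z
      using \<open>0 \<le> c\<close> by (auto simp: abs_mult ennreal_mult split: split_indicator)
    then show "(\<integral>\<^sup>+z. ennreal (norm ((h z)\<^sup>2 * (c * snd z powr (- \<beta> - 1)) * indicator {0<..} (snd z))) \<partial>lborel) < \<infinity>"
      using fin by simp
  qed
qed

text \<open>Scaling space and radius together gives a^(d+1) from Lebesgue measure and a^(-\<beta>-1)
  from the density in r; their product is a^(d-\<beta>). In this form the limit intensity absorbs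
  the limit of \<lambda>(\<rho>) \<rho>^\<beta>.\<close>

lemma limit_intensity_scale:
  fixes a c \<beta> :: real
  assumes "a > 0"
  shows "distr (limit_intensity c \<beta> :: ('a::euclidean_space \<times> real) measure) borel (\<lambda>z. inverse a *\<^sub>R z) =
    density (limit_intensity c \<beta>) (\<lambda>_. ennreal (a powr (real DIM('a) - \<beta>)))"
proof (rule measure_eqI)
  let ?d = "\<lambda>z::'a \<times> real. ennreal (c * snd z powr (- \<beta> - 1)) * indicator {0<..} (snd z)"
  have dm[measurable]: "?d \<in> borel_measurable borel"
  proof -
    have "?d \<in> borel_measurable (borel \<Otimes>\<^sub>M borel)" by measurable
    then show ?thesis by (simp add: borel_prod)
  qed
  have L: "limit_intensity c \<beta> = density lborel ?d"
    by (simp add: limit_intensity_def split_beta')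
  fix B :: "('a \<times> real) set"
  assume "B \<in> sets (distr (limit_intensity c \<beta>) borel (\<lambda>z. inverse a *\<^sub>R z))"
  then have B[measurable]: "B \<in> sets borel" by simp
  have "emeasure (distr (limit_intensity c \<beta>) borel (\<lambda>z. inverse a *\<^sub>R z)) B =
      (\<integral>\<^sup>+z. indicator B z \<partial>distr (limit_intensity c \<beta>) borel (\<lambda>z. inverse a *\<^sub>R z))"
    by simp
  also have "\<dots> = (\<integral>\<^sup>+z. indicator B (inverse a *\<^sub>R z) \<partial>limit_intensity c \<beta>)"
    by (rule nn_integral_distr) (auto simp: L)
  also have "\<dots> = (\<integral>\<^sup>+z. ?d z * indicator B (inverse a *\<^sub>R z) \<partial>lborel)"
    unfolding L by (rule nn_integral_density) auto
  also have "\<dots> = (\<integral>\<^sup>+z. ?d z * indicator B (inverse a *\<^sub>R z)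
      \<partial>density (distr lborel borel (\<lambda>z. 0 + a *\<^sub>R z)) (\<lambda>_. ennreal (\<bar>a\<bar> ^ DIM('a \<times> real))))"
    using lborel_affine[of a "0 :: 'a \<times> real"] assms by simp
  also have "\<dots> = (\<integral>\<^sup>+z. ennreal (\<bar>a\<bar> ^ DIM('a \<times> real)) * (?d (a *\<^sub>R z) * indicator B (inverse a *\<^sub>R a *\<^sub>R z)) \<partial>lborel)"
    by (subst nn_integral_density) (auto simp: nn_integral_distr)
  also have "\<dots> = (\<integral>\<^sup>+z. ennreal (a powr (real DIM('a) - \<beta>)) * (?d z * indicator B z) \<partial>lborel)"
  proof (rule nn_integral_cong)
    fix z :: "'a \<times> real"
    have "ennreal (\<bar>a\<bar> ^ DIM('a \<times> real)) * ?d (a *\<^sub>R z) = ennreal (a powr (real DIM('a) - \<beta>)) * ?d z"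
    proof (cases "0 < snd z")
      case True
      have "\<bar>a\<bar> ^ DIM('a \<times> real) = a powr (real DIM('a) + 1)"
        using assms powr_realpow[of a "DIM('a) + 1"] by (simp add: add.commute)
      moreover have "c * (a * snd z) powr (- \<beta> - 1) = a powr (- \<beta> - 1) * (c * snd z powr (- \<beta> - 1))"
        using assms True by (simp add: powr_mult)
      moreover have "a powr (real DIM('a) + 1) * a powr (- \<beta> - 1) = a powr (real DIM('a) - \<beta>)"
        by (simp add: powr_add[symmetric])
      ultimately have "\<bar>a\<bar> ^ DIM('a \<times> real) * (c * (a * snd z) powr (- \<beta> - 1)) =
          a powr (real DIM('a) - \<beta>) * (c * snd z powr (- \<beta> - 1))"
        by (simp only: mult.assoc[symmetric])
      then have "ennreal (\<bar>a\<bar> ^ DIM('a \<times> real)) * ennreal (c * (a * snd z) powr (- \<beta> - 1)) =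
          ennreal (a powr (real DIM('a) - \<beta>)) * ennreal (c * snd z powr (- \<beta> - 1))"
        by (simp only: ennreal_mult'[symmetric] zero_le_power abs_ge_zero powr_ge_zero)
      then show ?thesis
        using assms True by simp
    next
      case False
      then show ?thesis using assms by (simp add: zero_less_mult_iff)
    qed
    then show "ennreal (\<bar>a\<bar> ^ DIM('a \<times> real)) * (?d (a *\<^sub>R z) * indicator B (inverse a *\<^sub>R a *\<^sub>R z)) =
        ennreal (a powr (real DIM('a) - \<beta>)) * (?d z * indicator B z)"
      using assms by (simp add: mult.assoc[symmetric])
  qed
  also have "\<dots> = (\<integral>\<^sup>+z. ?d z * (ennreal (a powr (real DIM('a) - \<beta>)) * indicator B z) \<partial>lborel)"
    by (intro nn_integral_cong) (simp add: ac_simps)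
  also have "\<dots> = (\<integral>\<^sup>+z. ennreal (a powr (real DIM('a) - \<beta>)) * indicator B z \<partial>density lborel ?d)"
    by (rule nn_integral_density[symmetric]) auto
  also have "\<dots> = emeasure (density (limit_intensity c \<beta>) (\<lambda>_. ennreal (a powr (real DIM('a) - \<beta>)))) B"
    unfolding L by (rule emeasure_density[symmetric]) auto
  finally show "emeasure (distr (limit_intensity c \<beta>) borel (\<lambda>z. inverse a *\<^sub>R z)) B =
      emeasure (density (limit_intensity c \<beta>) (\<lambda>_. ennreal (a powr (real DIM('a) - \<beta>)))) B" .
qed (simp add: limit_intensity_def)

section \<open>Ball masses and admissible measures\<close>

lemma ball_mass_nonneg: "0 \<le> ball_mass \<mu> z"
  by (simp add: ball_mass_def split_beta')

text \<open>The relation "y lies in the closed ball around x of radius r" is closed in (x, r, y),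
  and the measure of its sections depends measurably on (x, r).\<close>

lemma ball_mass_measurable:
  fixes \<mu> :: "'a::euclidean_space measure"
  assumes \<mu>: "sets \<mu> = sets borel" "finite_measure \<mu>"
  shows "ball_mass \<mu> \<in> borel_measurable borel"
proof -
  interpret finite_measure \<mu> by fact
  have "closed {p :: ('a \<times> real) \<times> 'a. dist (fst (fst p)) (snd p) \<le> snd (fst p)}"
    by (intro closed_Collect_le continuous_intros)
  then have "{p :: ('a \<times> real) \<times> 'a. dist (fst (fst p)) (snd p) \<le> snd (fst p)} \<in> sets (borel \<Otimes>\<^sub>M \<mu>)"
    unfolding sets_pair_measure_cong[OF refl \<mu>(1), of borel]
    unfolding borel_prod by (rule borel_closed)
  then have "(\<lambda>z. emeasure \<mu> (Pair z -` {p :: ('a \<times> real) \<times> 'a. dist (fst (fst p)) (snd p) \<le> snd (fst p)})) \<in> borel_measurable borel"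
    by (rule measurable_emeasure_Pair)
  then have "(\<lambda>z. enn2real (emeasure \<mu> (cball (fst z) (snd z)))) \<in> borel_measurable borel"
    by (simp add: vimage_def cball_def)
  then show ?thesis by (simp add: ball_mass_def measure_def split_beta')
qed

text \<open>The preimage of a ball under scaling by \<open>a\<close> is the ball with centre and
  radius divided by \<open>a\<close>, so dilating the measure amounts to scaling both
  arguments.\<close>

lemma ball_mass_dilatation:
  fixes \<mu> :: "'a::euclidean_space measure"
  assumes "sets \<mu> = sets borel" "a > 0"
  shows "ball_mass (dilatation a \<mu>) z = ball_mass \<mu> (inverse a *\<^sub>R z)"
proof -
  have "(\<lambda>x. a *\<^sub>R x) -` cball (fst z) (snd z) = cball (inverse a *\<^sub>R fst z) (inverse a * snd z)"
  proof (intro Set.set_eqI)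
    fix x
    have "dist (inverse a *\<^sub>R fst z) x = inverse a * dist (fst z) (a *\<^sub>R x)"
    proof -
      have "inverse a *\<^sub>R fst z - x = inverse a *\<^sub>R (fst z - a *\<^sub>R x)"
        using assms(2) by (simp add: scaleR_diff_right)
      then show ?thesis using assms(2) by (simp add: dist_norm)
    qed
    then show "x \<in> (\<lambda>x. a *\<^sub>R x) -` cball (fst z) (snd z) \<longleftrightarrow> x \<in> cball (inverse a *\<^sub>R fst z) (inverse a * snd z)"
      using assms(2) by simp
  qed
  moreover have "space \<mu> = UNIV" using sets_eq_imp_space_eq[OF assms(1)] by simp
  moreover have "(\<lambda>x. a *\<^sub>R x) \<in> measurable \<mu> borel"
    using assms(1) by (simp cong: measurable_cong_sets)
  ultimately show ?thesis
    by (simp add: ball_mass_def dilatation_def split_beta' measure_distr)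
qed

text \<open>By Fubini and symmetry of the distance, each unit of mass is counted with the volume of
  a ball of radius r.\<close>

lemma nn_integral_ball_mass:
  fixes \<mu> :: "'a::euclidean_space measure"
  assumes \<mu>: "sets \<mu> = sets borel" "finite_measure \<mu>" and "0 < r"
  shows "(\<integral>\<^sup>+x. ennreal (ball_mass \<mu> (x, r)) \<partial>lborel) =
    emeasure \<mu> UNIV * ennreal (unit_ball_vol (real DIM('a))) * ennreal (r powr real DIM('a))"
proof -
  interpret finite_measure \<mu> by fact
  interpret pair_sigma_finite "lborel :: 'a measure" \<mu> ..
  have "closed {p :: 'a \<times> 'a. dist (fst p) (snd p) \<le> r}"
    by (intro closed_Collect_le continuous_intros)
  then have "{p :: 'a \<times> 'a. dist (fst p) (snd p) \<le> r} \<in> sets (borel \<Otimes>\<^sub>M borel)"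
    unfolding borel_prod by (rule borel_closed)
  moreover have "sets ((lborel :: 'a measure) \<Otimes>\<^sub>M \<mu>) = sets (borel \<Otimes>\<^sub>M borel)"
    by (intro sets_pair_measure_cong \<mu>(1)) simp
  ultimately have m: "(\<lambda>p. indicator {p :: 'a \<times> 'a. dist (fst p) (snd p) \<le> r} p :: ennreal) \<in> borel_measurable (lborel \<Otimes>\<^sub>M \<mu>)"
    by (intro borel_measurable_indicator) simp
  have "(\<integral>\<^sup>+x. ennreal (ball_mass \<mu> (x, r)) \<partial>lborel) = (\<integral>\<^sup>+x. (\<integral>\<^sup>+y. indicator {p :: 'a \<times> 'a. dist (fst p) (snd p) \<le> r} (x, y) \<partial>\<mu>) \<partial>lborel)"
  proof (rule nn_integral_cong)
    fix x :: 'a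
    have "(\<integral>\<^sup>+y. indicator {p :: 'a \<times> 'a. dist (fst p) (snd p) \<le> r} (x, y) \<partial>\<mu>) = (\<integral>\<^sup>+y. indicator (cball x r) y \<partial>\<mu>)"
      by (intro nn_integral_cong) (auto split: split_indicator)
    also have "\<dots> = emeasure \<mu> (cball x r)"
      using \<mu>(1) by (intro nn_integral_indicator) simp
    finally show "ennreal (ball_mass \<mu> (x, r)) = (\<integral>\<^sup>+y. indicator {p :: 'a \<times> 'a. dist (fst p) (snd p) \<le> r} (x, y) \<partial>\<mu>)"
      by (simp add: ball_mass_def emeasure_eq_measure)
  qed
  also have "\<dots> = (\<integral>\<^sup>+y. (\<integral>\<^sup>+x. indicator {p :: 'a \<times> 'a. dist (fst p) (snd p) \<le> r} (x, y) \<partial>lborel) \<partial>\<mu>)"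
    by (rule Fubini'[symmetric]) (use m in \<open>simp add: split_beta'\<close>)
  also have "\<dots> = (\<integral>\<^sup>+y. ennreal (unit_ball_vol (real DIM('a))) * ennreal (r powr real DIM('a)) \<partial>\<mu>)"
  proof (rule nn_integral_cong)
    fix y :: 'a
    have "(\<integral>\<^sup>+x. indicator {p :: 'a \<times> 'a. dist (fst p) (snd p) \<le> r} (x, y) \<partial>lborel) = (\<integral>\<^sup>+x. indicator (cball y r) x \<partial>lborel)"
      by (intro nn_integral_cong) (auto simp: dist_commute split: split_indicator)
    also have "\<dots> = ennreal (unit_ball_vol (real DIM('a))) * ennreal (r powr real DIM('a))"
      using \<open>0 < r\<close> by (simp add: emeasure_cball powr_realpow ennreal_mult)
    finally show "(\<integral>\<^sup>+x. indicator {p :: 'a \<times> 'a. dist (fst p) (snd p) \<le> r} (x, y) \<partial>lborel) =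
      ennreal (unit_ball_vol (real DIM('a))) * ennreal (r powr real DIM('a))" .
  qed
  also have "\<dots> = emeasure \<mu> UNIV * ennreal (unit_ball_vol (real DIM('a))) * ennreal (r powr real DIM('a))"
    using sets_eq_imp_space_eq[OF \<mu>(1)] by (simp add: ac_simps)
  finally show ?thesis .
qed

text \<open>The mean ball volume is a multiple of the moment of order d, finite since d < \<beta>.
  Hence the mass field is almost surely a convergent sum with finite mean.\<close>

lemma (in radius_density) nn_integral_ball_mass_mark_finite:
  fixes \<mu> :: "'a::euclidean_space measure"
  assumes \<mu>: "sets \<mu> = sets borel" "finite_measure \<mu>" and "\<rho> > 0" and "real DIM('a) < \<beta>"
  shows "(\<integral>\<^sup>+x. (\<integral>\<^sup>+r. ennreal (ball_mass \<mu> (x, r)) \<partial>mark_law f \<rho>) \<partial>lborel) < \<infinity>"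
proof -
  interpret finite_measure \<mu> by fact
  interpret mark: prob_space "mark_law f \<rho>" by (rule prob_space_mark_law) fact
  interpret pair_sigma_finite "lborel :: 'a measure" "mark_law f \<rho>" ..
  have [measurable]: "ball_mass \<mu> \<in> borel_measurable (borel \<Otimes>\<^sub>M borel)"
    using ball_mass_measurable[OF \<mu>] by (simp add: borel_prod)
  have "(\<integral>\<^sup>+x. (\<integral>\<^sup>+r. ennreal (ball_mass \<mu> (x, r)) \<partial>mark_law f \<rho>) \<partial>lborel) =
      (\<integral>\<^sup>+r. (\<integral>\<^sup>+x. ennreal (ball_mass \<mu> (x, r)) \<partial>lborel) \<partial>mark_law f \<rho>)"
    by (rule Fubini'[symmetric]) measurable
  also have "\<dots> = (\<integral>\<^sup>+r. emeasure \<mu> UNIV * ennreal (unit_ball_vol (real DIM('a))) * ennreal (r powr real DIM('a)) \<partial>mark_law f \<rho>)"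
    using AE_mark_law_pos[OF \<open>\<rho> > 0\<close>]
    by (intro nn_integral_cong_AE) (auto elim!: eventually_mono simp: nn_integral_ball_mass[OF \<mu>])
  also have "\<dots> = emeasure \<mu> UNIV * ennreal (unit_ball_vol (real DIM('a))) * (ennreal (\<rho> powr real DIM('a)) * moment (real DIM('a)))"
    by (subst nn_integral_cmult) (auto simp: mark_moment[OF \<open>\<rho> > 0\<close>])
  also have "\<dots> < \<infinity>"
  proof -
    have "emeasure \<mu> UNIV < \<infinity>" by (simp add: less_top[symmetric])
    then show ?thesis
      using moment_finite[of "real DIM('a)"] assms(4) by (simp add: ennreal_mult_less_top)
  qed
  finally show ?thesis .
qed

text \<open>Narrowing the window of exponents weakens the bound, on either side of r = 1. This
  permits common exponents for several measures.\<close>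

lemma min_powr_le:
  fixes r :: real
  assumes "0 < r" "p' \<le> p" "q \<le> q'" "p \<le> q"
  shows "min (r powr p') (r powr q') \<le> min (r powr p) (r powr q)"
proof (cases "r \<le> 1")
  case True
  then have "r powr q' \<le> r powr q" "r powr q \<le> r powr p"
    using assms by (auto intro!: powr_mono')
  then show ?thesis by linarith
next
  case False
  then have "r powr p' \<le> r powr p" "r powr p \<le> r powr q"
    using assms by (auto intro!: powr_mono)
  then show ?thesis by linarith
qed

lemma admissible_measuresD:
  assumes "\<mu> \<in> admissible_measures \<beta>"
  shows "sets \<mu> = sets borel" "finite_measure \<mu>"
  using assms by (auto simp: admissible_measures_def)

lemma admissible_combination_square_bound:
  fixes \<mu> :: "'n::finite \<Rightarrow> 'a::euclidean_space measure" and t :: "'n \<Rightarrow> real"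
  assumes \<mu>: "\<And>i. \<mu> i \<in> admissible_measures \<beta>"
  obtains p q C where "p < \<beta>" "\<beta> < q" "q \<le> 2 * real DIM('a)" "0 \<le> C"
    "\<And>r. 0 < r \<Longrightarrow> (\<integral>\<^sup>+x. ennreal ((\<Sum>i\<in>UNIV. t i * ball_mass (\<mu> i) (x, r))\<^sup>2) \<partial>lborel) \<le> ennreal (C * min (r powr p) (r powr q))"
proof -
  have "\<forall>i. \<exists>p q C. 0 < p \<and> p < \<beta> \<and> \<beta> < q \<and> q \<le> 2 * real DIM('a) \<and> 0 < C \<and>
      (\<forall>r\<ge>0. (\<integral>\<^sup>+x. (emeasure (\<mu> i) (cball x r))\<^sup>2 \<partial>lborel) \<le> ennreal (C * min (r powr p) (r powr q)))"
    using \<mu> by (simp add: admissible_measures_def)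
  then obtain p q C where pqC: "\<And>i. p i < \<beta>" "\<And>i. \<beta> < q i" "\<And>i. q i \<le> 2 * real DIM('a)" "\<And>i. 0 < C i"
    "\<And>i r. 0 \<le> r \<Longrightarrow> (\<integral>\<^sup>+x. (emeasure (\<mu> i) (cball x r))\<^sup>2 \<partial>lborel) \<le> ennreal (C i * min (r powr p i) (r powr q i))"
    by metis
  \<comment> \<open>The narrowest common window; as there are finitely many measures it still
    contains \<beta> strictly inside.\<close>
  define p' where "p' = Max (range p)"
  define q' where "q' = Min (range q)"
  define C' where "C' = (\<Sum>i\<in>UNIV. real CARD('n) * (t i)\<^sup>2 * C i)"
  have p': "p i \<le> p'" and q': "q' \<le> q i" for i
    by (auto simp: p'_def q'_def)
  have "p' \<in> range p" "q' \<in> range q" unfolding p'_def q'_def by (auto intro!: Max_in Min_in)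
  then have pq: "p' < \<beta>" "\<beta> < q'" "q' \<le> 2 * real DIM('a)" using pqC by auto
  have "(\<integral>\<^sup>+x. ennreal ((\<Sum>i\<in>UNIV. t i * ball_mass (\<mu> i) (x, r))\<^sup>2) \<partial>lborel) \<le> ennreal (C' * min (r powr p') (r powr q'))"
    if "0 < r" for r
  proof -
    have [measurable]: "ball_mass (\<mu> i) \<in> borel_measurable (borel \<Otimes>\<^sub>M borel)" for i
      using ball_mass_measurable[OF admissible_measuresD[OF \<mu>]] by (simp add: borel_prod)
    have sq: "ennreal ((ball_mass (\<mu> i) (x, r))\<^sup>2) = (emeasure (\<mu> i) (cball x r))\<^sup>2" for i x
    proof -
      interpret finite_measure "\<mu> i" by (rule admissible_measuresD[OF \<mu>])
      show ?thesis by (simp add: ball_mass_def emeasure_eq_measure ennreal_power)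
    qed
    have "(\<integral>\<^sup>+x. ennreal ((\<Sum>i\<in>UNIV. t i * ball_mass (\<mu> i) (x, r))\<^sup>2) \<partial>lborel) \<le>
        (\<integral>\<^sup>+x. (\<Sum>i\<in>UNIV. ennreal (real CARD('n) * (t i)\<^sup>2) * ennreal ((ball_mass (\<mu> i) (x, r))\<^sup>2)) \<partial>lborel)"
    proof (rule nn_integral_mono)
      fix x
      \<comment> \<open>Cauchy-Schwarz for a sum of \<open>CARD('n)\<close> terms is the source of
        that factor in \<open>C'\<close>.\<close>
      have "(\<Sum>i\<in>UNIV. t i * ball_mass (\<mu> i) (x, r))\<^sup>2 \<le> (\<Sum>i\<in>UNIV. (t i * ball_mass (\<mu> i) (x, r))\<^sup>2) * real CARD('n)"
        by (rule sum_squared_le_sum_of_squares)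
      also have "\<dots> = (\<Sum>i\<in>UNIV. real CARD('n) * (t i)\<^sup>2 * (ball_mass (\<mu> i) (x, r))\<^sup>2)"
        by (simp add: sum_distrib_right sum_distrib_left power_mult_distrib mult_ac)
      finally have "ennreal ((\<Sum>i\<in>UNIV. t i * ball_mass (\<mu> i) (x, r))\<^sup>2) \<le> ennreal \<dots>"
        by (rule ennreal_leI)
      also have "\<dots> = (\<Sum>i\<in>UNIV. ennreal (real CARD('n) * (t i)\<^sup>2 * (ball_mass (\<mu> i) (x, r))\<^sup>2))"
        by (rule sum_ennreal[symmetric]) simp
      finally show "ennreal ((\<Sum>i\<in>UNIV. t i * ball_mass (\<mu> i) (x, r))\<^sup>2) \<le>
          (\<Sum>i\<in>UNIV. ennreal (real CARD('n) * (t i)\<^sup>2) * ennreal ((ball_mass (\<mu> i) (x, r))\<^sup>2))"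
        by (simp add: ennreal_mult')
    qed
    also have "\<dots> = (\<Sum>i\<in>UNIV. ennreal (real CARD('n) * (t i)\<^sup>2) * (\<integral>\<^sup>+x. ennreal ((ball_mass (\<mu> i) (x, r))\<^sup>2) \<partial>lborel))"
      by (subst nn_integral_sum) (auto intro!: sum.cong nn_integral_cmult)
    also have "\<dots> \<le> (\<Sum>i\<in>UNIV. ennreal (real CARD('n) * (t i)\<^sup>2) * ennreal (C i * min (r powr p') (r powr q')))"
    proof (intro sum_mono mult_left_mono)
      fix i
      have "(\<integral>\<^sup>+x. ennreal ((ball_mass (\<mu> i) (x, r))\<^sup>2) \<partial>lborel) \<le> ennreal (C i * min (r powr p i) (r powr q i))"
        unfolding sq using pqC(5)[of r i] that by simp
      also have "\<dots> \<le> ennreal (C i * min (r powr p') (r powr q'))"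
        using pqC(4)[of i] that p'[of i] q'[of i] pq by (intro ennreal_leI mult_left_mono min_powr_le) auto
      finally show "(\<integral>\<^sup>+x. ennreal ((ball_mass (\<mu> i) (x, r))\<^sup>2) \<partial>lborel) \<le> ennreal (C i * min (r powr p') (r powr q'))" .
    qed simp
    also have "\<dots> = (\<Sum>i\<in>UNIV. ennreal (real CARD('n) * (t i)\<^sup>2 * C i * min (r powr p') (r powr q')))"
      by (intro sum.cong refl) (simp add: ennreal_mult'[symmetric] mult.assoc)
    also have "\<dots> = ennreal (\<Sum>i\<in>UNIV. real CARD('n) * (t i)\<^sup>2 * C i * min (r powr p') (r powr q'))"
      using pqC(4) by (intro sum_ennreal) (simp add: less_imp_le)
    finally show ?thesis unfolding C'_def by (simp add: sum_distrib_right)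
  qed
  moreover have "0 \<le> C'" unfolding C'_def using pqC(4) by (intro sum_nonneg) (simp add: less_imp_le)
  ultimately show ?thesis using that pq by blast
qed

section \<open>Centred characteristic functions and passage to the limit\<close>

lemma (in radius_density) integral_lborel_mark_law:
  fixes F :: "'a::euclidean_space \<times> real \<Rightarrow> complex"
  assumes "\<rho> > 0" and [measurable]: "F \<in> borel_measurable borel"
  shows "(CLINT z|(lborel \<Otimes>\<^sub>M mark_law f \<rho>). F z) = (CLINT z|lborel. (f (snd z / \<rho>) / \<rho>) *\<^sub>R F z)"
proof -
  have sf: "sigma_finite_measure (density lborel (\<lambda>r. ennreal (f (r / \<rho>) / \<rho>)))"
    using prob_space_mark_law[OF assms(1)] unfolding mark_law_def
    by (intro prob_space_imp_sigma_finite)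
  have "(lborel :: 'a measure) \<Otimes>\<^sub>M mark_law f \<rho> = density lborel (\<lambda>_. 1) \<Otimes>\<^sub>M density lborel (\<lambda>r. ennreal (f (r / \<rho>) / \<rho>))"
    by (simp add: mark_law_def density_1)
  also have "\<dots> = density (lborel \<Otimes>\<^sub>M lborel) (\<lambda>(x, r). 1 * ennreal (f (r / \<rho>) / \<rho>))"
    by (intro pair_measure_density sf lborel.sigma_finite_measure_axioms) measurable
  finally have eq: "(lborel :: 'a measure) \<Otimes>\<^sub>M mark_law f \<rho> = density lborel (\<lambda>z. ennreal (f (snd z / \<rho>) / \<rho>))"
    by (simp add: lborel_prod split_beta')
  have "(\<lambda>z::'a \<times> real. f (snd z / \<rho>) / \<rho>) \<in> borel_measurable (borel \<Otimes>\<^sub>M borel)"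
    by measurable
  then have [measurable]: "(\<lambda>z::'a \<times> real. f (snd z / \<rho>) / \<rho>) \<in> borel_measurable borel"
    by (simp add: borel_prod)
  show ?thesis
    unfolding eq using assms(1) f_nonneg by (intro integral_density) auto
qed

text \<open>Centring multiplies the characteristic function by a number of modulus 1, and the same
  number changes the exponent from the integral of \<open>iexp - 1\<close> to that of
  \<open>compensated_iexp\<close>. The error bound is therefore unaffected.\<close>

lemma (in marked_enumeration) centered_characteristic_bound:
  fixes g :: "'n::finite \<Rightarrow> 'a \<times> real \<Rightarrow> real" and t :: "'n \<Rightarrow> real"
  assumes gm[measurable]: "\<And>i. g i \<in> borel_measurable borel" and g0: "\<And>i z. 0 \<le> g i z"
    and fin: "\<And>i. (\<integral>\<^sup>+x. (\<integral>\<^sup>+r. ennreal (g i (x, r)) \<partial>\<nu>) \<partial>lborel) < \<infinity>"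
    and S: "0 \<le> S" "(\<integral>\<^sup>+x. (\<integral>\<^sup>+r. ennreal \<bar>\<Sum>i\<in>UNIV. t i * g i (x, r)\<bar> \<partial>\<nu>)\<^sup>2 \<partial>lborel) \<le> ennreal S"
  shows "cmod (expectation (\<lambda>\<omega>. iexp (\<Sum>i\<in>UNIV. t i * ((LINT z|\<Phi> \<omega>. g i z) - expectation (\<lambda>\<omega>. LINT z|\<Phi> \<omega>. g i z)))) -
      exp (k0 * (CLINT z|(lborel \<Otimes>\<^sub>M \<nu>). compensated_iexp (\<Sum>i\<in>UNIV. t i * g i z)))) \<le>
    exp 2 * k0 * S + 4 * sqrt ((k0 + \<kappa>) * S)"
proof -
  interpret P: pair_sigma_finite "lborel :: 'a measure" \<nu> ..
  have gm': "g i \<in> borel_measurable (lborel \<Otimes>\<^sub>M \<nu>)" for i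
    using gm[of i] by (simp add: borel_prod[symmetric] mark_sets cong: measurable_cong_sets sets_pair_measure_cong)
  note [measurable] = gm'
  define h where "h = (\<lambda>z. \<Sum>i\<in>UNIV. t i * g i z)"
  have hm[measurable]: "h \<in> borel_measurable borel" unfolding h_def by measurable
  have hm'[measurable]: "h \<in> borel_measurable (lborel \<Otimes>\<^sub>M \<nu>)" unfolding h_def by measurable
  have nn_g: "(\<integral>\<^sup>+z. ennreal (g i z) \<partial>(lborel \<Otimes>\<^sub>M \<nu>)) = (\<integral>\<^sup>+x. (\<integral>\<^sup>+r. ennreal (g i (x, r)) \<partial>\<nu>) \<partial>lborel)" for i
    by (rule mark.nn_integral_fst[symmetric]) measurable
  have g_int: "integrable (lborel \<Otimes>\<^sub>M \<nu>) (g i)" for i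
    using fin[of i] nn_g[of i] g0[of i] by (intro integrableI_nonneg) auto
  have h_int: "integrable (lborel \<Otimes>\<^sub>M \<nu>) h"
    unfolding h_def using g_int by simp
  have h_fin: "(\<integral>\<^sup>+x. (\<integral>\<^sup>+r. ennreal \<bar>h (x, r)\<bar> \<partial>\<nu>) \<partial>lborel) < \<infinity>"
  proof -
    have "(\<integral>\<^sup>+x. (\<integral>\<^sup>+r. ennreal \<bar>h (x, r)\<bar> \<partial>\<nu>) \<partial>lborel) = (\<integral>\<^sup>+z. ennreal \<bar>h z\<bar> \<partial>(lborel \<Otimes>\<^sub>M \<nu>))"
      by (rule mark.nn_integral_fst) measurable
    also have "\<dots> < \<infinity>" using h_int by (simp add: integrable_iff_bounded)
    finally show ?thesis .
  qed
  have Eg: "expectation (\<lambda>\<omega>. LINT z|\<Phi> \<omega>. g i z) = k0 * (LINT z|(lborel \<Otimes>\<^sub>M \<nu>). g i z)" for i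
    unfolding expectation_\<Phi>_nonneg[OF gm g0 fin] nn_g[symmetric]
    using g0[of i] by (subst integral_eq_nn_integral) auto
  define u where "u x = (CLINT r|\<nu>. iexp (h (x, r)) - 1)" for x
  note bnd = marked_characteristic_bound[OF hm h_fin, folded u_def]
  have e_int: "integrable (lborel \<Otimes>\<^sub>M \<nu>) (\<lambda>z. iexp (h z) - 1)"
    by (rule Bochner_Integration.integrable_bound[OF h_int]) (auto intro!: AE_I2 cmod_iexp_minus_one_le)
  have Iu: "(CLINT x|lborel. u x) = (CLINT z|(lborel \<Otimes>\<^sub>M \<nu>). iexp (h z) - 1)"
    unfolding u_def by (rule P.integral_fst'[OF e_int])
  have S2: "(LINT x|lborel. (cmod (u x))\<^sup>2) \<le> S"
  proof -
    have "ennreal (LINT x|lborel. (cmod (u x))\<^sup>2) = (\<integral>\<^sup>+x. ennreal ((cmod (u x))\<^sup>2) \<partial>lborel)"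
      using bnd(2) by (intro nn_integral_eq_integral[symmetric]) auto
    also have "\<dots> \<le> (\<integral>\<^sup>+x. (\<integral>\<^sup>+r. ennreal \<bar>h (x, r)\<bar> \<partial>\<nu>)\<^sup>2 \<partial>lborel)"
    proof (rule nn_integral_mono)
      fix x
      have i: "integrable \<nu> (\<lambda>r. iexp (h (x, r)) - 1)"
      proof (rule mark.integrable_const_bound[where B = 2])
        show "AE r in \<nu>. cmod (iexp (h (x, r)) - 1) \<le> 2"
          by (intro AE_I2 order_trans[OF norm_triangle_ineq4]) simp
      qed measurable
      have "ennreal (cmod (u x)) \<le> (\<integral>\<^sup>+r. ennreal (cmod (iexp (h (x, r)) - 1)) \<partial>\<nu>)"
        unfolding u_def by (rule integral_norm_bound_ennreal[OF i])
      also have "\<dots> \<le> (\<integral>\<^sup>+r. ennreal \<bar>h (x, r)\<bar> \<partial>\<nu>)"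
        by (intro nn_integral_mono ennreal_leI cmod_iexp_minus_one_le)
      finally have "(ennreal (cmod (u x)))\<^sup>2 \<le> (\<integral>\<^sup>+r. ennreal \<bar>h (x, r)\<bar> \<partial>\<nu>)\<^sup>2"
        by (rule power_mono) simp
      then show "ennreal ((cmod (u x))\<^sup>2) \<le> (\<integral>\<^sup>+r. ennreal \<bar>h (x, r)\<bar> \<partial>\<nu>)\<^sup>2"
        by (simp add: ennreal_power)
    qed
    also have "\<dots> \<le> ennreal S" using S(2) by (simp add: h_def)
    finally show ?thesis using S(1) by (subst (asm) ennreal_le_iff) auto
  qed
  define H where "H = (LINT z|(lborel \<Otimes>\<^sub>M \<nu>). h z)"
  have H_eq: "H = (\<Sum>i\<in>UNIV. t i * (LINT z|(lborel \<Otimes>\<^sub>M \<nu>). g i z))"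
    unfolding H_def h_def using g_int by (subst Bochner_Integration.integral_sum) auto
  \<comment> \<open>Each component is a separate Bochner integral, so additivity holds only on the
    almost sure event that all of them converge.\<close>
  have lin: "AE \<omega> in M. (\<Sum>i\<in>UNIV. t i * ((LINT z|\<Phi> \<omega>. g i z) - expectation (\<lambda>\<omega>. LINT z|\<Phi> \<omega>. g i z))) =
      (LINT z|\<Phi> \<omega>. h z) - k0 * H"
  proof -
    have "AE \<omega> in M. \<forall>i\<in>UNIV. integrable (\<Phi> \<omega>) (g i)"
      using AE_\<Phi>_summable[of "g _"] fin g0 by (intro AE_finite_allI) (auto elim!: eventually_mono)
    then show ?thesis
    proof eventually_elim
      case (elim \<omega>)
      then have "(LINT z|\<Phi> \<omega>. h z) = (\<Sum>i\<in>UNIV. t i * (LINT z|\<Phi> \<omega>. g i z))"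
        unfolding h_def by (subst Bochner_Integration.integral_sum) auto
      then show ?case
        unfolding Eg H_eq by (simp add: right_diff_distrib sum_subtractf sum_distrib_left mult.left_commute)
    qed
  qed
  have meas_g: "(\<lambda>\<omega>. LINT z|\<Phi> \<omega>. g i z) \<in> borel_measurable M" for i
    by (rule integral_\<Phi>_measurable_nonneg) (use gm g0 in auto)
  define Z where "Z \<omega> = (\<Sum>i\<in>UNIV. t i * ((LINT z|\<Phi> \<omega>. g i z) - expectation (\<lambda>\<omega>. LINT z|\<Phi> \<omega>. g i z)))" for \<omega>
  have [measurable]: "Z \<in> borel_measurable M"
    unfolding Z_def using meas_g by measurable
  let ?c = "iexp (k0 * H)"
  have "expectation (\<lambda>\<omega>. iexp (LINT z|\<Phi> \<omega>. h z)) = expectation (\<lambda>\<omega>. iexp (Z \<omega>) * ?c)"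
  proof -
    define V where "V \<omega> = (LINT z|\<Phi> \<omega>. h z)" for \<omega>
    have V: "AE \<omega> in M. V \<omega> = Z \<omega> + k0 * H"
      using lin by eventually_elim (simp add: V_def Z_def)
    have "AE \<omega> in M. iexp (V \<omega>) = iexp (Z \<omega>) * ?c"
      using V by eventually_elim (simp add: exp_add[symmetric] distrib_left)
    moreover have "V \<in> borel_measurable M"
      unfolding V_def by (rule integral_\<Phi>_measurable[OF hm])
    ultimately show ?thesis unfolding V_def[symmetric] by (intro integral_cong_AE) auto
  qed
  also have "\<dots> = expectation (\<lambda>\<omega>. iexp (Z \<omega>)) * ?c" by simp
  finally have E1: "expectation (\<lambda>\<omega>. iexp (LINT z|\<Phi> \<omega>. h z)) = expectation (\<lambda>\<omega>. iexp (Z \<omega>)) * ?c" .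
  have comp: "(CLINT z|(lborel \<Otimes>\<^sub>M \<nu>). compensated_iexp (h z)) = (CLINT x|lborel. u x) - \<i> * complex_of_real H"
  proof -
    have "(CLINT z|(lborel \<Otimes>\<^sub>M \<nu>). compensated_iexp (h z)) =
        (CLINT z|(lborel \<Otimes>\<^sub>M \<nu>). iexp (h z) - 1) - (CLINT z|(lborel \<Otimes>\<^sub>M \<nu>). \<i> * complex_of_real (h z))"
      unfolding compensated_iexp_def using h_int by (intro Bochner_Integration.integral_diff e_int) auto
    then show ?thesis unfolding Iu H_def by simp
  qed
  have E2: "exp (k0 * (CLINT x|lborel. u x)) = exp (k0 * (CLINT z|(lborel \<Otimes>\<^sub>M \<nu>). compensated_iexp (h z))) * ?c"
    unfolding comp exp_add[symmetric] by (simp add: algebra_simps)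
  have "cmod (expectation (\<lambda>\<omega>. iexp (Z \<omega>)) - exp (k0 * (CLINT z|(lborel \<Otimes>\<^sub>M \<nu>). compensated_iexp (h z)))) =
      cmod ((expectation (\<lambda>\<omega>. iexp (Z \<omega>)) - exp (k0 * (CLINT z|(lborel \<Otimes>\<^sub>M \<nu>). compensated_iexp (h z)))) * ?c)"
    by (simp add: norm_mult)
  also have "\<dots> = cmod (expectation (\<lambda>\<omega>. iexp (LINT z|\<Phi> \<omega>. h z)) - exp (k0 * (CLINT x|lborel. u x)))"
    unfolding E1 E2 by (simp add: left_diff_distrib)
  also have "\<dots> \<le> exp 2 * k0 * (LINT x|lborel. (cmod (u x))\<^sup>2) + 4 * sqrt ((k0 + \<kappa>) * (LINT x|lborel. (cmod (u x))\<^sup>2))"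
    by (rule bnd(3))
  also have "\<dots> \<le> exp 2 * k0 * S + 4 * sqrt ((k0 + \<kappa>) * S)"
    using S2 k0_nonneg by (intro add_mono mult_left_mono real_sqrt_le_mono) (auto simp: \<kappa>_def)
  finally show ?thesis unfolding Z_def h_def .
qed

lemma marked_enumeration_exists:
  fixes \<phi> :: "'w \<Rightarrow> 'a::euclidean_space measure" and k :: "'a \<Rightarrow> complex"
  assumes dpp: "determinantal M \<phi> (\<lambda>x y. k (x - y)) lborel" and k2: "integrable lborel (\<lambda>x. (cmod (k x))\<^sup>2)"
    and marking: "iid_marking M \<phi> \<nu> \<Phi>" and \<nu>: "prob_space \<nu>" "sets \<nu> = sets borel"
  obtains N X R where "marked_enumeration M N X \<phi> k R \<nu> \<Phi>"
proof -
  from marking obtain N X R where NXR: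
    "N \<in> measurable M (count_space UNIV)" "\<And>i. X i \<in> borel_measurable M" "\<And>i. R i \<in> borel_measurable M"
    "distr M ((count_space UNIV \<Otimes>\<^sub>M (\<Pi>\<^sub>M i\<in>UNIV. borel)) \<Otimes>\<^sub>M (\<Pi>\<^sub>M i\<in>UNIV. borel))
            (\<lambda>\<omega>. ((N \<omega>, \<lambda>i. X i \<omega>), \<lambda>i. R i \<omega>)) =
          distr M (count_space UNIV \<Otimes>\<^sub>M (\<Pi>\<^sub>M i\<in>UNIV. borel)) (\<lambda>\<omega>. (N \<omega>, \<lambda>i. X i \<omega>))
            \<Otimes>\<^sub>M (\<Pi>\<^sub>M i\<in>UNIV. \<nu>)"
    and en: "\<And>\<omega>. \<omega> \<in> space M \<Longrightarrow> sets (\<Phi> \<omega>) = sets borel"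
    "\<And>\<omega> B. \<omega> \<in> space M \<Longrightarrow> B \<in> sets borel \<Longrightarrow> emeasure (\<phi> \<omega>) B = (\<Sum>i. if enat i < N \<omega> then indicator B (X i \<omega>) else 0)"
    "\<And>\<omega> B. \<omega> \<in> space M \<Longrightarrow> B \<in> sets borel \<Longrightarrow> emeasure (\<Phi> \<omega>) B = (\<Sum>i. if enat i < N \<omega> then indicator B (X i \<omega>, R i \<omega>) else 0)"
    unfolding iid_marking_def by blast
  have "prob_space M" using dpp by (simp add: determinantal_def simple_point_process_def)
  then have "determinantal_enumeration M N X \<phi> k"
    unfolding determinantal_enumeration_def determinantal_enumeration_axioms_def
    using NXR en dpp k2 by blast
  then have "marked_enumeration M N X \<phi> k R \<nu> \<Phi>"
    unfolding marked_enumeration_def marked_enumeration_axioms_def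
    using NXR en \<nu> by blast
  then show ?thesis by (rule that)
qed

lemma borel_measurable_vec:
  fixes Y :: "'n::finite \<Rightarrow> 'w \<Rightarrow> real"
  assumes "\<And>i. Y i \<in> borel_measurable M"
  shows "(\<lambda>\<omega>. \<chi> i. Y i \<omega>) \<in> borel_measurable M"
proof (subst borel_measurable_euclidean_space, rule ballI)
  fix b :: "real ^ 'n" assume "b \<in> Basis"
  then obtain i where "b = axis i 1" by (auto simp: Basis_vec_def)
  then show "(\<lambda>\<omega>. (\<chi> i. Y i \<omega>) \<bullet> b) \<in> borel_measurable M"
    using assms[of i] by (simp add: inner_axis)
qed

lemma inner_vec_sum:
  fixes Y :: "'n::finite \<Rightarrow> real"
  shows "t \<bullet> (\<chi> i. Y i) = (\<Sum>i\<in>UNIV. vec_nth t i * Y i)"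
  by (simp add: inner_vec_def)

text \<open>Dominated convergence for the densities \<open>l n * f (r / s n) / s n\<close>: regular
  variation gives the pointwise limit, the global tail bound the domination, and the quadratic bound
  on \<open>compensated_iexp\<close> makes the dominating function integrable.\<close>

lemma (in radius_density) tendsto_compensated_integral:
  fixes h :: "'a::euclidean_space \<times> real \<Rightarrow> real" and s l :: "nat \<Rightarrow> real"
  assumes [measurable]: "h \<in> borel_measurable borel"
    and f_asymp: "f \<sim>[at_top] (\<lambda>r. C\<^sub>\<beta> * r powr (- \<beta> - 1))" and "0 < C\<^sub>\<beta>"
    and s: "\<And>n. 0 < s n" "s \<longlonglongrightarrow> 0" and l: "\<And>n. 0 \<le> l n" "(\<lambda>n. l n * s n powr \<beta>) \<longlonglongrightarrow> A"
    and h2: "integrable lborel (\<lambda>z. (h z)\<^sup>2 * (1 * snd z powr (- \<beta> - 1)) * indicator {0<..} (snd z))"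
  shows "(\<lambda>n. complex_of_real (l n) * (CLINT z|(lborel \<Otimes>\<^sub>M mark_law f (s n)). compensated_iexp (h z))) \<longlonglongrightarrow>
    (CLINT z|lborel. (A * (C\<^sub>\<beta> * snd z powr (- \<beta> - 1)) * indicator {0<..} (snd z)) *\<^sub>R compensated_iexp (h z))"
proof -
  define F where "F n z = (l n * (f (snd z / s n) / s n)) *\<^sub>R compensated_iexp (h z)" for n and z :: "'a \<times> real"
  define F' where "F' z = (A * (C\<^sub>\<beta> * snd z powr (- \<beta> - 1)) * indicator {0<..} (snd z)) *\<^sub>R compensated_iexp (h z)" for z :: "'a \<times> real"
  have hm: "h \<in> borel_measurable (borel \<Otimes>\<^sub>M borel)" using assms(1) by (simp add: borel_prod)
  have cm: "(\<lambda>z. compensated_iexp (h z)) \<in> borel_measurable borel" by measurable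
  have cm'[measurable]: "(\<lambda>z. compensated_iexp (h z)) \<in> borel_measurable (borel \<Otimes>\<^sub>M borel)" using hm by measurable
  have Fm: "F n \<in> borel_measurable borel" for n
  proof -
    have "F n \<in> borel_measurable (borel \<Otimes>\<^sub>M borel)" unfolding F_def[abs_def] by measurable
    then show ?thesis by (simp add: borel_prod)
  qed
  have F'm: "F' \<in> borel_measurable borel"
  proof -
    have "F' \<in> borel_measurable (borel \<Otimes>\<^sub>M borel)" unfolding F'_def[abs_def] by measurable
    then show ?thesis by (simp add: borel_prod)
  qed
  have eq: "complex_of_real (l n) * (CLINT z|(lborel \<Otimes>\<^sub>M mark_law f (s n)). compensated_iexp (h z)) = (CLINT z|lborel. F n z)" for n
    unfolding integral_lborel_mark_law[OF s(1) cm]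
    by (simp add: F_def scaleR_conv_of_real mult.assoc flip: integral_mult_right_zero)
  obtain B where B: "\<And>n. norm (l n * s n powr \<beta>) \<le> B"
    using convergent_imp_Bseq[OF convergentI[OF l(2)]] by (auto simp: Bseq_def)
  \<comment> \<open>Radius 0 has to be excluded: there \<open>f (0 / s n)\<close> is the constant
    f(0), so neither the domination nor the limit is available.\<close>
  have AE0: "AE z in (lborel :: ('a \<times> real) measure). snd z \<noteq> 0"
  proof -
    have "AE z in (lborel :: 'a measure) \<Otimes>\<^sub>M (lborel :: real measure). snd z \<noteq> 0"
    proof (rule lborel_pair.AE_pair_measure)
      show "AE x in (lborel :: 'a measure). AE r in lborel. snd (x, r) \<noteq> (0 :: real)"
        using AE_lborel_singleton[of "0 :: real"] by simp
    qed measurable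
    then show ?thesis unfolding lborel_prod .
  qed
  have "(\<lambda>n. CLINT z|lborel. F n z) \<longlonglongrightarrow> (CLINT z|lborel. F' z)"
  proof (rule integral_dominated_convergence[where w = "\<lambda>z. (B * C\<^sub>0) * ((h z)\<^sup>2 * (1 * snd z powr (- \<beta> - 1)) * indicator {0<..} (snd z))"])
    show "integrable lborel (\<lambda>z. (B * C\<^sub>0) * ((h z)\<^sup>2 * (1 * snd z powr (- \<beta> - 1)) * indicator {0<..} (snd z)))"
      by (intro integrable_mult_right h2)
    show "F' \<in> borel_measurable lborel" "\<And>n. F n \<in> borel_measurable lborel"
      using Fm F'm by simp_all
    show "AE z in lborel. norm (F n z) \<le> (B * C\<^sub>0) * ((h z)\<^sup>2 * (1 * snd z powr (- \<beta> - 1)) * indicator {0<..} (snd z))" for n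
      using AE0
    proof eventually_elim
      case (elim z)
      show ?case
      proof (cases "0 < snd z")
        case True
        have "l n * (f (snd z / s n) / s n) \<le> l n * (C\<^sub>0 * s n powr \<beta> * snd z powr (- \<beta> - 1))"
          by (intro mult_left_mono density_bound s(1) True l(1))
        also have "\<dots> = (l n * s n powr \<beta>) * (C\<^sub>0 * snd z powr (- \<beta> - 1))" by (simp add: ac_simps)
        also have "\<dots> \<le> B * (C\<^sub>0 * snd z powr (- \<beta> - 1))"
          using B[of n] C0_nonneg by (intro mult_right_mono) auto
        finally have 1: "l n * (f (snd z / s n) / s n) \<le> B * (C\<^sub>0 * snd z powr (- \<beta> - 1))" .
        have 2: "cmod (compensated_iexp (h z)) \<le> (h z)\<^sup>2"
          by (rule order_trans[OF cmod_compensated_iexp_le]) simp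
        have 0: "0 \<le> l n * (f (snd z / s n) / s n)"
          using l(1)[of n] f_nonneg s(1)[of n] by simp
        have "norm (F n z) = (l n * (f (snd z / s n) / s n)) * cmod (compensated_iexp (h z))"
          unfolding F_def norm_scaleR by (simp only: abs_of_nonneg[OF 0])
        also have "\<dots> \<le> (B * (C\<^sub>0 * snd z powr (- \<beta> - 1))) * (h z)\<^sup>2"
          using 0 1 by (intro mult_mono 1 2) auto
        finally show ?thesis using True by (simp add: ac_simps)
      next
        case False
        then have "snd z / s n < 0" using elim s(1)[of n] by (simp add: divide_neg_pos)
        then show ?thesis using False by (simp add: F_def f_neg)
      qed
    qed
    show "AE z in lborel. (\<lambda>n. F n z) \<longlonglongrightarrow> F' z"
      using AE0
    proof eventually_elim
      case (elim z)
      show ?case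
      proof (cases "0 < snd z")
        case True
        define r where "r = snd z"
        have "r > 0" using True by (simp add: r_def)
        have f1: "((\<lambda>y. f y / (C\<^sub>\<beta> * y powr (- \<beta> - 1))) \<longlongrightarrow> 1) at_top"
        proof (rule asymp_equivD_strong[OF f_asymp])
          show "\<forall>\<^sub>F y in at_top. f y \<noteq> 0 \<or> C\<^sub>\<beta> * y powr (- \<beta> - 1) \<noteq> 0"
            using eventually_gt_at_top[of 0] by eventually_elim (use \<open>0 < C\<^sub>\<beta>\<close> in auto)
        qed
        have top: "filterlim (\<lambda>n. r / s n) at_top sequentially"
        proof -
          have "filterlim (\<lambda>n. inverse (s n)) at_top sequentially"
            using s by (intro filterlim_inverse_at_top) auto
          then have "filterlim (\<lambda>n. r * inverse (s n)) at_top sequentially"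
            using \<open>r > 0\<close> by (intro filterlim_tendsto_pos_mult_at_top[OF tendsto_const])
          then show ?thesis by (simp add: divide_inverse)
        qed
        have lim: "(\<lambda>n. f (r / s n) / (C\<^sub>\<beta> * (r / s n) powr (- \<beta> - 1))) \<longlonglongrightarrow> 1"
          by (rule filterlim_compose[OF f1 top])
        \<comment> \<open>Written as a product of a convergent factor, a ratio tending to 1 by the
          asymptotics of f, and the limit density; the powers of \<open>s n\<close> cancel.\<close>
        have "(\<lambda>n. (l n * s n powr \<beta>) * (f (r / s n) / (C\<^sub>\<beta> * (r / s n) powr (- \<beta> - 1))) * (C\<^sub>\<beta> * r powr (- \<beta> - 1))) \<longlonglongrightarrow>
            A * 1 * (C\<^sub>\<beta> * r powr (- \<beta> - 1))"
          by (intro tendsto_mult l(2) lim tendsto_const)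
        also have "(\<lambda>n. (l n * s n powr \<beta>) * (f (r / s n) / (C\<^sub>\<beta> * (r / s n) powr (- \<beta> - 1))) * (C\<^sub>\<beta> * r powr (- \<beta> - 1))) =
            (\<lambda>n. l n * (f (r / s n) / s n))"
        proof
          fix n
          have "(r / s n) powr (- \<beta> - 1) = r powr (- \<beta> - 1) * (s n powr \<beta> * s n)"
          proof -
            have "(r / s n) powr (- \<beta> - 1) = r powr (- \<beta> - 1) / s n powr (- \<beta> - 1)"
              using s(1)[of n] \<open>r > 0\<close> by (simp add: powr_divide)
            also have "s n powr (- \<beta> - 1) = inverse (s n powr (\<beta> + 1))"
              by (simp add: powr_minus[symmetric])
            also have "s n powr (\<beta> + 1) = s n powr \<beta> * s n"
              using s(1)[of n] by (simp add: powr_add)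
            finally show ?thesis by (simp add: divide_inverse)
          qed
          then show "(l n * s n powr \<beta>) * (f (r / s n) / (C\<^sub>\<beta> * (r / s n) powr (- \<beta> - 1))) * (C\<^sub>\<beta> * r powr (- \<beta> - 1)) =
              l n * (f (r / s n) / s n)"
            using s(1)[of n] \<open>r > 0\<close> \<open>0 < C\<^sub>\<beta>\<close> by (simp add: field_simps)
        qed
        finally have "(\<lambda>n. l n * (f (r / s n) / s n)) \<longlonglongrightarrow> A * (C\<^sub>\<beta> * r powr (- \<beta> - 1))" by simp
        then show ?thesis
          unfolding F_def F'_def r_def using True by (intro tendsto_scaleR tendsto_const) simp
      next
        case False
        then have "snd z / s n < 0" for n using elim s(1)[of n] by (simp add: divide_neg_pos)
        then show ?thesis using False by (simp add: F_def F'_def f_neg)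
      qed
    qed
  qed
  then show ?thesis unfolding eq F'_def .
qed

lemma filterlim_at_right_0:
  fixes s :: "nat \<Rightarrow> real"
  assumes "s \<longlonglongrightarrow> 0" "\<And>n. 0 < s n"
  shows "filterlim s (at_right 0) sequentially"
  using assms by (auto simp: filterlim_at less_imp_neq[symmetric])

theorem theorem2p11:
  fixes \<beta> C\<^sub>\<beta> C\<^sub>0 a :: real
    and f :: "real \<Rightarrow> real"
    and lam :: "real \<Rightarrow> real"
    and M :: "real \<Rightarrow> 'w measure"
    and \<phi> :: "real \<Rightarrow> 'w \<Rightarrow> 'a::euclidean_space measure"
    and \<Phi> :: "real \<Rightarrow> 'w \<Rightarrow> ('a \<times> real) measure"
    and K\<^sub>\<rho> :: "real \<Rightarrow> 'a \<Rightarrow> complex"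
    and M\<^sub>0 :: "'u measure"
    and \<phi>\<^sub>0 :: "'u \<Rightarrow> 'a measure"
    and K :: "'a \<Rightarrow> complex"
    and N :: "'v measure"
    and Q :: "'v \<Rightarrow> ('a \<times> real) measure"
    and \<mu> :: "'n::finite \<Rightarrow> 'a measure"
  assumes "real DIM('a) < \<beta>" and "\<beta> < 2 * real DIM('a)"
    \<comment> \<open>the radius density\<close>
    and "f \<in> borel_measurable borel" and "\<And>r. 0 \<le> f r" and "\<And>r. r < 0 \<Longrightarrow> f r = 0"
    and "(\<integral>\<^sup>+r. ennreal (f r) \<partial>lborel) = 1"
    and "0 < C\<^sub>\<beta>" and "f \<sim>[at_top] (\<lambda>r. C\<^sub>\<beta> * r powr (- \<beta> - 1))"
    and "\<And>r. 0 \<le> r \<Longrightarrow> r powr (\<beta> + 1) * f r \<le> C\<^sub>0"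
    \<comment> \<open>the unscaled process, which only enters through \<open>K 0\<close>\<close>
    and "determinantal M\<^sub>0 \<phi>\<^sub>0 (\<lambda>x y. K (x - y)) lborel" and "stationary M\<^sub>0 \<phi>\<^sub>0"
    \<comment> \<open>the scaled processes and their markings\<close>
    and "\<And>\<rho>. 0 < \<rho> \<Longrightarrow> determinantal (M \<rho>) (\<phi> \<rho>) (\<lambda>x y. K\<^sub>\<rho> \<rho> (x - y)) lborel"
    and "\<And>\<rho>. 0 < \<rho> \<Longrightarrow> stationary (M \<rho>) (\<phi> \<rho>)"
    and "\<And>\<rho>. 0 < \<rho> \<Longrightarrow> iid_marking (M \<rho>) (\<phi> \<rho>) (mark_law f \<rho>) (\<Phi> \<rho>)"
    \<comment> \<open>the kernel operators\<close>
    and "\<And>\<rho>. 0 < \<rho> \<Longrightarrow> is_L2_integral_kernel lborel (\<lambda>x y. K\<^sub>\<rho> \<rho> (x - y))"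
    and "\<And>\<rho>. 0 < \<rho> \<Longrightarrow>
           L2_bounded_operator lborel (integral_operator lborel (\<lambda>x y. K\<^sub>\<rho> \<rho> (x - y)))"
    and "\<And>\<rho>. 0 < \<rho> \<Longrightarrow>
           L2_symmetric lborel (integral_operator lborel (\<lambda>x y. K\<^sub>\<rho> \<rho> (x - y)))"
    and "\<And>\<rho>. 0 < \<rho> \<Longrightarrow>
           L2_spectrum lborel (integral_operator lborel (\<lambda>x y. K\<^sub>\<rho> \<rho> (x - y)))
             \<subseteq> complex_of_real ` {0..<1}"
    and "\<And>\<rho>. 0 < \<rho> \<Longrightarrow> locally_trace_class (\<lambda>x y. K\<^sub>\<rho> \<rho> (x - y))"
    \<comment> \<open>intensities\<close>
    and "\<And>\<rho>. 0 < \<rho> \<Longrightarrow> K\<^sub>\<rho> \<rho> 0 = complex_of_real (lam \<rho>) * K 0"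
    and "filterlim lam at_top (at_right 0)"
    \<comment> \<open>square integrals of the kernels\<close>
    and "\<forall>\<^sub>F \<rho> in at_right 0. integrable lborel (\<lambda>x. (cmod (K\<^sub>\<rho> \<rho> x))\<^sup>2)"
    and "(\<lambda>\<rho>. LINT x|lborel. (cmod (K\<^sub>\<rho> \<rho> x))\<^sup>2) \<in> O[at_right 0](lam)"
    \<comment> \<open>the intermediate scaling\<close>
    and "0 < a"
    and "((\<lambda>\<rho>. lam \<rho> * \<rho> powr \<beta>) \<longlongrightarrow> a powr (real DIM('a) - \<beta>)) (at_right 0)"
    \<comment> \<open>the Poisson random measure and the measures at which the fields are evaluated\<close>
    and "poisson_random_measure N (limit_intensity (Re (K 0) * C\<^sub>\<beta>) \<beta>) Q"
    and "\<And>i. \<mu> i \<in> admissible_measures \<beta>"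
  shows "converges_in_distribution M
           (\<lambda>\<rho> \<omega>. \<chi> i. centered_mass_field (M \<rho>) (\<Phi> \<rho>) (\<mu> i) \<omega>) (at_right 0)
           N (\<lambda>\<omega>. \<chi> i. poisson_field N (limit_intensity (Re (K 0) * C\<^sub>\<beta>) \<beta>) Q
                           (dilatation a (\<mu> i)) \<omega>)"
proof -
  let ?d = "real DIM('a)"
  define K0 where "K0 = Re (K 0)"
  define m where "m = (limit_intensity (K0 * C\<^sub>\<beta>) \<beta> :: ('a \<times> real) measure)"
  interpret rd: radius_density f \<beta> C\<^sub>0
    by standard (use assms(3-6,9) in auto)
  interpret P: poisson_random_measure_space N m Q
    by standard (use assms(26) in \<open>simp add: m_def K0_def\<close>)
  define \<kappa> where "\<kappa> \<rho> = (LINT x|lborel. (cmod (K\<^sub>\<rho> \<rho> x))\<^sup>2)" for \<rho>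
  from assms(23) obtain c' where "c' > 0" and c': "\<forall>\<^sub>F \<rho> in at_right 0. norm (\<kappa> \<rho>) \<le> c' * norm (lam \<rho>)"
    unfolding \<kappa>_def by (elim landau_o.bigE)
  have "\<forall>\<^sub>F \<rho> in at_right 0. 0 < lam \<rho>"
    using assms(21) by (simp add: filterlim_at_top_dense)
  with c' assms(22) have "\<forall>\<^sub>F \<rho> in at_right 0. norm (\<kappa> \<rho>) \<le> c' * norm (lam \<rho>) \<and> 0 < lam \<rho> \<and>
      integrable lborel (\<lambda>x. (cmod (K\<^sub>\<rho> \<rho> x))\<^sup>2)"
    by eventually_elim auto
  \<comment> \<open>One interval on which all eventual hypotheses hold; the sequences considered
    below stay inside it, so every estimate holds for all n.\<close>
  then obtain b where "b > 0" and b: "\<And>\<rho>. 0 < \<rho> \<Longrightarrow> \<rho> < b \<Longrightarrow> norm (\<kappa> \<rho>) \<le> c' * norm (lam \<rho>) \<and> 0 < lam \<rho> \<and>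
      integrable lborel (\<lambda>x. (cmod (K\<^sub>\<rho> \<rho> x))\<^sup>2)"
    unfolding eventually_at_right_field by blast
  have \<mu>: "sets (\<mu> i) = sets borel" "finite_measure (\<mu> i)" for i
    using admissible_measuresD[OF assms(27)] by auto
  have g_meas[measurable]: "ball_mass (\<mu> i) \<in> borel_measurable borel" for i
    by (rule ball_mass_measurable[OF \<mu>])
  have model: "\<exists>N' X R. marked_enumeration (M \<rho>) N' X (\<phi> \<rho>) (K\<^sub>\<rho> \<rho>) R (mark_law f \<rho>) (\<Phi> \<rho>)"
    if \<rho>: "0 < \<rho>" "\<rho> < b" for \<rho>
    by (rule marked_enumeration_exists[OF assms(12)[OF \<rho>(1)] _ assms(14)[OF \<rho>(1)]])
      (use b[OF \<rho>] rd.prob_space_mark_law[OF \<rho>(1)] rd.sets_mark_law in auto)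
  have k0: "0 \<le> lam \<rho> * K0" if \<rho>: "0 < \<rho>" "\<rho> < b" for \<rho>
  proof -
    obtain N' X R where "marked_enumeration (M \<rho>) N' X (\<phi> \<rho>) (K\<^sub>\<rho> \<rho>) R (mark_law f \<rho>) (\<Phi> \<rho>)"
      using model[OF \<rho>] by blast
    then interpret E: marked_enumeration "M \<rho>" N' X "\<phi> \<rho>" "K\<^sub>\<rho> \<rho>" R "mark_law f \<rho>" "\<Phi> \<rho>" .
    show ?thesis using E.k0_nonneg by (simp add: E.k0_def assms(20)[OF \<rho>(1)] K0_def)
  qed
  \<comment> \<open>The sign is inherited from a scaled process: its intensity
    \<open>lam \<rho> * K0\<close> is nonnegative and \<open>lam \<rho>\<close> is positive at
    \<rho> = b / 2.\<close>
  have "0 \<le> K0"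
    using k0[of "b / 2"] b[of "b / 2"] \<open>b > 0\<close> by (auto simp: zero_le_mult_iff)
  have field_meas: "(\<lambda>\<omega>. centered_mass_field (M \<rho>) (\<Phi> \<rho>) (\<mu> i) \<omega>) \<in> borel_measurable (M \<rho>)"
    and field_prob: "prob_space (M \<rho>)" if \<rho>: "0 < \<rho>" "\<rho> < b" for \<rho> i
  proof -
    obtain N' X R where "marked_enumeration (M \<rho>) N' X (\<phi> \<rho>) (K\<^sub>\<rho> \<rho>) R (mark_law f \<rho>) (\<Phi> \<rho>)"
      using model[OF \<rho>] by blast
    then interpret E: marked_enumeration "M \<rho>" N' X "\<phi> \<rho>" "K\<^sub>\<rho> \<rho>" R "mark_law f \<rho>" "\<Phi> \<rho>" .
    show "prob_space (M \<rho>)" by (rule E.prob_space_axioms)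
    show "(\<lambda>\<omega>. centered_mass_field (M \<rho>) (\<Phi> \<rho>) (\<mu> i) \<omega>) \<in> borel_measurable (M \<rho>)"
      unfolding centered_mass_field_def mass_field_def
      by (intro borel_measurable_diff E.integral_\<Phi>_measurable g_meas borel_measurable_const)
  qed
  define G where "G i = ball_mass (dilatation a (\<mu> i))" for i
  have G_eq: "G i z = ball_mass (\<mu> i) (inverse a *\<^sub>R z)" for i z
    unfolding G_def by (rule ball_mass_dilatation[OF \<mu>(1) assms(24)])
  have scale: "distr m borel (\<lambda>z. inverse a *\<^sub>R z) = density m (\<lambda>_. ennreal (a powr (?d - \<beta>)))"
    unfolding m_def by (rule limit_intensity_scale[OF assms(24)])
  have sets_m[measurable_cong]: "sets m = sets borel" by (simp add: m_def limit_intensity_def)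
  have G_meas[measurable]: "G i \<in> borel_measurable m" for i
    unfolding G_eq[abs_def] by measurable
  have g_square: "integrable m (\<lambda>z. (ball_mass (\<mu> i) z)\<^sup>2)" for i
  proof -
    \<comment> \<open>Kronecker coefficients recover a single measure from the estimate for linear
      combinations.\<close>
    obtain p q C where "p < \<beta>" "\<beta> < q" "0 \<le> C" and
      bnd: "\<And>r. 0 < r \<Longrightarrow> (\<integral>\<^sup>+x. ennreal ((\<Sum>j\<in>UNIV. (if j = i then 1 else 0) * ball_mass (\<mu> j) (x, r))\<^sup>2) \<partial>lborel) \<le> ennreal (C * min (r powr p) (r powr q))"
      by (rule admissible_combination_square_bound[of \<mu> \<beta> "\<lambda>j. if j = i then 1 else 0", OF assms(27)]) blast
    have "(\<Sum>j\<in>UNIV. (if j = i then 1 else 0) * ball_mass (\<mu> j) z) = ball_mass (\<mu> i) z" for z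
      by (simp add: if_distrib[of "\<lambda>x. x * _"] cong: if_cong)
    note bnd' = bnd[unfolded this]
    show ?thesis
      unfolding m_def
      by (rule square_integrable_limit_intensity(1)[OF g_meas bnd' \<open>0 \<le> C\<close> _ \<open>p < \<beta>\<close> \<open>\<beta> < q\<close>])
        (use \<open>0 \<le> K0\<close> assms(7) in auto)
  qed
  have G_square: "integrable m (\<lambda>z. (G i z)\<^sup>2)" for i
  proof -
    have "integrable (density m (\<lambda>_. ennreal (a powr (?d - \<beta>)))) (\<lambda>z. (ball_mass (\<mu> i) z)\<^sup>2)"
      using g_square[of i] by (subst integrable_density) auto
    then show ?thesis
      unfolding scale[symmetric] G_eq by (subst (asm) integrable_distr_eq) auto
  qed
  define Y where "Y i = poisson_field N m Q (dilatation a (\<mu> i))" for i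
  have Y: "is_compensated_integral N m Q (G i) (Y i)" for i
    unfolding Y_def poisson_field_def G_def[symmetric]
    by (rule P.is_compensated_integral_compensated_integral[OF G_meas G_square])
  have Y_meas: "Y i \<in> borel_measurable N" for i
    using Y[of i] by (simp add: is_compensated_integral_def)
  have char: "(\<lambda>n. CLINT \<omega>|M (s n). iexp (\<Sum>i\<in>UNIV. t i * centered_mass_field (M (s n)) (\<Phi> (s n)) (\<mu> i) \<omega>)) \<longlonglongrightarrow>
      (CLINT \<omega>|N. iexp (\<Sum>i\<in>UNIV. t i * Y i \<omega>))"
    if s: "\<And>n. 0 < s n" "\<And>n. s n < b" "s \<longlonglongrightarrow> 0" for s :: "nat \<Rightarrow> real" and t :: "'n \<Rightarrow> real"
  proof -
    define h where "h z = (\<Sum>i\<in>UNIV. t i * ball_mass (\<mu> i) z)" for z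
    have hm[measurable]: "h \<in> borel_measurable borel" unfolding h_def by measurable
    obtain p q C where pqC: "p < \<beta>" "\<beta> < q" "q \<le> 2 * ?d" "0 \<le> C" and
      h2: "\<And>r. 0 < r \<Longrightarrow> (\<integral>\<^sup>+x. ennreal ((h (x, r))\<^sup>2) \<partial>lborel) \<le> ennreal (C * min (r powr p) (r powr q))"
      unfolding h_def by (rule admissible_combination_square_bound[of \<mu> \<beta> t, OF assms(27)]) blast
    have h2q: "(\<integral>\<^sup>+x. ennreal ((h (x, r))\<^sup>2) \<partial>lborel) \<le> ennreal (C * r powr q)" if "0 < r" for r
      using \<open>0 \<le> C\<close> by (intro order_trans[OF h2[OF that]] ennreal_leI mult_left_mono) auto
    note s_lim = filterlim_at_right_0[OF s(3,1)]
    \<comment> \<open>The constant of the weighted Cauchy-Schwarz bound with s = d. The orders d and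
      q - d lie strictly between 0 and \<beta> because d < \<beta> < q \<le> 2d.\<close>
    define D where "D = C * enn2real (rd.moment ?d) * enn2real (rd.moment (q - ?d))"
    have "0 \<le> D" using \<open>0 \<le> C\<close> by (simp add: D_def)
    have mom: "rd.moment ?d = ennreal (enn2real (rd.moment ?d))" "rd.moment (q - ?d) = ennreal (enn2real (rd.moment (q - ?d)))"
      using rd.moment_finite[of ?d] rd.moment_finite[of "q - ?d"] assms(1) pqC by auto
    define L where "L n = lam (s n)" for n
    have L0: "0 < L n" for n using b[OF s(1,2)] by (simp add: L_def)
    define J where "J = (CLINT z|lborel. (a powr (?d - \<beta>) * K0 * (C\<^sub>\<beta> * snd z powr (- \<beta> - 1)) * indicator {0<..} (snd z)) *\<^sub>R compensated_iexp (h z))"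
    have La: "(\<lambda>n. L n * s n powr \<beta>) \<longlonglongrightarrow> a powr (?d - \<beta>)"
      unfolding L_def by (rule filterlim_compose[OF assms(25) s_lim])
    then have La': "(\<lambda>n. L n * K0 * s n powr \<beta>) \<longlonglongrightarrow> a powr (?d - \<beta>) * K0"
      using tendsto_mult_right[OF La, of K0] by (simp add: ac_simps)
    have J_lim: "(\<lambda>n. complex_of_real (L n * K0) * (CLINT z|(lborel \<Otimes>\<^sub>M mark_law f (s n)). compensated_iexp (h z))) \<longlonglongrightarrow> J"
      unfolding J_def
    proof (rule rd.tendsto_compensated_integral[OF hm assms(8,7) s(1,3) _ La'])
      show "0 \<le> L n * K0" for n using L0[of n] \<open>0 \<le> K0\<close> by simp
      show "integrable lborel (\<lambda>z. (h z)\<^sup>2 * (1 * snd z powr (- \<beta> - 1)) * indicator {0<..} (snd z))"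
        by (rule square_integrable_limit_intensity(2)[OF hm h2 \<open>0 \<le> C\<close> _ pqC(1,2)]) auto
    qed
    have bound: "cmod ((CLINT \<omega>|M (s n). iexp (\<Sum>i\<in>UNIV. t i * centered_mass_field (M (s n)) (\<Phi> (s n)) (\<mu> i) \<omega>)) -
        exp (complex_of_real (L n * K0) * (CLINT z|(lborel \<Otimes>\<^sub>M mark_law f (s n)). compensated_iexp (h z)))) \<le>
        exp 2 * K0 * (L n * (D * s n powr q)) + 4 * sqrt ((K0 + c') * (L n * (D * s n powr q)))" for n
    proof -
      obtain N' X R where "marked_enumeration (M (s n)) N' X (\<phi> (s n)) (K\<^sub>\<rho> (s n)) R (mark_law f (s n)) (\<Phi> (s n))"
        using model[OF s(1,2)] by blast
      then interpret E: marked_enumeration "M (s n)" N' X "\<phi> (s n)" "K\<^sub>\<rho> (s n)" R "mark_law f (s n)" "\<Phi> (s n)" .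
      have Ek0: "E.k0 = L n * K0" by (simp add: E.k0_def assms(20)[OF s(1)] K0_def L_def)
      have E\<kappa>: "E.\<kappa> \<le> c' * L n"
        using b[OF s(1,2), of n] by (auto simp: E.\<kappa>_def \<kappa>_def L_def)
      define S where "S = D * s n powr q"
      have "0 \<le> S" using \<open>0 \<le> D\<close> by (simp add: S_def)
      have "(\<integral>\<^sup>+x. (\<integral>\<^sup>+r. ennreal \<bar>h (x, r)\<bar> \<partial>mark_law f (s n))\<^sup>2 \<partial>lborel) \<le>
          ennreal C * rd.moment ?d * rd.moment (q - ?d) * ennreal (s n powr q)"
        by (rule rd.square_mark_mean_le[OF hm h2q \<open>0 \<le> C\<close> s(1)])
      also have "\<dots> = ennreal S"
        unfolding S_def D_def using \<open>0 \<le> C\<close> by (subst mom(1), subst mom(2)) (simp add: ennreal_mult)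
      finally have "cmod ((CLINT \<omega>|M (s n). iexp (\<Sum>i\<in>UNIV. t i * centered_mass_field (M (s n)) (\<Phi> (s n)) (\<mu> i) \<omega>)) -
        exp (E.k0 * (CLINT z|(lborel \<Otimes>\<^sub>M mark_law f (s n)). compensated_iexp (h z)))) \<le>
        exp 2 * E.k0 * S + 4 * sqrt ((E.k0 + E.\<kappa>) * S)"
        unfolding centered_mass_field_def mass_field_def h_def
        by (intro E.centered_characteristic_bound g_meas ball_mass_nonneg \<open>0 \<le> S\<close>
          rd.nn_integral_ball_mass_mark_finite[OF \<mu> s(1) assms(1)])
      also have "\<dots> \<le> exp 2 * K0 * (L n * S) + 4 * sqrt ((K0 + c') * (L n * S))"
      proof (intro add_mono mult_left_mono real_sqrt_le_mono)
        show "exp 2 * E.k0 * S \<le> exp 2 * K0 * (L n * S)" unfolding Ek0 by simp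
        \<comment> \<open>Here the bound on the square integral of the kernel enters: both
          \<open>k0\<close> and \<open>\<kappa>\<close> are of order \<open>L n\<close>.\<close>
        have "(E.k0 + E.\<kappa>) * S \<le> (L n * K0 + c' * L n) * S"
          unfolding Ek0 using E\<kappa> \<open>0 \<le> S\<close> by (intro mult_right_mono) auto
        then show "(E.k0 + E.\<kappa>) * S \<le> (K0 + c') * (L n * S)" by (simp add: algebra_simps)
      qed simp
      finally show ?thesis unfolding Ek0 S_def .
    qed
    have err: "(\<lambda>n. L n * (D * s n powr q)) \<longlonglongrightarrow> 0"
    proof -
      have "(\<lambda>n. s n powr (q - \<beta>)) \<longlonglongrightarrow> 0"
      proof (rule tendsto_zero_powrI[OF s(3) tendsto_const])
        show "\<forall>\<^sub>F n in sequentially. 0 \<le> s n" using s(1) by (simp add: less_imp_le)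
      qed (use pqC in simp)
      \<comment> \<open>The error is the convergent factor times a positive power of
        \<open>s n\<close>, since q > \<beta>.\<close>
      then have "(\<lambda>n. (L n * s n powr \<beta>) * (D * s n powr (q - \<beta>))) \<longlonglongrightarrow> a powr (?d - \<beta>) * (D * 0)"
        by (intro tendsto_mult La tendsto_const)
      moreover have "(L n * s n powr \<beta>) * (D * s n powr (q - \<beta>)) = L n * (D * s n powr q)" for n
      proof -
        have "s n powr \<beta> * s n powr (q - \<beta>) = s n powr q" by (simp add: powr_add[symmetric])
        then show ?thesis by (metis mult.assoc mult.left_commute)
      qed
      ultimately show ?thesis by simp
    qed
    have "(\<lambda>n. (CLINT \<omega>|M (s n). iexp (\<Sum>i\<in>UNIV. t i * centered_mass_field (M (s n)) (\<Phi> (s n)) (\<mu> i) \<omega>)) -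
        exp (complex_of_real (L n * K0) * (CLINT z|(lborel \<Otimes>\<^sub>M mark_law f (s n)). compensated_iexp (h z)))) \<longlonglongrightarrow> 0"
    proof (rule Lim_null_comparison)
      have "(\<lambda>n. exp 2 * K0 * (L n * (D * s n powr q)) + 4 * sqrt ((K0 + c') * (L n * (D * s n powr q)))) \<longlonglongrightarrow>
          exp 2 * K0 * 0 + 4 * sqrt ((K0 + c') * 0)"
        by (intro tendsto_intros err)
      then show "(\<lambda>n. exp 2 * K0 * (L n * (D * s n powr q)) + 4 * sqrt ((K0 + c') * (L n * (D * s n powr q)))) \<longlonglongrightarrow> 0"
        by simp
    qed (intro always_eventually allI bound)
    from tendsto_add[OF this tendsto_exp[OF J_lim]]
    have "(\<lambda>n. CLINT \<omega>|M (s n). iexp (\<Sum>i\<in>UNIV. t i * centered_mass_field (M (s n)) (\<Phi> (s n)) (\<mu> i) \<omega>)) \<longlonglongrightarrow> exp J"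
      by simp
    also have "exp J = (CLINT \<omega>|N. iexp (\<Sum>i\<in>UNIV. t i * Y i \<omega>))"
    proof -
      have "(CLINT \<omega>|N. iexp (\<Sum>i\<in>UNIV. t i * Y i \<omega>)) = exp (CLINT z|m. compensated_iexp (\<Sum>i\<in>UNIV. t i * G i z))"
        by (rule P.compensated_integral_characteristic(2)[OF P.is_compensated_integral_sum]) (auto intro: Y)
      also have "(CLINT z|m. compensated_iexp (\<Sum>i\<in>UNIV. t i * G i z)) = (CLINT z|m. compensated_iexp (h (inverse a *\<^sub>R z)))"
        by (simp add: G_eq h_def)
      \<comment> \<open>The dilatation, so far in the argument of \<open>h\<close>, is moved onto
        the intensity measure, where it becomes the factor a^(d-\<beta>) found in
        \<open>J\<close>.\<close>
      also have "\<dots> = (CLINT z|distr m borel (\<lambda>z. inverse a *\<^sub>R z). compensated_iexp (h z))"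
        by (rule integral_distr[symmetric]) measurable
      also have "\<dots> = (CLINT z|m. a powr (?d - \<beta>) *\<^sub>R compensated_iexp (h z))"
        unfolding scale by (rule integral_density) auto
      also have "\<dots> = (CLINT z|density lborel (\<lambda>z. ennreal (K0 * C\<^sub>\<beta> * snd z powr (- \<beta> - 1) * indicator {0<..} (snd z))). a powr (?d - \<beta>) *\<^sub>R compensated_iexp (h z))"
      proof -
        have "m = density lborel (\<lambda>z. ennreal (K0 * C\<^sub>\<beta> * snd z powr (- \<beta> - 1) * indicator {0<..} (snd z)))"
          unfolding m_def limit_intensity_def split_beta'
          by (intro arg_cong[where f = "density lborel"] ext) (auto split: split_indicator)
        then show ?thesis by simp
      qed
      also have "\<dots> = (CLINT z|lborel. (K0 * C\<^sub>\<beta> * snd z powr (- \<beta> - 1) * indicator {0<..} (snd z)) *\<^sub>R (a powr (?d - \<beta>) *\<^sub>R compensated_iexp (h z)))"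
      proof (rule integral_density)
        have "(\<lambda>z::'a \<times> real. K0 * C\<^sub>\<beta> * snd z powr (- \<beta> - 1) * indicator {0<..} (snd z)) \<in> borel_measurable (borel \<Otimes>\<^sub>M borel)"
          by measurable
        then show "(\<lambda>z::'a \<times> real. K0 * C\<^sub>\<beta> * snd z powr (- \<beta> - 1) * indicator {0<..} (snd z)) \<in> borel_measurable lborel"
          by (simp add: borel_prod)
      qed (use \<open>0 \<le> K0\<close> assms(7) in auto)
      also have "\<dots> = J"
        unfolding J_def by (simp add: ac_simps)
      finally show ?thesis by simp
    qed
    finally show ?thesis .
  qed
  show ?thesis
    unfolding converges_in_distribution_def
  proof (intro conjI allI impI)
    have "\<forall>\<^sub>F \<rho> in at_right (0::real). 0 < \<rho> \<and> \<rho> < b"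
      unfolding eventually_at_right_field using \<open>b > 0\<close> by blast
    then show "\<forall>\<^sub>F \<rho> in at_right 0. (\<lambda>\<omega>. \<chi> i. centered_mass_field (M \<rho>) (\<Phi> \<rho>) (\<mu> i) \<omega>) \<in> borel_measurable (M \<rho>)"
    proof eventually_elim
      case (elim \<rho>)
      then show ?case by (intro borel_measurable_vec field_meas) auto
    qed
    have lim_eq: "(\<lambda>\<omega>. \<chi> i. poisson_field N (limit_intensity (Re (K 0) * C\<^sub>\<beta>) \<beta>) Q (dilatation a (\<mu> i)) \<omega>) = (\<lambda>\<omega>. \<chi> i. Y i \<omega>)"
      by (simp add: Y_def m_def K0_def)
    show "(\<lambda>\<omega>. \<chi> i. poisson_field N (limit_intensity (Re (K 0) * C\<^sub>\<beta>) \<beta>) Q (dilatation a (\<mu> i)) \<omega>) \<in> borel_measurable N"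
      unfolding lim_eq by (intro borel_measurable_vec Y_meas)
    fix H :: "real ^ 'n \<Rightarrow> real" assume H: "continuous_on UNIV H \<and> bounded (range H)"
    show "((\<lambda>\<rho>. LINT \<omega>|M \<rho>. H (\<chi> i. centered_mass_field (M \<rho>) (\<Phi> \<rho>) (\<mu> i) \<omega>)) \<longlongrightarrow>
        (LINT \<omega>|N. H (\<chi> i. poisson_field N (limit_intensity (Re (K 0) * C\<^sub>\<beta>) \<beta>) Q (dilatation a (\<mu> i)) \<omega>))) (at_right 0)"
    \<comment> \<open>The continuity theorem is stated for sequences; testing along sequences in the
      interval (0, b) is enough for a right limit at 0.\<close>
    proof (rule tendsto_at_right_sequentially[OF \<open>b > 0\<close>])
      fix s :: "nat \<Rightarrow> real" assume s: "\<And>n. 0 < s n" "\<And>n. s n < b" "s \<longlonglongrightarrow> 0"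
      have "(\<lambda>n. LINT \<omega>|M (s n). H (\<chi> i. centered_mass_field (M (s n)) (\<Phi> (s n)) (\<mu> i) \<omega>)) \<longlonglongrightarrow>
          (LINT \<omega>|N. H (\<chi> i. Y i \<omega>))"
      proof (rule levy_continuity_euclidean[where h = H and Y = "\<lambda>\<omega>. \<chi> i. Y i \<omega>"
            and X = "\<lambda>n \<omega>. \<chi> i. centered_mass_field (M (s n)) (\<Phi> (s n)) (\<mu> i) \<omega>"])
        show "prob_space (M (s n))" for n by (rule field_prob[OF s(1,2)])
        show "(\<lambda>\<omega>. \<chi> i. centered_mass_field (M (s n)) (\<Phi> (s n)) (\<mu> i) \<omega>) \<in> borel_measurable (M (s n))" for n
          by (intro borel_measurable_vec field_meas s)
        show "prob_space N" by (rule P.prob_space_axioms)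
        show "(\<lambda>\<omega>. \<chi> i. Y i \<omega>) \<in> borel_measurable N"
          by (intro borel_measurable_vec Y_meas)
        show "(\<lambda>n. CLINT \<omega>|M (s n). iexp (t \<bullet> (\<chi> i. centered_mass_field (M (s n)) (\<Phi> (s n)) (\<mu> i) \<omega>))) \<longlonglongrightarrow>
            (CLINT \<omega>|N. iexp (t \<bullet> (\<chi> i. Y i \<omega>)))" for t
          unfolding inner_vec_sum by (rule char[OF s])
      qed (use H in auto)
      then show "(\<lambda>n. LINT \<omega>|M (s n). H (\<chi> i. centered_mass_field (M (s n)) (\<Phi> (s n)) (\<mu> i) \<omega>)) \<longlonglongrightarrow>
          (LINT \<omega>|N. H (\<chi> i. poisson_field N (limit_intensity (Re (K 0) * C\<^sub>\<beta>) \<beta>) Q (dilatation a (\<mu> i)) \<omega>))"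
        by (simp add: Y_def m_def K0_def)
    qed
  qed
qed

end
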